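(* Let $P,Q\in\mathbb{R}[x,y]$ be quadratic polynomials and consider the cubic Kolmogorov system $$\frac{dx}{dt}=xP(x,y),\qquad \frac{dy}{dt}=yQ(x,y).$$ If this system has four centers, then it has an elementary first integral in $\mathbb{R}^2\setminus\{(x,y):xy=0\}$ and it has no limit cycles. In the sense of equivalence, all the possible configurations of centers (over all such systems with four centers) are $(1;1;1;1)$, $(0;1;2;1)$ and $(0;1;1;2)$.
   Context: The coordinate axes are invariant, so all centers lie in open quadrants. A center is a critical point having a neighborhood filled with periodic orbits except for the point itself. A limit cycle is an isolated closed orbit. A first integral is a nonconstant function, constant along the orbits; elementary means expressed by elementary functions (here polynomials, real powers $|x|^\alpha,|y|^\beta$, and $\ln|x|,\ln|y|$). The system has configuration $(i_1;i_2;i_3;i_4)$ of centers if it has exactly $i_j$ centers in the interior of the $j$-th quadrant, $j=1,2,3,4$. Two configurations are equivalent if one is transformed to the other by a composition of the maps $(x,y)\mapsto(-x,y)$, $(x,y)\mapsto(x,-y)$, $(x,y)\mapsto(y,x)$. *)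

theory Defs
  imports "HOL-Analysis.Analysis" "HOL-Computational_Algebra.Polynomial"
begin

text \<open>
  Elements of \<open>\<real>[x,y]\<close> are represented in \<open>\<real>[x][y]\<close>: \<open>coeff (coeff P j) i\<close> is the
  coefficient of \<open>x\<^sup>i y\<^sup>j\<close>.
\<close>

definition eval2 :: "real poly poly \<Rightarrow> real \<Rightarrow> real \<Rightarrow> real" where
  "eval2 P x y = poly (poly P [:y:]) x"

definition quadratic :: "real poly poly \<Rightarrow> bool" where
  "quadratic P \<longleftrightarrow>
     (\<forall>i j. coeff (coeff P j) i \<noteq> 0 \<longrightarrow> i + j \<le> 2) \<and>
     (\<exists>i j. coeff (coeff P j) i \<noteq> 0 \<and> i + j = 2)"

definition kolmogorov :: "real poly poly \<Rightarrow> real poly poly \<Rightarrow> real \<times> real \<Rightarrow> real \<times> real" where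
  "kolmogorov P Q = (\<lambda>(x, y). (x * eval2 P x y, y * eval2 Q x y))"

definition solution_on :: "(real \<times> real \<Rightarrow> real \<times> real) \<Rightarrow> real set \<Rightarrow> (real \<Rightarrow> real \<times> real) \<Rightarrow> bool" where
  "solution_on F J g \<longleftrightarrow> (\<forall>t\<in>J. (g has_vector_derivative F (g t)) (at t within J))"

definition closed_orbit :: "(real \<times> real \<Rightarrow> real \<times> real) \<Rightarrow> (real \<times> real) set \<Rightarrow> bool" where
  "closed_orbit F C \<longleftrightarrow>
     (\<exists>g T. solution_on F UNIV g \<and> T > 0 \<and> (\<forall>t. g (t + T) = g t) \<and>
            \<not> g constant_on UNIV \<and> C = range g)"

definition limit_cycle :: "(real \<times> real \<Rightarrow> real \<times> real) \<Rightarrow> (real \<times> real) set \<Rightarrow> bool" where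
  "limit_cycle F C \<longleftrightarrow>
     closed_orbit F C \<and>
     (\<exists>U. open U \<and> C \<subseteq> U \<and> (\<forall>C'. closed_orbit F C' \<and> C' \<subseteq> U \<longrightarrow> C' = C))"

definition is_center :: "(real \<times> real \<Rightarrow> real \<times> real) \<Rightarrow> real \<times> real \<Rightarrow> bool" where
  "is_center F p \<longleftrightarrow>
     F p = 0 \<and>
     (\<exists>U. open U \<and> p \<in> U \<and> (\<forall>q \<in> U - {p}. \<exists>C. closed_orbit F C \<and> q \<in> C \<and> C \<subseteq> U - {p}))"

definition centers :: "(real \<times> real \<Rightarrow> real \<times> real) \<Rightarrow> (real \<times> real) set" where
  "centers F = {p. is_center F p}"

text \<open>
  Non-constancy is required on every nonempty open subset: \<open>\<real>\<^sup>2\<close> without the axes is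
  disconnected, and a function such as \<open>x * \<bar>x\<bar> powr (-1)\<close>, which is constant on each
  quadrant, must not count as a first integral.
\<close>

definition first_integral_on ::
    "(real \<times> real) set \<Rightarrow> (real \<times> real \<Rightarrow> real \<times> real) \<Rightarrow> (real \<times> real \<Rightarrow> real) \<Rightarrow> bool" where
  "first_integral_on D F H \<longleftrightarrow>
     (\<forall>U. open U \<and> U \<noteq> {} \<and> U \<subseteq> D \<longrightarrow> \<not> H constant_on U) \<and>
     (\<forall>J g. is_interval J \<and> solution_on F J g \<and> g ` J \<subseteq> D \<longrightarrow> (H \<circ> g) constant_on J)"

text \<open>
  Only the values off the coordinate axes matter; negative powers and logarithms take
  arbitrary library values on the axes.
\<close>

inductive_set elementary :: "(real \<times> real \<Rightarrow> real) set" where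
  polynomial: "(\<lambda>(x, y). eval2 R x y) \<in> elementary"
| powr_x: "(\<lambda>(x, y). \<bar>x\<bar> powr a) \<in> elementary"
| powr_y: "(\<lambda>(x, y). \<bar>y\<bar> powr b) \<in> elementary"
| ln_x: "(\<lambda>(x, y). ln \<bar>x\<bar>) \<in> elementary"
| ln_y: "(\<lambda>(x, y). ln \<bar>y\<bar>) \<in> elementary"
| add: "f \<in> elementary \<Longrightarrow> h \<in> elementary \<Longrightarrow> (\<lambda>p. f p + h p) \<in> elementary"
| mult: "f \<in> elementary \<Longrightarrow> h \<in> elementary \<Longrightarrow> (\<lambda>p. f p * h p) \<in> elementary"

definition quadrants :: "(real \<times> real) set list" where
  "quadrants =
     [{(x, y). x > 0 \<and> y > 0}, {(x, y). x < 0 \<and> y > 0},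
      {(x, y). x < 0 \<and> y < 0}, {(x, y). x > 0 \<and> y < 0}]"

text \<open>The configuration \<open>(i\<^sub>1; i\<^sub>2; i\<^sub>3; i\<^sub>4)\<close> is the list \<open>[i\<^sub>1, i\<^sub>2, i\<^sub>3, i\<^sub>4]\<close>.\<close>

definition configuration :: "(real \<times> real \<Rightarrow> real \<times> real) \<Rightarrow> nat list" where
  "configuration F = map (\<lambda>D. card (centers F \<inter> D)) quadrants"

inductive_set plane_symmetries :: "(real \<times> real \<Rightarrow> real \<times> real) set" where
  "id \<in> plane_symmetries"
| "g \<in> plane_symmetries \<Longrightarrow> (\<lambda>(x, y). (- x, y)) \<circ> g \<in> plane_symmetries"
| "g \<in> plane_symmetries \<Longrightarrow> (\<lambda>(x, y). (x, - y)) \<circ> g \<in> plane_symmetries"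
| "g \<in> plane_symmetries \<Longrightarrow> (\<lambda>(x, y). (y, x)) \<circ> g \<in> plane_symmetries"

definition config_equiv :: "nat list \<Rightarrow> nat list \<Rightarrow> bool" where
  "config_equiv c d \<longleftrightarrow>
     length c = 4 \<and> length d = 4 \<and>
     (\<exists>g \<in> plane_symmetries. \<forall>i<4. \<forall>j<4.
        g ` (quadrants ! i) = quadrants ! j \<longrightarrow> d ! j = c ! i)"

end

theory Submission imports Defs begin

text \<open>
  A quadratic polynomial vanishing at three points of a line vanishes on the whole line, and centers
  are isolated zeros; so no three of the four centers \<open>p\<^sub>i\<close> are collinear and the conics through them
  form the pencil spanned by \<open>P\<close> and \<open>Q\<close>. The Jacobian \<open>J\<^sub>i\<close> of \<open>(P, Q)\<close> at \<open>p\<^sub>i\<close> is then nonzero and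
  proportional to \<open>1/e\<^sub>i\<close>, where \<open>\<Sum>e\<^sub>i = 0\<close> and \<open>\<Sum>e\<^sub>i p\<^sub>i = 0\<close>. A Lyapunov function shows that a center with
  nonsingular linear part has determinant \<open>x\<^sub>i y\<^sub>i J\<^sub>i > 0\<close> and trace \<open>x P\<^sub>x + y Q\<^sub>y = 0\<close>. The signs of the
  determinants give the possible configurations. The trace is itself a conic through the \<open>p\<^sub>i\<close>, hence
  a combination of \<open>P\<close> and \<open>Q\<close>, and this says exactly that some \<open>\<bar>x\<bar>\<^sup>\<alpha> \<bar>y\<bar>\<^sup>\<beta>\<close> is an integrating factor.
  The resulting first integral \<open>H\<close> is regular along closed orbits, so that these come in families
  parametrised by \<open>H\<close>.
\<close>


section \<open>Solutions of autonomous differential equations\<close>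

text \<open>The trace condition turns into an integrating factor through the identity div(V F) = V
  (x P_x + y Q_y + m P + n Q) for V = |x|^(m-1) |y|^(n-1): once the conic x P_x + y Q_y is a
  combination of P and Q, its coefficients are -m and -n. The signs e_i x_i y_i > 0 and the two
  barycentric relations put a center into every half-plane bounded by an axis and into both pairs of
  opposite quadrants, and only the three listed classes satisfy this. What shapes the analytic part
  is that a center is defined by closed orbits alone. Nondegeneracy has to come from algebra before
  the linear part can say anything, and the conditions on the linear part are obtained by following
  orbits near p. The realization half runs the other way: trace 0 and positive determinant do not
  make a zero of a nonlinear field a center by themselves. It is the first integral that closes the
  orbits turning around p, so each example is built together with its integrating factor.\<close>

definition solves :: "('a::real_normed_vector \<Rightarrow> 'a) \<Rightarrow> (real \<Rightarrow> 'a) \<Rightarrow> bool" where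
  "solves F x \<longleftrightarrow> (\<forall>t. (x has_vector_derivative F (x t)) (at t))"

lemma solution_on_UNIV_iff: "solution_on F UNIV g \<longleftrightarrow> solves F g"
  by (simp add: solution_on_def solves_def)

lemma solvesD: "solves F x \<Longrightarrow> (x has_vector_derivative F (x t)) (at t)"
  by (simp add: solves_def)

lemma solves_continuous_on: "solves F x \<Longrightarrow> continuous_on S x"
  by (meson solvesD continuous_at_imp_continuous_on has_vector_derivative_continuous)

lemma solves_const: "F p = 0 \<Longrightarrow> solves F (\<lambda>_. p)"
  by (simp add: solves_def)

section \<open>Time translation, time reversal and continuous dependence\<close>

lemma solves_shift:
  assumes "solves F x"
  shows "solves F (\<lambda>t. x (t + a))"
  unfolding solves_def
proof
  fix t
  have "((\<lambda>t. t + a) has_real_derivative 1) (at t)"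
    by (auto intro!: derivative_eq_intros)
  from vector_diff_chain_at[OF this[unfolded has_real_derivative_iff_has_vector_derivative]
      solvesD[OF assms, of "t + a"]]
  show "((\<lambda>t. x (t + a)) has_vector_derivative F (x (t + a))) (at t)"
    by (simp add: o_def)
qed

lemma solves_reverse:
  assumes "solves F x"
  shows "solves (\<lambda>z. - F z) (\<lambda>t. x (a - t))"
  unfolding solves_def
proof
  fix t
  have "((\<lambda>t. a - t) has_real_derivative -1) (at t)"
    by (auto intro!: derivative_eq_intros)
  from vector_diff_chain_at[OF this[unfolded has_real_derivative_iff_has_vector_derivative]
      solvesD[OF assms, of "a - t"]]
  show "((\<lambda>t. x (a - t)) has_vector_derivative - F (x (a - t))) (at t)"
    by (simp add: o_def)
qed

text \<open>The squared distance, damped by exp(- 2 L t), is nonincreasing by Cauchy-Schwarz and the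
  Lipschitz bound. The curves have to stay in \<open>S\<close> only up to time \<tau>, so the
  estimate applies to orbits that remain in a ball for a while.\<close>

lemma gronwall:
  fixes F :: "'a::real_inner \<Rightarrow> 'a"
  assumes lip: "L-lipschitz_on S F"
    and x: "solves F x" and y: "solves F y"
    and S: "\<And>t. t \<in> {0..\<tau>} \<Longrightarrow> x t \<in> S" "\<And>t. t \<in> {0..\<tau>} \<Longrightarrow> y t \<in> S"
    and \<tau>: "0 \<le> \<tau>"
  shows "dist (x \<tau>) (y \<tau>) \<le> exp (L * \<tau>) * dist (x 0) (y 0)"
proof -
  define d where "d t = x t - y t" for t
  define N where "N t = exp (- (2 * L * t)) * (d t \<bullet> d t)" for t
  have d': "(d has_vector_derivative F (x t) - F (y t)) (at t)" for t
    unfolding d_def by (intro has_vector_derivative_diff solvesD x y)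
  have dd: "((\<lambda>t. d t \<bullet> d t) has_real_derivative 2 * (d t \<bullet> (F (x t) - F (y t)))) (at t)" for t
  proof -
    have "((\<lambda>t. d t \<bullet> d t) has_derivative (\<lambda>h. d t \<bullet> (h *\<^sub>R (F (x t) - F (y t))) + (h *\<^sub>R (F (x t) - F (y t))) \<bullet> d t)) (at t)"
      using d'[of t, unfolded has_vector_derivative_def] by (intro has_derivative_inner)
    thus ?thesis
      by (rule has_derivative_imp_has_field_derivative) (simp add: inner_commute)
  qed
  have N': "(N has_real_derivative exp (- (2 * L * t)) * (2 * (d t \<bullet> (F (x t) - F (y t))) - 2 * L * (d t \<bullet> d t))) (at t)" for t
    unfolding N_def by (rule derivative_eq_intros dd refl | simp add: algebra_simps)+
  have "N \<tau> \<le> N 0"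
  proof (rule DERIV_nonpos_imp_nonincreasing[OF \<tau>])
    fix t assume t: "0 \<le> t" "t \<le> \<tau>"
    have "d t \<bullet> (F (x t) - F (y t)) \<le> norm (d t) * norm (F (x t) - F (y t))"
      by (rule norm_cauchy_schwarz)
    also have "norm (F (x t) - F (y t)) \<le> L * norm (d t)"
      using lipschitz_onD[OF lip S[of t]] t by (simp add: d_def dist_norm)
    hence "norm (d t) * norm (F (x t) - F (y t)) \<le> norm (d t) * (L * norm (d t))"
      by (intro mult_left_mono) auto
    finally have "2 * (d t \<bullet> (F (x t) - F (y t))) - 2 * L * (d t \<bullet> d t) \<le> 0"
      by (simp add: dot_square_norm power2_eq_square algebra_simps)
    thus "\<exists>y. (N has_real_derivative y) (at t) \<and> y \<le> 0"
      using N'[of t] by (meson exp_ge_zero mult_nonneg_nonpos)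
  qed
  hence "exp (- (2 * L * \<tau>)) * (norm (d \<tau>))\<^sup>2 \<le> (norm (d 0))\<^sup>2"
    by (simp add: N_def dot_square_norm)
  hence "exp (2 * L * \<tau>) * (exp (- (2 * L * \<tau>)) * (norm (d \<tau>))\<^sup>2) \<le> exp (2 * L * \<tau>) * (norm (d 0))\<^sup>2"
    by (intro mult_left_mono) auto
  hence "(norm (d \<tau>))\<^sup>2 \<le> exp (2 * L * \<tau>) * (norm (d 0))\<^sup>2"
    by (simp add: exp_minus field_simps)
  also have "\<dots> = (exp (L * \<tau>) * norm (d 0))\<^sup>2"
    by (simp add: power_mult_distrib power2_eq_square flip: exp_add)
  finally have "norm (d \<tau>) \<le> exp (L * \<tau>) * norm (d 0)"
    by (rule power2_le_imp_le) auto
  thus ?thesis by (simp add: d_def dist_norm)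
qed

lemma gronwall_both:
  fixes F :: "'a::real_inner \<Rightarrow> 'a"
  assumes lip: "L-lipschitz_on S F"
    and x: "solves F x" and y: "solves F y"
    and S: "range x \<subseteq> S" "range y \<subseteq> S"
  shows "dist (x t) (y t) \<le> exp (L * \<bar>t - s\<bar>) * dist (x s) (y s)"
proof (cases "s \<le> t")
  case True
  show ?thesis
    using gronwall[OF lip solves_shift[OF x, of s] solves_shift[OF y, of s], of "t - s"] S True
    by auto
next
  case False
  show ?thesis
    using gronwall[OF lipschitz_on_minus[OF lip] solves_reverse[OF x, of s] solves_reverse[OF y, of s], of "s - t"]
      S False
    by auto
qed

lemma solves_unique:
  fixes F :: "'a::real_inner \<Rightarrow> 'a"
  assumes "L-lipschitz_on S F" "solves F x" "solves F y" "range x \<subseteq> S" "range y \<subseteq> S" "x s = y s"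
  shows "x = y"
proof
  fix t
  show "x t = y t"
    using gronwall_both[OF assms(1-5), of t s] assms(6) by simp
qed

text \<open>The difference of two integrals covers both signs of t, one of the two being 0. On a
  bounded interval it agrees up to a constant with the integral from - R, to which the fundamental
  theorem applies.\<close>

lemma antiderivative_real_line:
  fixes f :: "real \<Rightarrow> 'a::banach"
  assumes "continuous_on UNIV f"
  shows "\<exists>A. A 0 = 0 \<and> (\<forall>t. (A has_vector_derivative f t) (at t))"
proof -
  define A where "A t = integral {0..t} f - integral {t..0} f" for t
  have int: "f integrable_on {a..b}" for a b
    by (rule integrable_continuous_real) (rule continuous_on_subset[OF assms subset_UNIV])
  have A_eq: "A t = integral {-R..t} f - integral {-R..0} f" if "\<bar>t\<bar> \<le> R" for t R
  proof (cases "0 \<le> t")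
    case True
    have "integral {-R..0} f + integral {0..t} f = integral {-R..t} f"
      using True that by (intro Henstock_Kurzweil_Integration.integral_combine int) auto
    moreover have "integral {t..0} f = 0" using True by (cases "t = 0") auto
    ultimately show ?thesis by (simp add: A_def algebra_simps)
  next
    case False
    have "integral {-R..t} f + integral {t..0} f = integral {-R..0} f"
      using False that by (intro Henstock_Kurzweil_Integration.integral_combine int) auto
    moreover have "integral {0..t} f = 0" using False by auto
    ultimately show ?thesis by (simp add: A_def algebra_simps)
  qed
  have "(A has_vector_derivative f t) (at t)" for t
  proof -
    define R where "R = \<bar>t\<bar> + 1"
    have "((\<lambda>u. integral {-R..u} f) has_vector_derivative f t) (at t within {-R..R})"
      by (intro integral_has_vector_derivative continuous_on_subset[OF assms]) (auto simp: R_def)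
    hence "((\<lambda>u. integral {-R..u} f) has_vector_derivative f t) (at t)"
      by (subst (asm) at_within_interior) (auto simp: R_def)
    hence "((\<lambda>u. integral {-R..u} f - integral {-R..0} f) has_vector_derivative f t - 0) (at t)"
      by (intro has_vector_derivative_diff has_vector_derivative_const)
    hence *: "((\<lambda>u. integral {-R..u} f - integral {-R..0} f) has_vector_derivative f t) (at t)" by simp
    show ?thesis
      by (rule has_vector_derivative_transform_within_open[OF *, of "{-R<..<R}"])
        (auto simp: R_def A_eq[of _ R, unfolded R_def])
  qed
  thus ?thesis by (intro exI[of _ A]) (auto simp: A_def)
qed

lemma weighted_bound_forward:
  fixes A :: "real \<Rightarrow> 'a::real_normed_vector"
  assumes A: "\<And>t. (A has_vector_derivative f t) (at t)" "A 0 = 0"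
    and f: "\<And>t. norm (f t) \<le> K * exp (c * \<bar>t\<bar>)" and c: "c > 0" and t: "0 \<le> t"
  shows "norm (A t) \<le> K / c * (exp (c * t) - 1)"
proof (cases "t = 0")
  case False
  have "norm (A t - A 0) \<le> K / c * exp (c * t) - K / c * exp (c * 0)"
  proof (rule differentiable_bound_general)
    show "0 < t" using t False by simp
    show "continuous_on {0..t} A"
      using A(1) by (meson continuous_at_imp_continuous_on has_vector_derivative_continuous)
    show "continuous_on {0..t} (\<lambda>t. K / c * exp (c * t))" by (intro continuous_intros)
    show "((\<lambda>t. K / c * exp (c * t)) has_vector_derivative K * exp (c * s)) (at s)" for s
      using c by (auto intro!: derivative_eq_intros simp flip: has_real_derivative_iff_has_vector_derivative)
  qed (use A f in \<open>auto intro: order_trans[OF f]\<close>)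
  thus ?thesis using A(2) by (simp add: algebra_simps)
qed (use A(2) in simp)

text \<open>This is the gain from an exponential weight: integration from 0 turns a bound K exp(c
  |t|) into one with K / c, so a large c makes integration contracting. Negative times follow by
  reflection.\<close>

lemma weighted_bound:
  fixes A :: "real \<Rightarrow> 'a::real_normed_vector"
  assumes A: "\<And>t. (A has_vector_derivative f t) (at t)" "A 0 = 0"
    and f: "\<And>t. norm (f t) \<le> K * exp (c * \<bar>t\<bar>)" and c: "c > 0"
  shows "norm (A t) \<le> K / c * (exp (c * \<bar>t\<bar>) - 1)"
proof (cases "0 \<le> t")
  case True thus ?thesis using weighted_bound_forward[OF A f c, of t] by simp
next
  case False
  have "((\<lambda>t. A (- t)) has_vector_derivative - f (- t)) (at t)" for t
  proof -
    have "((\<lambda>t. - t) has_vector_derivative (-1::real)) (at t)"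
      by (auto intro!: derivative_eq_intros simp flip: has_real_derivative_iff_has_vector_derivative)
    from vector_diff_chain_at[OF this A(1)[of "- t"]] show ?thesis by (simp add: o_def)
  qed
  from weighted_bound_forward[OF this, of K c "- t"] A(2) f c False show ?thesis
    by (metis abs_minus_cancel abs_of_nonneg add.inverse_inverse linear neg_0_le_iff_le norm_minus_cancel minus_zero)
qed

text \<open>
  Picard iteration on the whole line at once: in the norm \<open>sup \<bar>x t\<bar> exp (- 2 L \<bar>t\<bar>)\<close> the integral
  operator is a contraction with constant 1/2.
\<close>

lemma lipschitz_global_solution:
  fixes G :: "'a::banach \<Rightarrow> 'a"
  assumes "L0-lipschitz_on UNIV G"
  shows "\<exists>x. x 0 = q \<and> solves G x"
proof -
  \<comment> \<open>\<open>L0\<close> may be 0; adding 1 makes the rate c positive, so that dividing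
    by it is harmless.\<close>
  define L where "L = L0 + 1"
  have L0: "0 \<le> L0" using assms by (rule lipschitz_on_nonneg)
  hence L: "L > 0" by (simp add: L_def)
  have lip: "dist (G a) (G b) \<le> L * dist a b" for a b
    using lipschitz_onD[OF assms, of a b] mult_right_mono[of L0 L "dist a b"] by (simp add: L_def)
  have contG: "continuous_on UNIV G" using assms by (rule lipschitz_on_continuous_on)
  define c where "c = 2 * L"
  have c: "c > 0" using L by (simp add: c_def)
  define w where "w t = exp (c * \<bar>t\<bar>)" for t :: real
  have w: "w t > 0" "w t \<ge> 1" for t using c by (auto simp: w_def)
  have w_cont: "continuous_on S w" for S unfolding w_def by (intro continuous_intros)
  \<comment> \<open>The bounded function z stands for the curve x = w z, so the sup norm of z is the
    weighted norm of x.\<close>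
  define f where "f z s = G (w s *\<^sub>R apply_bcontfun z s)" for z s
  have f_cont: "continuous_on UNIV (f z)" for z
    unfolding f_def by (intro continuous_on_compose2[OF contG] continuous_intros w_cont continuous_on_apply_bcontfun) auto
  define A where "A z = (SOME A. A 0 = 0 \<and> (\<forall>t. (A has_vector_derivative f z t) (at t)))" for z
  have A: "A z 0 = 0" "(A z has_vector_derivative f z t) (at t)" for z t
    using someI_ex[OF antiderivative_real_line[OF f_cont[of z]]] by (auto simp: A_def)
  have A_cont: "continuous_on S (A z)" for S z
    using A(2) by (meson continuous_at_imp_continuous_on has_vector_derivative_continuous)
  define T where "T z t = inverse (w t) *\<^sub>R (q + A z t)" for z t
  have T_bcont: "T z \<in> bcontfun" for z
  proof (rule bcontfun_normI)
    show "continuous_on UNIV (T z)"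
      unfolding T_def using w by (intro continuous_intros w_cont A_cont) (metis less_irrefl)
    define K where "K = norm (G 0) + L * norm z"
    have K: "norm (f z s) \<le> K * exp (c * \<bar>s\<bar>)" for s
    proof -
      have "norm (f z s) \<le> norm (G 0) + L * norm (w s *\<^sub>R apply_bcontfun z s)"
        using lip[of "w s *\<^sub>R apply_bcontfun z s" 0] norm_triangle_sub[of "f z s" "G 0"]
        by (simp add: f_def dist_norm)
      also have "\<dots> \<le> norm (G 0) * w s + L * (w s * norm z)"
        using w[of s] L norm_bounded[of z s]
        by (intro add_mono mult_left_mono) (auto simp: mult_le_cancel_left1)
      finally show ?thesis by (simp add: K_def w_def algebra_simps)
    qed
    have "norm (A z t) \<le> K / c * (w t - 1)" for t
      unfolding w_def by (rule weighted_bound[OF A(2) A(1) K c])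
    moreover have "K \<ge> 0" using L by (simp add: K_def)
    ultimately have Az: "norm (A z t) \<le> K / c * w t" for t
      using c by (smt (verit) divide_nonneg_pos mult_left_mono)
    show "norm (T z t) \<le> norm q + K / c" for t
    proof -
      have "norm (T z t) = inverse (w t) * norm (q + A z t)" using w[of t] by (simp add: T_def)
      also have "\<dots> \<le> inverse (w t) * (norm q * w t + K / c * w t)"
        using w[of t] Az[of t] norm_triangle_ineq[of q "A z t"] mult_left_mono[of 1 "w t" "norm q"]
        by (intro mult_left_mono) auto
      also have "\<dots> = norm q + K / c" using w[of t] by (simp add: field_simps)
      finally show ?thesis .
    qed
  qed
  define \<Phi> where "\<Phi> z = Bcontfun (T z)" for z
  have \<Phi>: "apply_bcontfun (\<Phi> z) = T z" for z
    using T_bcont by (simp add: \<Phi>_def Bcontfun_inverse)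
  have "dist (\<Phi> y) (\<Phi> z) \<le> 1/2 * dist y z" for y z
  proof (rule dist_bound)
    fix t
    have "norm (A y t - A z t) \<le> L * dist y z / c * (w t - 1)"
      unfolding w_def
    proof (rule weighted_bound)
      show "((\<lambda>t. A y t - A z t) has_vector_derivative f y t - f z t) (at t)" for t
        by (intro has_vector_derivative_diff A)
      show "norm (f y t - f z t) \<le> L * dist y z * exp (c * \<bar>t\<bar>)" for t
      proof -
        have "norm (f y t - f z t) \<le> L * dist (w t *\<^sub>R apply_bcontfun y t) (w t *\<^sub>R apply_bcontfun z t)"
          using lip by (simp add: f_def dist_norm)
        also have "\<dots> = L * (w t * dist (apply_bcontfun y t) (apply_bcontfun z t))"
          using w[of t] by (simp add: dist_norm flip: scaleR_diff_right)
        also have "\<dots> \<le> L * (w t * dist y z)"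
          using L w[of t] dist_bounded[of y t z] by (intro mult_left_mono) auto
        finally show ?thesis by (simp add: w_def algebra_simps)
      qed
    qed (use A c in auto)
    also have "\<dots> \<le> 1/2 * dist y z * w t"
      using L by (simp add: c_def field_simps)
    finally have "norm (A y t - A z t) \<le> 1/2 * dist y z * w t" .
    hence "inverse (w t) * norm (A y t - A z t) \<le> inverse (w t) * (1/2 * dist y z * w t)"
      using w[of t] by (intro mult_left_mono) auto
    moreover have "dist (apply_bcontfun (\<Phi> y) t) (apply_bcontfun (\<Phi> z) t) = inverse (w t) * norm (A y t - A z t)"
      using w[of t] by (simp add: \<Phi> T_def dist_norm flip: scaleR_diff_right)
    moreover have "inverse (w t) * (1/2 * dist y z * w t) = 1/2 * dist y z"
      using w[of t] by simp
    ultimately show "dist (apply_bcontfun (\<Phi> y) t) (apply_bcontfun (\<Phi> z) t) \<le> 1/2 * dist y z"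
      by linarith
  qed
  hence "\<exists>!z. \<Phi> z = z"
    using banach_fix_type[of "1/2" \<Phi>] by auto
  then obtain z where z: "\<Phi> z = z" by blast
  define x where "x t = q + A z t" for t
  have xz: "x t = w t *\<^sub>R apply_bcontfun z t" for t
    using w[of t] \<Phi>[of z] z by (simp add: x_def T_def)
  have "(x has_vector_derivative G (x t)) (at t)" for t
  proof -
    have "(x has_vector_derivative 0 + f z t) (at t)"
      unfolding x_def by (intro has_vector_derivative_add has_vector_derivative_const A)
    thus ?thesis by (simp add: f_def xz)
  qed
  moreover have "x 0 = q" using A by (simp add: x_def)
  ultimately show ?thesis by (auto simp: solves_def)
qed

section \<open>Locally Lipschitz fields\<close>

definition locally_lip :: "('a::real_normed_vector \<Rightarrow> 'a) \<Rightarrow> bool" where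
  "locally_lip F \<longleftrightarrow> (\<forall>R. \<exists>L. L-lipschitz_on (cball 0 R) F)"

lemma locally_lip_bounded:
  assumes "locally_lip F" "bounded S"
  obtains L where "L-lipschitz_on S F"
proof -
  obtain R where "S \<subseteq> cball 0 R"
    using assms(2) by (auto simp: bounded_iff subset_iff)
  thus ?thesis using assms(1) that unfolding locally_lip_def by (meson lipschitz_on_subset)
qed

text \<open>Compose with the nearest-point projection onto a ball containing \<open>S\<close>, which
  is 1-Lipschitz. Solutions of \<open>G\<close> exist for all times, and they solve the equation of
  \<open>F\<close> as long as they stay in \<open>S\<close>.\<close>

lemma locally_lip_extend:
  fixes F :: "'a::euclidean_space \<Rightarrow> 'a"
  assumes "locally_lip F" "bounded S"
  obtains G L where "L-lipschitz_on UNIV G" "\<And>z. z \<in> S \<Longrightarrow> G z = F z"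
proof -
  obtain R0 where R0: "S \<subseteq> cball 0 R0"
    using assms(2) by (auto simp: bounded_iff subset_iff)
  define B where "B = cball (0::'a) (max R0 0)"
  have B: "convex B" "closed B" "B \<noteq> {}" "S \<subseteq> B" using R0 by (auto simp: B_def)
  obtain L where L: "L-lipschitz_on B F" using assms(1) by (auto simp: locally_lip_def B_def)
  have "L-lipschitz_on UNIV (\<lambda>z. F (closest_point B z))"
  proof (rule lipschitz_onI)
    fix x y
    have "dist (F (closest_point B x)) (F (closest_point B y)) \<le> L * dist (closest_point B x) (closest_point B y)"
      using B by (intro lipschitz_onD[OF L] closest_point_in_set)
    also have "\<dots> \<le> L * dist x y"
      using B lipschitz_on_nonneg[OF L] by (intro mult_left_mono closest_point_lipschitz)
    finally show "dist (F (closest_point B x)) (F (closest_point B y)) \<le> L * dist x y" .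
  qed (use lipschitz_on_nonneg[OF L] in auto)
  thus ?thesis using B that[of L "\<lambda>z. F (closest_point B z)"] by (auto simp: closest_point_self subset_iff)
qed

section \<open>Closed orbits and a criterion for not being a center\<close>

lemma closed_orbitE:
  assumes "closed_orbit F C"
  obtains g T where "solves F g" "T > 0" "\<And>t. g (t + T) = g t" "\<not> g constant_on UNIV" "C = range g"
  using assms by (auto simp: closed_orbit_def solution_on_UNIV_iff)

lemma closed_orbitI:
  assumes "solves F g" "T > 0" "\<And>t. g (t + T) = g t" "F (g s) \<noteq> 0"
  shows "closed_orbit F (range g)"
proof -
  have "\<not> g constant_on UNIV"
  proof
    assume "g constant_on UNIV"
    then obtain c where "g = (\<lambda>_. c)" by (auto simp: constant_on_def)
    hence "(g has_vector_derivative 0) (at s)" by simp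
    with solvesD[OF assms(1), of s] assms(4) show False
      using vector_derivative_unique_at by blast
  qed
  thus ?thesis using assms by (auto simp: closed_orbit_def solution_on_UNIV_iff)
qed

lemma periodic_add_int:
  fixes g :: "real \<Rightarrow> 'a"
  assumes "\<And>t. g (t + T) = g t"
  shows "g (t + of_int n * T) = g t"
proof (induction n rule: int_induct[where k = 0])
  case (step1 i)
  thus ?case using assms[of "t + of_int i * T"] by (simp add: algebra_simps)
next
  case (step2 i)
  thus ?case using assms[of "t + of_int i * T - T"] by (simp add: algebra_simps)
qed simp

lemma periodic_range:
  fixes g :: "real \<Rightarrow> 'a"
  assumes "\<And>t. g (t + T) = g t" "T > 0"
  shows "range g = g ` {a..a + T}"
proof
  show "range g \<subseteq> g ` {a..a + T}"
  proof safe
    fix t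
    define n where "n = - \<lfloor>(t - a) / T\<rfloor>"
    have "of_int \<lfloor>(t - a) / T\<rfloor> * T \<le> t - a" "t - a \<le> (of_int \<lfloor>(t - a) / T\<rfloor> + 1) * T"
      using assms(2) floor_divide_lower floor_divide_upper less_imp_le by blast+
    hence "t + of_int n * T \<in> {a..a + T}" by (auto simp: n_def algebra_simps)
    thus "g t \<in> g ` {a..a + T}" using periodic_add_int[of g T, OF assms(1), of t n] by (metis imageI)
  qed
qed auto

lemma compact_closed_orbit:
  assumes "closed_orbit F C"
  shows "compact C"
proof -
  from assms obtain g and T :: real where g: "solves F g" "T > 0" "\<And>t. g (t + T) = g t" "C = range g"
    by (metis closed_orbitE)
  have "C = g ` {0..0 + T}" using periodic_range[of g T, OF g(3,2), of 0] g(4) by blast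
  thus ?thesis using compact_continuous_image[OF solves_continuous_on[OF g(1)]] by auto
qed

lemma closed_orbit_at:
  assumes "closed_orbit F C" "q \<in> C"
  obtains g T where "solves F g" "T > 0" "\<And>t. g (t + T) = g t" "C = range g" "g 0 = q"
proof -
  from assms obtain g and T :: real where g: "solves F g" "T > 0" "\<And>t. g (t + T) = g t" "C = range g"
    by (metis closed_orbitE)
  then obtain a where a: "q = g a" using assms(2) by auto
  show ?thesis
  proof (rule that[of "\<lambda>t. g (t + a)" T])
    show "g (t + T + a) = g (t + a)" for t using g(3)[of "t + a"] by (simp add: algebra_simps)
    show "C = range (\<lambda>t. g (t + a))"
      using g(4) by (auto simp: image_iff) (metis diff_add_cancel)
  qed (use g a solves_shift in auto)
qed

text \<open>A zero of \<open>F\<close> on the orbit would also be a constant solution, and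
  uniqueness would make the whole orbit constant. Compactness of the orbit supplies the Lipschitz
  constant.\<close>

lemma closed_orbit_nonsingular:
  assumes "locally_lip F" "closed_orbit F C" "q \<in> C"
  shows "F q \<noteq> (0 :: real \<times> real)"
proof
  assume 0: "F q = 0"
  from assms obtain g where g: "solves F g" "\<not> g constant_on UNIV" "C = range g"
    by (metis closed_orbitE)
  then obtain a where a: "q = g a" using assms(3) by auto
  obtain L where L: "L-lipschitz_on C F"
    using locally_lip_bounded[OF assms(1)] compact_closed_orbit[OF assms(2)] compact_imp_bounded by metis
  have "g = (\<lambda>_. q)"
    by (rule solves_unique[OF L g(1) solves_const[of F q, OF 0], of a]) (use g a assms in auto)
  thus False using g(2) by (auto simp: constant_on_def)
qed

text \<open>Take the least element of the compact set of times at which \<open>f\<close> equals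
  \<open>e\<close>; a larger value before it would, by the intermediate value theorem, produce a
  still earlier such time.\<close>

lemma first_exit:
  fixes f :: "real \<Rightarrow> real"
  assumes "continuous_on {0..s} f" "f 0 \<le> e" "f s \<ge> e" "0 \<le> s"
  obtains t where "t \<in> {0..s}" "f t = e" "\<And>u. u \<in> {0..t} \<Longrightarrow> f u \<le> e"
proof -
  define A where "A = {t \<in> {0..s}. f t = e}"
  have "A = {0..s} \<inter> f -` {e}" by (auto simp: A_def)
  hence "closed A" using continuous_closed_preimage[OF assms(1) closed_atLeastAtMost closed_singleton] by simp
  moreover have "bounded A" by (rule bounded_subset[of "{0..s}"]) (auto simp: A_def)
  ultimately have "compact A" by (simp add: compact_eq_bounded_closed)
  moreover obtain x where "x \<in> A"
    using IVT'[of f 0 e s] assms by (auto simp: A_def)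
  ultimately obtain t where t: "t \<in> A" "\<And>u. u \<in> A \<Longrightarrow> t \<le> u"
    using compact_attains_inf[of A] by auto
  show ?thesis
  proof (rule that[of t])
    fix u assume u: "u \<in> {0..t}"
    show "f u \<le> e"
    proof (rule ccontr)
      assume n: "\<not> f u \<le> e"
      have "continuous_on {0..u} f" using assms(1) by (rule continuous_on_subset) (use u t in \<open>auto simp: A_def\<close>)
      then obtain v where "0 \<le> v" "v \<le> u" "f v = e" using IVT'[of f 0 e u] n assms(2) u by auto
      hence "v \<in> A" "v \<noteq> u" using u t n by (auto simp: A_def)
      with t(2)[of v] \<open>v \<le> u\<close> u show False by auto
    qed
  qed (use t in \<open>auto simp: A_def\<close>)
qed

lemma no_closed_orbit_of_increasing:
  fixes F :: "real \<times> real \<Rightarrow> real \<times> real"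
  assumes W: "\<And>z. z \<in> S \<Longrightarrow> (W has_derivative W' z) (at z)" "\<And>z. z \<in> S \<Longrightarrow> W' z (F z) > (0::real)"
    and C: "closed_orbit F C"
  shows "\<not> C \<subseteq> S"
proof
  assume sub: "C \<subseteq> S"
  from C obtain g and T :: real where g: "solves F g" "T > 0" "\<And>t. g (t + T) = g t" "C = range g"
    by (metis closed_orbitE)
  have "W (g 0) < W (g T)"
  proof (rule DERIV_pos_imp_increasing[OF g(2), of "\<lambda>t. W (g t)"])
    fix t
    have gt: "g t \<in> S" using g sub by auto
    have "((W \<circ> g) has_derivative (W' (g t) \<circ> (\<lambda>h. h *\<^sub>R F (g t)))) (at t)"
      using solvesD[OF g(1), of t] W(1)[OF gt] by (intro diff_chain_at) (auto simp: has_vector_derivative_def)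
    moreover have "W' (g t) \<circ> (\<lambda>h. h *\<^sub>R F (g t)) = (\<lambda>h. h * W' (g t) (F (g t)))"
      by (intro ext) (simp add: linear_cmul[OF has_derivative_linear[OF W(1)[OF gt]], of _ "F (g t)"])
    ultimately have "((\<lambda>t. W (g t)) has_real_derivative W' (g t) (F (g t))) (at t)"
      by (simp add: has_field_derivative_def o_def mult.commute[of _ "W' (g t) (F (g t))"])
    thus "\<exists>y. ((\<lambda>t. W (g t)) has_real_derivative y) (at t) \<and> y > 0"
      using W(2)[OF gt] by blast
  qed
  moreover have "g T = g 0" using g(3)[of 0] by simp
  ultimately show False by simp
qed

text \<open>
  The closed orbits through points tending to \<open>p\<close> must leave the ball, at points \<open>r\<^sub>n\<close> of the sphere;
  the backward orbit of an accumulation point \<open>r\<close> never leaves the ball, and being a closed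
  orbit this is all of it, although \<open>W\<close> increases along it.
\<close>

lemma not_center_of_increasing:
  fixes F :: "real \<times> real \<Rightarrow> real \<times> real"
  assumes F: "locally_lip F" "F p = 0" and \<epsilon>: "\<epsilon> > 0"
    and W: "\<And>z. z \<in> cball p \<epsilon> - {p} \<Longrightarrow> (W has_derivative W' z) (at z)"
           "\<And>z. z \<in> cball p \<epsilon> - {p} \<Longrightarrow> W' z (F z) > (0::real)"
  shows "\<not> is_center F p"
proof
  assume "is_center F p"
  then obtain U where U: "open U" "p \<in> U"
    and orb: "\<And>q. q \<in> U - {p} \<Longrightarrow> \<exists>C. closed_orbit F C \<and> q \<in> C \<and> C \<subseteq> U - {p}"
    by (auto simp: is_center_def)
  obtain e0 where e0: "e0 > 0" "cball p e0 \<subseteq> U" using U open_contains_cball by blast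
  define e where "e = min \<epsilon> e0"
  have e: "e > 0" "cball p e \<subseteq> U" "cball p e \<subseteq> cball p \<epsilon>"
    using e0 \<epsilon> by (auto simp: e_def)
  have leave: "\<not> C \<subseteq> cball p e" if "closed_orbit F C" "C \<subseteq> U - {p}" for C
    using no_closed_orbit_of_increasing[of "cball p e - {p}" W W' F C] W e that by blast
  \<comment> \<open>Points of a horizontal ray tending to p; the summand 2 keeps even the one for n
    = 0 strictly inside the ball.\<close>
  define q where "q n = p + (e / (real n + 2), 0)" for n
  have q: "q n \<in> U - {p}" "dist (q n) p < e" for n
  proof -
    have "dist (q n) p = e / (real n + 2)" using e by (simp add: q_def dist_norm norm_Pair)
    moreover have "\<dots> < e" using e(1) by (simp add: divide_less_eq algebra_simps add_pos_nonneg)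
    ultimately show "dist (q n) p < e" by simp
    hence "q n \<in> cball p e" by (simp add: dist_commute)
    moreover have "q n \<noteq> p" using e(1) by (simp add: q_def zero_prod_def)
    ultimately show "q n \<in> U - {p}" using e by auto
  qed
  have q_lim: "(\<lambda>n. dist (q n) p) \<longlonglongrightarrow> 0"
  proof -
    have "(\<lambda>n. e / real (n + 2)) \<longlonglongrightarrow> 0" by (rule LIMSEQ_ignore_initial_segment) (rule lim_const_over_n)
    hence "(\<lambda>n. e / (real n + 2)) \<longlonglongrightarrow> 0" by (simp add: add.commute)
    moreover have "dist (q n) p = e / (real n + 2)" for n using e by (simp add: q_def dist_norm norm_Pair)
    ultimately show ?thesis by simp
  qed
  have "\<forall>n. \<exists>h. solves F (fst h) \<and> fst h 0 = q n \<and> 0 \<le> snd h \<and> dist (fst h (snd h)) p = e \<and>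
      (\<forall>u\<in>{0..snd h}. dist (fst h u) p \<le> e)"
  proof
    fix n
    obtain C where C: "closed_orbit F C" "q n \<in> C" "C \<subseteq> U - {p}" using orb[OF q(1)] by blast
    obtain g T where g: "solves F g" "T > 0" "\<And>t. g (t + T) = g t" "C = range g" "g 0 = q n"
      using closed_orbit_at[OF C(1,2)] by blast
    obtain s where s: "s \<in> {0..0 + T}" "g s \<notin> cball p e"
      using leave[OF C(1,3)] unfolding g(4) periodic_range[of g T, OF g(3,2), of 0] image_subset_iff by blast
    obtain t where "t \<in> {0..s}" "dist (g t) p = e" "\<And>u. u \<in> {0..t} \<Longrightarrow> dist (g u) p \<le> e"
    proof (rule first_exit)
      show "continuous_on {0..s} (\<lambda>t. dist (g t) p)"
        by (intro continuous_intros solves_continuous_on[OF g(1)])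
      show "dist (g 0) p \<le> e" using q(2)[of n] g(5) by simp
    qed (use s in \<open>auto simp: dist_commute\<close>)
    thus "\<exists>h. solves F (fst h) \<and> fst h 0 = q n \<and> 0 \<le> snd h \<and> dist (fst h (snd h)) p = e \<and>
      (\<forall>u\<in>{0..snd h}. dist (fst h u) p \<le> e)" using g by (intro exI[of _ "(g, t)"]) auto
  qed
  from choice[OF this] obtain h where h: "\<forall>n. solves F (fst (h n)) \<and> fst (h n) 0 = q n \<and> 0 \<le> snd (h n) \<and>
      dist (fst (h n) (snd (h n))) p = e \<and> (\<forall>u\<in>{0..snd (h n)}. dist (fst (h n) u) p \<le> e)"
    by (rule exE)
  define g where "g n = fst (h n)" for n
  define t where "t n = snd (h n)" for n
  have g: "solves F (g n)" "g n 0 = q n" for n using spec[OF h, of n] by (simp_all add: g_def)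
  have t: "0 \<le> t n" "dist (g n (t n)) p = e" for n using spec[OF h, of n] by (simp_all add: g_def t_def)
  have tu: "dist (g n u) p \<le> e" if "u \<in> {0..t n}" for n u using spec[OF h, of n] that by (simp add: g_def t_def)
  obtain L where L: "L-lipschitz_on (cball p e) F" using locally_lip_bounded[OF F(1) bounded_cball] .
  \<comment> \<open>The exit times tend to infinity: comparison with the constant solution p shows
    that an orbit starting at \<open>q n\<close> is still within exp(L s)
    \<open>dist (q n) p\<close> of p at time s, as long as it has stayed in the ball.\<close>
  have late: "\<forall>\<^sub>F n in sequentially. s \<le> t n" for s
  proof -
    have "(\<lambda>n. exp (L * s) * dist (q n) p) \<longlonglongrightarrow> exp (L * s) * 0"
      by (intro tendsto_intros q_lim)
    hence "\<forall>\<^sub>F n in sequentially. exp (L * s) * dist (q n) p < e"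
      using e(1) by (intro order_tendstoD(2)[of _ "exp (L * s) * 0"]) auto
    thus ?thesis
    proof eventually_elim
      case (elim n)
      have "dist (g n (t n)) p \<le> exp (L * t n) * dist (q n) p"
        using gronwall[OF L g(1) solves_const[of F p] _ _ t(1)[of n]] tu F(2) e(1)
        by (auto simp: dist_commute g(2))
      hence 1: "e \<le> exp (L * t n) * dist (q n) p" using t(2) by simp
      show ?case
      proof (rule ccontr)
        assume "\<not> s \<le> t n"
        hence "exp (L * t n) \<le> exp (L * s)" using lipschitz_on_nonneg[OF L] by (simp add: mult_left_mono)
        hence "exp (L * t n) * dist (q n) p \<le> exp (L * s) * dist (q n) p" by (intro mult_right_mono) auto
        with 1 elim show False by linarith
      qed
    qed
  qed
  have "\<And>n. g n (t n) \<in> sphere p e" using t(2) by (simp add: dist_commute)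
  then obtain r \<sigma> where r: "r \<in> sphere p e" "strict_mono \<sigma>" "((\<lambda>n. g n (t n)) \<circ> \<sigma>) \<longlonglongrightarrow> r"
    using compact_sphere[of p e] unfolding compact_def by metis
  have "r \<in> U - {p}" using r(1) e by auto
  then obtain C where C: "closed_orbit F C" "r \<in> C" "C \<subseteq> U - {p}" using orb by blast
  obtain z T where z: "solves F z" "T > 0" "\<And>t. z (t + T) = z t" "C = range z" "z 0 = r"
    using closed_orbit_at[OF C(1,2)] by blast
  obtain s' where s': "s' \<in> {-T..-T + T}" "z s' \<notin> cball p e"
    using leave[OF C(1,3)] unfolding z(4) periodic_range[of z T, OF z(3,2), of "-T"] image_subset_iff by blast
  \<comment> \<open>After the time span s the backward orbit of r is outside the closed ball. With s
    fixed, the approximating orbits eventually spend at least time s in the ball before they reach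
    the sphere.\<close>
  define s where "s = - s'"
  have s: "0 \<le> s" "z (0 - s) \<notin> cball p e" using s' by (auto simp: s_def)
  obtain L' where L': "L'-lipschitz_on (cball p e \<union> C) F"
    using locally_lip_bounded[OF F(1)] compact_closed_orbit[OF C(1)] compact_imp_bounded bounded_cball bounded_Un
    by metis
  \<comment> \<open>Followed backward from their exit points, the approximating orbits stay close to
    the orbit of r for time s while inside the closed ball; so \<open>z (0 - s)\<close> is a limit
    of points of that ball.\<close>
  have ev: "\<forall>\<^sub>F n in sequentially. dist (g (\<sigma> n) (t (\<sigma> n) - s)) (z (0 - s)) \<le> exp (L' * s) * dist (((\<lambda>n. g n (t n)) \<circ> \<sigma>) n) r \<and>
      g (\<sigma> n) (t (\<sigma> n) - s) \<in> cball p e"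
    using eventually_subseq[OF r(2) late[of s]]
  proof eventually_elim
    case (elim n)
    have "dist (g (\<sigma> n) (t (\<sigma> n) - s)) (z (0 - s)) \<le> exp (L' * s) * dist (g (\<sigma> n) (t (\<sigma> n) - 0)) (z (0 - 0))"
    proof (rule gronwall[OF lipschitz_on_minus[OF L'] solves_reverse[OF g(1)] solves_reverse[OF z(1)]])
      fix u assume "u \<in> {0..s}"
      thus "g (\<sigma> n) (t (\<sigma> n) - u) \<in> cball p e \<union> C"
        using tu[of "t (\<sigma> n) - u" "\<sigma> n"] elim by (auto simp: dist_commute)
    qed (use s z in auto)
    thus ?case using tu[of "t (\<sigma> n) - s" "\<sigma> n"] elim s z by (auto simp: dist_commute)
  qed
  have "(\<lambda>n. exp (L' * s) * dist (((\<lambda>n. g n (t n)) \<circ> \<sigma>) n) r) \<longlonglongrightarrow> exp (L' * s) * dist r r"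
    by (intro tendsto_intros r(3))
  hence lim0: "(\<lambda>n. exp (L' * s) * dist (((\<lambda>n. g n (t n)) \<circ> \<sigma>) n) r) \<longlonglongrightarrow> 0" by simp
  have "(\<lambda>n. dist (g (\<sigma> n) (t (\<sigma> n) - s)) (z (0 - s))) \<longlonglongrightarrow> 0"
    by (rule tendsto_sandwich[OF _ _ tendsto_const lim0]) (use ev in \<open>auto elim: eventually_mono\<close>)
  hence "(\<lambda>n. g (\<sigma> n) (t (\<sigma> n) - s)) \<longlonglongrightarrow> z (0 - s)" by (rule iffD2[OF tendsto_dist_iff])
  moreover have "\<forall>\<^sub>F n in sequentially. g (\<sigma> n) (t (\<sigma> n) - s) \<in> cball p e"
    using ev by (rule eventually_mono) (elim conjE)
  ultimately have "z (0 - s) \<in> cball p e"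
    by (intro Lim_in_closed_set[OF closed_cball]) auto
  with s(2) show False by simp
qed

section \<open>Centers of vector fields with an integrating factor\<close>

definition cross :: "real \<times> real \<Rightarrow> real \<times> real \<Rightarrow> real" where
  "cross a b = fst a * snd b - snd a * fst b"

lemma cross_scaleR_left: "cross (s *\<^sub>R a) b = s * cross a b"
  by (simp add: cross_def algebra_simps)

text \<open>\<open>H\<close> is a first integral of \<open>F\<close> arising from the integrating factor \<open>V\<close>.\<close>

definition integrates :: "(real \<times> real) set \<Rightarrow> (real \<times> real \<Rightarrow> real \<times> real) \<Rightarrow>
    (real \<times> real \<Rightarrow> real) \<Rightarrow> (real \<times> real \<Rightarrow> real) \<Rightarrow> bool" where
  "integrates D F V H \<longleftrightarrow>
     (\<forall>z\<in>D. V z > 0 \<and> (H has_derivative (\<lambda>h. V z * cross (F z) h)) (at z))"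

lemma integratesD:
  "integrates D F V H \<Longrightarrow> z \<in> D \<Longrightarrow> V z > 0"
  "integrates D F V H \<Longrightarrow> z \<in> D \<Longrightarrow> (H has_derivative (\<lambda>h. V z * cross (F z) h)) (at z)"
  by (auto simp: integrates_def)

lemma integrates_along:
  assumes "integrates D F V H" "g t \<in> D" "(g has_vector_derivative d) (at t within J)"
  shows "((\<lambda>t. H (g t)) has_real_derivative V (g t) * cross (F (g t)) d) (at t within J)"
proof -
  have "((H \<circ> g) has_derivative ((\<lambda>h. V (g t) * cross (F (g t)) h) \<circ> (\<lambda>h. h *\<^sub>R d))) (at t within J)"
    using assms integratesD(2)[OF assms(1,2)]
    by (intro diff_chain_within has_derivative_at_withinI[where s = "g ` J"]) (auto simp: has_vector_derivative_def)
  moreover have "(\<lambda>h. V (g t) * cross (F (g t)) h) \<circ> (\<lambda>h. h *\<^sub>R d) = (\<lambda>h. V (g t) * cross (F (g t)) d * h)"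
    by (auto simp: cross_def algebra_simps)
  ultimately show ?thesis
    by (simp add: has_field_derivative_def o_def)
qed

lemma integrates_constant_on:
  assumes "integrates D F V H" "is_interval J" "solution_on F J g" "g ` J \<subseteq> D"
  shows "(H \<circ> g) constant_on J"
proof -
  have "\<exists>c. \<forall>t\<in>J. H (g t) = c"
  proof (rule has_derivative_zero_constant)
    show "convex J" using assms(2) is_interval_convex by blast
    fix t assume t: "t \<in> J"
    have "((\<lambda>t. H (g t)) has_real_derivative V (g t) * cross (F (g t)) (F (g t))) (at t within J)"
      using assms t by (intro integrates_along[of D]) (auto simp: solution_on_def)
    thus "((\<lambda>t. H (g t)) has_derivative (\<lambda>h. 0)) (at t within J)"
      by (simp add: has_field_derivative_def cross_def mult.commute lambda_zero)
  qed
  thus ?thesis by (auto simp: constant_on_def)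
qed

lemma integrates_solves:
  assumes "integrates D F V H" "solves F g" "range g \<subseteq> D"
  shows "H (g t) = H (g s)"
  using integrates_constant_on[OF assms(1) is_interval_univ, of g] assms(2,3)
  by (auto simp: solution_on_UNIV_iff constant_on_def)

lemma integrates_continuous_on: "integrates D F V H \<Longrightarrow> continuous_on D H"
  by (meson continuous_at_imp_continuous_on has_derivative_continuous integratesD(2))

lemma periodic_of_return:
  fixes G :: "'a::real_inner \<Rightarrow> 'a"
  assumes "L-lipschitz_on UNIV G" "solves G x" "x T = x 0"
  shows "x (t + T) = x t"
proof -
  have "(\<lambda>t. x (t + T)) = x"
    by (rule solves_unique[OF assms(1) solves_shift[OF assms(2)] assms(2), of T 0]) (use assms(3) in auto)
  thus ?thesis by (metis)
qed

text \<open>The argument of a nonvanishing curve is lifted by integrating \<open>w' / w\<close>.\<close>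

lemma winding_return:
  fixes w w' :: "real \<Rightarrow> complex"
  assumes w: "\<And>t. (w has_vector_derivative w' t) (at t)" "\<And>t. w t \<noteq> 0"
    and cont: "continuous_on UNIV w'"
    and \<kappa>: "\<kappa> > 0" and \<sigma>: "\<sigma> = 1 \<or> \<sigma> = -1"
    and rot: "\<And>t. \<sigma> * Im (w' t / w t) \<ge> \<kappa>"
  obtains T a where "T > 0" "a > 0" "w T = of_real a * w 0"
proof -
  have w_cont: "continuous_on UNIV w"
    using w(1) by (meson continuous_at_imp_continuous_on has_vector_derivative_continuous)
  have "continuous_on UNIV (\<lambda>t. w' t / w t)" by (intro continuous_intros cont w_cont) (simp add: w(2))
  then obtain l where l: "l 0 = 0" "\<And>t. (l has_vector_derivative w' t / w t) (at t)"
    using antiderivative_real_line by blast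
  have "((\<lambda>t. w t * exp (- l t)) has_vector_derivative 0) (at t)" for t
  proof -
    have "((exp \<circ> (\<lambda>t. - l t)) has_vector_derivative (- (w' t / w t)) * exp (- l t)) (at t)"
      by (rule field_vector_diff_chain_at) (auto intro!: derivative_eq_intros has_vector_derivative_minus l(2))
    hence "((\<lambda>t. w t * exp (- l t)) has_vector_derivative w t * ((- (w' t / w t)) * exp (- l t)) + w' t * exp (- l t)) (at t)"
      by (intro has_vector_derivative_mult w(1)) (simp add: o_def)
    thus ?thesis using w(2)[of t] by simp
  qed
  hence "\<exists>c. \<forall>t\<in>UNIV. w t * exp (- l t) = c"
    by (intro has_derivative_zero_constant) (simp_all add: has_vector_derivative_def)
  then obtain c where c: "\<And>t. w t * exp (- l t) = c" by auto
  have wl: "w t = w 0 * exp (l t)" for t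
    using c[of t] c[of 0] l(1) by (simp add: exp_minus field_simps)
  define \<theta> where "\<theta> t = \<sigma> * Im (l t)" for t
  have \<theta>': "(\<theta> has_real_derivative \<sigma> * Im (w' t / w t)) (at t)" for t
    unfolding \<theta>_def has_real_derivative_iff_has_vector_derivative
    using has_vector_derivative_mult_right[OF bounded_linear.has_vector_derivative[OF bounded_linear_Im l(2)[of t]]] .
  \<comment> \<open>Turning at rate at least \<kappa>, the angle has completed a full turn by this
    time.\<close>
  define b where "b = 2 * pi / \<kappa>"
  have b: "b > 0" using \<kappa> by (simp add: b_def)
  have "\<theta> 0 - \<kappa> * 0 \<le> \<theta> b - \<kappa> * b"
  proof (rule DERIV_nonneg_imp_nondecreasing[of 0 b "\<lambda>t. \<theta> t - \<kappa> * t"])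
    fix t show "\<exists>y. ((\<lambda>t. \<theta> t - \<kappa> * t) has_real_derivative y) (at t) \<and> 0 \<le> y"
      using rot[of t] by (intro exI[of _ "\<sigma> * Im (w' t / w t) - \<kappa> * 1"] conjI DERIV_diff DERIV_cmult \<theta>') auto
  qed (use b in auto)
  hence "2 * pi \<le> \<theta> b" using \<kappa> l(1) by (simp add: \<theta>_def b_def)
  moreover have "continuous_on {0..b} \<theta>"
    using \<theta>' by (meson DERIV_isCont continuous_at_imp_continuous_on)
  ultimately obtain T where T: "0 \<le> T" "\<theta> T = 2 * pi"
    using IVT'[of \<theta> 0 "2 * pi" b] b l(1) by (auto simp: \<theta>_def)
  have "T \<noteq> 0" using T l(1) by (auto simp: \<theta>_def)
  have "exp (l T) = of_real (exp (Re (l T)))"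
  proof -
    have "Im (l T) = 2 * pi \<or> Im (l T) = - (2 * pi)" using T(2) \<sigma> by (auto simp: \<theta>_def)
    thus ?thesis by (auto simp: exp_eq_polar complex_eq_iff)
  qed
  thus ?thesis
    using that[of T "exp (Re (l T))"] T(1) \<open>T \<noteq> 0\<close> wl[of T] by (simp add: mult.commute)
qed

text \<open>
  Along a ray from \<open>p\<close> the derivative of \<open>H\<close> is, up to the positive factor \<open>V\<close>, minus the angular
  velocity of the flow. So definiteness of the latter makes orbits turn around \<open>p\<close>
  and return to the ray they started from, at a point determined by the value of \<open>H\<close>.
\<close>

lemma ray_strict_mono:
  assumes int: "integrates (cball p r) F V H" and \<kappa>: "\<kappa> > 0"
    and rot: "\<And>z. z \<in> cball p r \<Longrightarrow> \<sigma> * cross (z - p) (F z) \<ge> \<kappa> * (norm (z - p))\<^sup>2"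
    and v: "p + v \<in> cball p r" "v \<noteq> 0" and ab: "0 \<le> a" "a < b" "b \<le> 1"
  shows "- \<sigma> * H (p + a *\<^sub>R v) < - \<sigma> * H (p + b *\<^sub>R v)"
proof -
  have in_ball: "p + s *\<^sub>R v \<in> cball p r" if "0 \<le> s" "s \<le> 1" for s
  proof -
    have "s * norm v \<le> norm v" using that by (simp add: mult_left_le_one_le)
    moreover have "norm v \<le> r" using v by (simp add: dist_norm)
    ultimately have "s * norm v \<le> r" by (rule order_trans)
    thus ?thesis using that by (simp add: dist_norm)
  qed
  have deriv: "((\<lambda>s. - \<sigma> * H (p + s *\<^sub>R v)) has_real_derivative
      - \<sigma> * (V (p + s *\<^sub>R v) * cross (F (p + s *\<^sub>R v)) v)) (at s)" if "0 \<le> s" "s \<le> 1" for s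
  proof -
    have "((\<lambda>s. p + s *\<^sub>R v) has_vector_derivative v) (at s)"
      by (auto intro!: derivative_eq_intros)
    from DERIV_cmult[OF integrates_along[OF int in_ball[OF that] this]] show ?thesis .
  qed
  show ?thesis
  proof (rule DERIV_pos_imp_increasing_open[OF ab(2)])
    fix s assume s: "a < s" "s < b"
    hence s': "0 < s" "0 \<le> s" "s \<le> 1" using ab by auto
    have "\<sigma> * cross (s *\<^sub>R v) (F (p + s *\<^sub>R v)) \<ge> \<kappa> * (norm (s *\<^sub>R v))\<^sup>2"
      using rot[OF in_ball[OF s'(2,3)]] by simp
    moreover have "\<kappa> * (norm (s *\<^sub>R v))\<^sup>2 > 0" using \<kappa> s' v by simp
    ultimately have "s * (\<sigma> * cross v (F (p + s *\<^sub>R v))) > 0"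
      by (simp add: cross_scaleR_left mult.left_commute)
    hence "\<sigma> * cross v (F (p + s *\<^sub>R v)) > 0" using s' zero_less_mult_pos by blast
    hence "V (p + s *\<^sub>R v) * (\<sigma> * cross v (F (p + s *\<^sub>R v))) > 0"
      using integratesD(1)[OF int in_ball[OF s'(2,3)]] by simp
    also have "V (p + s *\<^sub>R v) * (\<sigma> * cross v (F (p + s *\<^sub>R v))) =
       - \<sigma> * (V (p + s *\<^sub>R v) * cross (F (p + s *\<^sub>R v)) v)"
      by (simp add: cross_def algebra_simps)
    finally show "\<exists>y. ((\<lambda>s. - \<sigma> * H (p + s *\<^sub>R v)) has_real_derivative y) (at s) \<and> 0 < y"
      using deriv[OF s'(2,3)] by blast
  next
    show "continuous_on {a..b} (\<lambda>s. - \<sigma> * H (p + s *\<^sub>R v))"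
      using ab by (intro continuous_at_imp_continuous_on ballI DERIV_isCont[OF deriv]) auto
  qed
qed

lemma center_of_rotation:
  fixes F :: "real \<times> real \<Rightarrow> real \<times> real"
  assumes F: "locally_lip F" "F p = 0" and r: "r > 0"
    and int: "integrates (cball p r) F V H"
    and \<kappa>: "\<kappa> > 0" and \<sigma>: "\<sigma> = 1 \<or> \<sigma> = -1"
    and rot: "\<And>z. z \<in> cball p r \<Longrightarrow> \<sigma> * cross (z - p) (F z) \<ge> \<kappa> * (norm (z - p))\<^sup>2"
  shows "is_center F p"
proof -
  \<comment> \<open>H with the sign for which it increases outward along every ray from p; in
    particular p is its strict minimum on the ball.\<close>
  define E where "E z = - \<sigma> * H z" for z
  have E_cont: "continuous_on (cball p r) E"
    unfolding E_def by (intro continuous_intros integrates_continuous_on[OF int])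
  have ray: "E (p + a *\<^sub>R v) < E (p + b *\<^sub>R v)"
    if "p + v \<in> cball p r" "v \<noteq> 0" "0 \<le> a" "a < b" "b \<le> 1" for a b v
    unfolding E_def by (rule ray_strict_mono[OF int \<kappa> rot that])
  have E_min: "E p < E z" if "z \<in> cball p r - {p}" for z
    using ray[of "z - p" 0 1] that by simp
  obtain m0 where m0: "m0 \<in> sphere p r" "\<And>z. z \<in> sphere p r \<Longrightarrow> E m0 \<le> E z"
  proof -
    have "sphere p r \<noteq> {}" using r by simp
    thus ?thesis
      using continuous_attains_inf[OF compact_sphere _ continuous_on_subset[OF E_cont sphere_cball]] that by blast
  qed
  define m where "m = E m0"
  \<comment> \<open>Below the least value of \<open>E\<close> on the sphere, conservation of
    \<open>E\<close> keeps an orbit from ever reaching the sphere.\<close>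
  define U where "U = ball p r \<inter> {z. E z < m}"
  have U_open: "open U"
  proof -
    have "continuous_on (ball p r) E" by (rule continuous_on_subset[OF E_cont]) auto
    hence "open (ball p r \<inter> E -` {..<m})" by (intro continuous_open_preimage) auto
    moreover have "U = ball p r \<inter> E -` {..<m}" by (auto simp: U_def)
    ultimately show ?thesis by simp
  qed
  have U_p: "p \<in> U"
    using E_min[of m0] m0(1) r by (auto simp: U_def m_def)
  have U_orbits: "\<exists>C. closed_orbit F C \<and> q \<in> C \<and> C \<subseteq> U - {p}" if q: "q \<in> U - {p}" for q
  proof -
    have qball: "q \<in> ball p r" and qm: "E q < m" and qp: "q \<noteq> p" using q by (auto simp: U_def)
    obtain G L where G: "L-lipschitz_on UNIV G" "\<And>z. z \<in> cball p r \<Longrightarrow> G z = F z"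
      by (rule locally_lip_extend[OF F(1) bounded_cball[of p r]]) blast
    obtain x where x: "x 0 = q" "solves G x" using lipschitz_global_solution[OF G(1)] by blast
    have x_cont: "continuous_on S x" for S by (rule solves_continuous_on[OF x(2)])
    \<comment> \<open>A clopen argument in time: the set is closed by continuity, and open because x
      stays for a short while in the open ball, where \<open>G\<close> agrees with \<open>F\<close>
      and H is conserved. Hence x never leaves the ball and solves the original equation.\<close>
    define S where "S = {t. x t \<in> cball p r \<and> E (x t) = E q}"
    have S_ball: "x t \<in> ball p r" if "t \<in> S" for t
    proof -
      have "x t \<notin> sphere p r" using that m0(2)[of "x t"] qm unfolding S_def m_def by fastforce
      thus ?thesis using that by (simp add: S_def)
    qed
    have "closed S"
    proof -
      have "S = x -` (cball p r \<inter> E -` {E q})" by (auto simp: S_def)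
      moreover have "closed (cball p r \<inter> E -` {E q})" by (intro continuous_closed_preimage[OF E_cont]) auto
      ultimately show ?thesis using x_cont by (simp only: closed_vimage)
    qed
    moreover have "open S"
      unfolding open_dist
    proof
      fix t assume t: "t \<in> S"
      have "open (x -` ball p r)" by (rule open_vimage[OF open_ball x_cont])
      then obtain d where d: "d > 0" "ball t d \<subseteq> x -` ball p r"
        using S_ball[OF t] open_contains_ball by (metis vimageI2)
      have "\<exists>c. \<forall>s\<in>ball t d. H (x s) = c"
      proof (rule has_derivative_zero_constant)
        fix s assume s: "s \<in> ball t d"
        have xs: "x s \<in> cball p r" using s d by auto
        have "((\<lambda>s. H (x s)) has_real_derivative V (x s) * cross (F (x s)) (F (x s))) (at s within ball t d)"
          using solvesD[OF x(2), of s] G(2)[OF xs]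
          by (intro integrates_along[where g = x and t = s, OF int xs]) (auto intro: has_vector_derivative_at_within)
        thus "((\<lambda>t. H (x t)) has_derivative (\<lambda>h. 0)) (at s within ball t d)"
          by (simp add: has_field_derivative_def cross_def mult.commute lambda_zero)
      qed auto
      then obtain c where c: "\<And>s. s \<in> ball t d \<Longrightarrow> H (x s) = c" by blast
      have "s \<in> S" if "dist s t < d" for s
      proof -
        have s: "s \<in> ball t d" "t \<in> ball t d" using that d(1) by (simp_all add: dist_commute)
        have "x s \<in> ball p r" using s(1) d(2) by blast
        moreover have "H (x s) = H (x t)" using c[OF s(1)] c[OF s(2)] by simp
        ultimately show ?thesis using t by (simp add: S_def E_def)
      qed
      thus "\<exists>e>0. \<forall>y. dist y t < e \<longrightarrow> y \<in> S" using d(1) by blast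
    qed
    moreover have "0 \<in> S" using qball x(1) by (auto simp: S_def)
    ultimately have "S = UNIV" using clopen[of S] by blast
    hence xS: "x t \<in> ball p r" "E (x t) = E q" for t using S_ball[of t] by (auto simp: S_def)
    hence x_cball: "x t \<in> cball p r" for t by (simp add: less_imp_le)
    have xF: "solves F x" using x(2) G(2)[OF x_cball] by (simp add: solves_def)
    have Eq: "E p < E q" using E_min[of q] qball qp by (simp add: less_imp_le)
    have xp: "x t \<noteq> p" for t using xS(2)[of t] Eq by auto
    have "x t \<in> U - {p}" for t using xS[of t] xp[of t] qm by (simp add: U_def)
    hence sub: "range x \<subseteq> U - {p}" by (rule image_subsetI)
    define w where "w t = Complex (fst (x t - p)) (snd (x t - p))" for t
    define w' where "w' t = Complex (fst (F (x t))) (snd (F (x t)))" for t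
    have bl: "bounded_linear (\<lambda>z. Complex (fst z) (snd z))"
      unfolding Complex_eq by (intro bounded_linear_intros bounded_linear_compose[OF bounded_linear_of_real bounded_linear_fst]
            bounded_linear_compose[OF bounded_linear_of_real bounded_linear_snd])
    have w_deriv: "(w has_vector_derivative w' t) (at t)" for t
    proof -
      have "((\<lambda>t. x t - p) has_vector_derivative F (x t) - 0) (at t)"
        by (intro has_vector_derivative_diff solvesD xF has_vector_derivative_const)
      from bounded_linear.has_vector_derivative[OF bl this] show ?thesis by (simp add: w_def[abs_def] w'_def)
    qed
    have w_nz: "w t \<noteq> 0" for t
      using xp[of t] by (auto simp: w_def complex_eq_iff prod_eq_iff)
    have "continuous_on UNIV w'"
    proof -
      obtain L' where "L'-lipschitz_on (cball p r) F" using locally_lip_bounded[OF F(1) bounded_cball] .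
      hence "continuous_on (cball p r) F" by (rule lipschitz_on_continuous_on)
      hence "continuous_on UNIV (\<lambda>t. F (x t))"
        by (rule continuous_on_compose2[OF _ x_cont]) (use x_cball in auto)
      thus ?thesis unfolding w'_def by (rule bounded_linear.continuous_on[OF bl])
    qed
    moreover have "\<sigma> * Im (w' t / w t) \<ge> \<kappa>" for t
    proof -
      have n: "(norm (x t - p))\<^sup>2 = (fst (x t - p))\<^sup>2 + (snd (x t - p))\<^sup>2"
        by (cases "x t - p") (simp add: norm_Pair)
      have pos: "(norm (x t - p))\<^sup>2 > 0" using xp[of t] by simp
      have "Im (w' t / w t) = cross (x t - p) (F (x t)) / (norm (x t - p))\<^sup>2"
        by (simp add: n w_def w'_def cross_def Im_divide algebra_simps)
      hence "\<sigma> * Im (w' t / w t) = \<sigma> * cross (x t - p) (F (x t)) / (norm (x t - p))\<^sup>2" by simp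
      thus ?thesis using rot[OF x_cball[of t]] pos by (simp add: pos_le_divide_eq)
    qed
    ultimately obtain T a where T: "T > 0" "a > 0" "w T = of_real a * w 0"
      using winding_return[OF w_deriv w_nz _ \<kappa> \<sigma>] by blast
    have xT: "x T = p + a *\<^sub>R (q - p)"
    proof -
      have "fst (x T - p) = a * fst (q - p)" "snd (x T - p) = a * snd (q - p)"
        using T(3) x(1) by (auto simp: w_def complex_eq_iff)
      thus ?thesis by (simp add: prod_eq_iff algebra_simps)
    qed
    \<comment> \<open>Otherwise \<open>x T\<close> and q would be different points of one ray with
      the same value of \<open>E\<close>.\<close>
    have "a = 1"
    proof (rule ccontr)
      assume "a \<noteq> 1"
      then consider "a < 1" | "a > 1" by linarith
      thus False
      proof cases
        case 1
        hence "E (p + a *\<^sub>R (q - p)) < E (p + 1 *\<^sub>R (q - p))"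
          using T qball qp by (intro ray) (auto simp: less_imp_le)
        thus False using xS(2)[of T] xT by simp
      next
        case 2
        have "E (p + (1/a) *\<^sub>R (x T - p)) < E (p + 1 *\<^sub>R (x T - p))"
          using T xp x_cball 2 by (intro ray) auto
        thus False using xS(2)[of T] xT T by simp
      qed
    qed
    hence "x T = x 0" using xT x(1) by simp
    hence "x (t + T) = x t" for t by (rule periodic_of_return[where x = x, OF G(1) x(2)])
    moreover have "F (x 0) \<noteq> 0"
    proof
      assume "F (x 0) = 0"
      hence "\<kappa> * (norm (x 0 - p))\<^sup>2 \<le> 0" using rot[OF x_cball[of 0]] by (simp add: cross_def)
      thus False using \<kappa> xp[of 0] by (simp add: mult_le_0_iff)
    qed
    ultimately have "closed_orbit F (range x)" using closed_orbitI[OF xF T(1)] by blast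
    thus ?thesis using sub x(1) by blast
  qed
  show ?thesis
    unfolding is_center_def by (intro conjI exI[of _ U] ballI F(2) U_open U_p U_orbits)
qed

section \<open>Closed orbits near a closed orbit\<close>

lemma orthogonal_pair_decomp:
  fixes f v :: "real \<times> real"
  assumes "v \<bullet> f = 0" "f \<noteq> 0"
  obtains s where "v = s *\<^sub>R (- snd f, fst f)"
proof
  have n: "(fst f)\<^sup>2 + (snd f)\<^sup>2 \<noteq> 0" using assms(2) by (auto simp: prod_eq_iff sum_power2_eq_zero_iff)
  have o: "fst v * fst f + snd v * snd f = 0" using assms(1) by (simp add: inner_prod_def)
  have "fst v * ((fst f)\<^sup>2 + (snd f)\<^sup>2) = - (fst f * snd v - snd f * fst v) * snd f"
       "snd v * ((fst f)\<^sup>2 + (snd f)\<^sup>2) = (fst f * snd v - snd f * fst v) * fst f"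
    using o by algebra+
  thus "v = (cross f v / ((fst f)\<^sup>2 + (snd f)\<^sup>2)) *\<^sub>R (- snd f, fst f)"
    using n by (simp add: prod_eq_iff cross_def field_simps)
qed

text \<open>
  The return map on a transversal through a point of the orbit preserves \<open>H\<close>, which is strictly
  monotone on the transversal; so the return map is the identity.
\<close>

lemma nearby_closed_orbit:
  fixes F :: "real \<times> real \<Rightarrow> real \<times> real"
  assumes F: "locally_lip F" and D: "open D" and int: "integrates D F V H"
    and C: "closed_orbit F C" "C \<subseteq> D" and U: "open U" "C \<subseteq> U"
  shows "\<exists>C'. closed_orbit F C' \<and> C' \<subseteq> U \<and> C' \<noteq> C"
proof -
  from C(1) obtain g and T :: real where g: "solves F g" "T > 0" "\<And>t. g (t + T) = g t" "C = range g"
    by (metis closed_orbitE)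
  have gC: "g t \<in> C" for t using g(4) by auto
  define p where "p = g 0"
  have gT: "g T = p" using g(3)[of 0] by (simp add: p_def)
  define f where "f = F p"
  have f: "f \<noteq> 0" using closed_orbit_nonsingular[OF F C(1) gC] by (simp add: f_def p_def)
  \<comment> \<open>The velocity at p turned by a right angle. At z the derivative of H in this
    direction is V z (\<open>F z \<bullet> f\<close>), which is positive for z near p.\<close>
  define n where "n = (- snd f, fst f)"
  have nf: "n \<bullet> f = 0" by (simp add: n_def inner_prod_def)
  have n: "norm n = norm f" by (cases f) (simp add: n_def norm_Pair add.commute)
  have n0: "norm n > 0" using n f by simp
  obtain \<delta> where \<delta>: "\<delta> > 0" "(\<Union>z\<in>C. ball z \<delta>) \<subseteq> U \<inter> D"
    using compact_subset_open_imp_ball_epsilon_subset[OF compact_closed_orbit[OF C(1)] open_Int[OF U(1) D]] U(2) C(2)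
    by (metis Int_greatest)
  define S where "S = (\<Union>z\<in>C. ball z \<delta>)"
  have S: "S \<subseteq> U" "S \<subseteq> D" using \<delta> by (auto simp: S_def)
  have near: "z \<in> S" if "dist z (g t) < \<delta>" for z t
    using that gC[of t] by (auto simp: S_def dist_commute)
  have "bounded S"
  proof -
    have "bounded C" using compact_closed_orbit[OF C(1)] compact_imp_bounded by blast
    then obtain R where R: "\<And>z. z \<in> C \<Longrightarrow> norm z \<le> R" by (auto simp: bounded_iff)
    have "norm y \<le> R + \<delta>" if "y \<in> S" for y
    proof -
      obtain z where z: "z \<in> C" "dist z y < \<delta>" using \<open>y \<in> S\<close> by (auto simp: S_def)
      have "norm y \<le> norm z + dist z y" by (metis add.commute dist_commute dist_norm norm_triangle_sub)
      thus ?thesis using R[OF z(1)] z(2) by linarith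
    qed
    thus ?thesis unfolding bounded_iff by blast
  qed
  obtain G L where G: "L-lipschitz_on UNIV G" "\<And>z. z \<in> S \<Longrightarrow> G z = F z"
    by (rule locally_lip_extend[OF F \<open>bounded S\<close>]) blast
  have gS: "g t \<in> S" for t using near[of "g t" t] \<delta>(1) by simp
  have gG: "solves G g" using g(1) G(2)[OF gS] by (simp add: solves_def)
  have L: "0 \<le> L" using G(1) by (rule lipschitz_on_nonneg)
  obtain \<rho> where \<rho>: "\<rho> > 0" "ball p \<rho> \<subseteq> S" "\<And>z. z \<in> ball p \<rho> \<Longrightarrow> F z \<bullet> f > 0"
  proof -
    obtain L' where "L'-lipschitz_on S F" using locally_lip_bounded[OF F \<open>bounded S\<close>] .
    hence "continuous_on S F" by (rule lipschitz_on_continuous_on)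
    hence "continuous_on S (\<lambda>z. F z \<bullet> f)" by (intro continuous_intros)
    moreover have "open S" by (auto simp: S_def)
    ultimately have "open (S \<inter> (\<lambda>z. F z \<bullet> f) -` {0<..})" by (intro continuous_open_preimage) auto
    moreover have "p \<in> S \<inter> (\<lambda>z. F z \<bullet> f) -` {0<..}" using gS[of 0] f by (simp add: p_def f_def)
    ultimately obtain \<rho> where "\<rho> > 0" "ball p \<rho> \<subseteq> S \<inter> (\<lambda>z. F z \<bullet> f) -` {0<..}"
      using open_contains_ball by blast
    thus ?thesis by (intro that[of \<rho>]) auto
  qed
  have trans: "H (p + a *\<^sub>R n) < H (p + b *\<^sub>R n)"
    if ab: "a < b" "p + a *\<^sub>R n \<in> ball p \<rho>" "p + b *\<^sub>R n \<in> ball p \<rho>" for a b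
  proof (rule DERIV_pos_imp_increasing[OF ab(1)])
    fix s assume s: "a \<le> s" "s \<le> b"
    have "\<bar>s\<bar> \<le> max \<bar>a\<bar> \<bar>b\<bar>" using s by auto
    hence "\<bar>s\<bar> * norm n \<le> max \<bar>a\<bar> \<bar>b\<bar> * norm n" by (intro mult_right_mono) auto
    also have "\<dots> < \<rho>" using ab by (auto simp: dist_norm max_def)
    finally have b: "p + s *\<^sub>R n \<in> ball p \<rho>" by (simp add: dist_norm)
    hence D: "p + s *\<^sub>R n \<in> D" using \<rho>(2) S(2) by blast
    have "((\<lambda>s. p + s *\<^sub>R n) has_vector_derivative n) (at s)"
      by (auto intro!: derivative_eq_intros)
    from integrates_along[where g = "\<lambda>s. p + s *\<^sub>R n" and t = s, OF int D this]
    have "((\<lambda>s. H (p + s *\<^sub>R n)) has_real_derivative V (p + s *\<^sub>R n) * cross (F (p + s *\<^sub>R n)) n) (at s)" .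
    moreover have "cross (F (p + s *\<^sub>R n)) n = F (p + s *\<^sub>R n) \<bullet> f"
      by (simp add: cross_def n_def inner_prod_def)
    ultimately show "\<exists>y. ((\<lambda>s. H (p + s *\<^sub>R n)) has_real_derivative y) (at s) \<and> 0 < y"
      using \<rho>(3)[OF b] integratesD(1)[OF int D] by auto
  qed
  \<comment> \<open>The signed height over the line through p spanned by n. The flow crosses this
    line upward at p, and a zero of \<phi> along a nearby curve is a return to the line.\<close>
  define \<phi> where "\<phi> z = (z - p) \<bullet> f" for z
  have \<phi>_lip: "\<bar>\<phi> z - \<phi> y\<bar> \<le> dist z y * norm f" for z y
    using Cauchy_Schwarz_ineq2[of "z - y" f] by (simp add: \<phi>_def dist_norm inner_diff_left)
  have "((\<lambda>t. \<phi> (g t)) has_real_derivative f \<bullet> f) (at T)"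
  proof -
    have "((\<lambda>t. g t - p) has_vector_derivative F (g T) - 0) (at T)"
      by (intro has_vector_derivative_diff solvesD g has_vector_derivative_const)
    hence "((\<lambda>t. (g t - p) \<bullet> f) has_vector_derivative F (g T) \<bullet> f) (at T)"
      by (intro bounded_linear.has_vector_derivative[OF bounded_linear_inner_left]) simp
    thus ?thesis by (simp add: \<phi>_def gT f_def has_real_derivative_iff_has_vector_derivative)
  qed
  moreover have "f \<bullet> f > 0" using f by simp
  ultimately obtain d1 d2 where d: "d1 > 0" "d2 > 0"
      "\<And>h. 0 < h \<Longrightarrow> h < d1 \<Longrightarrow> \<phi> (g T) < \<phi> (g (T + h))"
      "\<And>h. 0 < h \<Longrightarrow> h < d2 \<Longrightarrow> \<phi> (g (T - h)) < \<phi> (g T)"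
    using DERIV_pos_inc_right DERIV_pos_inc_left by metis
  obtain d3 where d3: "d3 > 0" "\<And>t. \<bar>t - T\<bar> < d3 \<Longrightarrow> dist (g t) p < \<rho> / 2"
  proof -
    have "isCont g T" using solves_continuous_on[OF g(1), of UNIV] by (simp add: continuous_on_eq_continuous_at)
    thus ?thesis using that gT \<rho>(1) unfolding continuous_at_eps_delta
      by (metis dist_commute dist_real_def half_gt_zero)
  qed
  \<comment> \<open>Small enough that \<phi> has strict and opposite signs at T - \<eta> and T +
    \<eta>, that the reference orbit stays within \<rho> / 2 of p in between, and that these times
    lie in [0, 2 T].\<close>
  define \<eta> where "\<eta> = min (min (d1/2) (d2/2)) (min (d3/2) (T/2))"
  have \<eta>: "\<eta> > 0" "\<eta> < d1" "\<eta> < d2" "\<eta> < d3" "\<eta> < T" using d(1,2) d3(1) g(2) by (auto simp: \<eta>_def)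
  have \<phi>T: "\<phi> (g T) = 0" by (simp add: gT \<phi>_def)
  have \<phi>1: "\<phi> (g (T + \<eta>)) > 0" using d(3)[of \<eta>] \<eta> \<phi>T by simp
  have \<phi>2: "\<phi> (g (T - \<eta>)) < 0" using d(4)[of \<eta>] \<eta> \<phi>T by simp
  \<comment> \<open>By Gronwall, a start at p + s n deviates from the reference orbit by at most M s
    up to time 2 T. \<open>B\<close> is the tolerance under which the perturbed curve stays in
    \<open>S\<close>, keeps the two signs of \<phi> (whose Lipschitz constant is the norm of f) and
    is within \<rho> of p when it returns.\<close>
  define M where "M = exp (L * (2 * T)) * norm n"
  have M: "M > 0" using n0 by (simp add: M_def)
  define B where "B = min (min \<delta> (\<rho> / 2)) (min (\<phi> (g (T + \<eta>)) / norm f) (- \<phi> (g (T - \<eta>)) / norm f))"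
  have B: "B > 0" using \<delta>(1) \<rho>(1) \<phi>1 \<phi>2 f by (simp add: B_def divide_pos_pos divide_neg_pos)
  define s where "s = B / (2 * M)"
  have s: "s > 0" "M * s < B" using B M by (simp_all add: s_def)
  obtain x where x: "x 0 = p + s *\<^sub>R n" "solves G x" using lipschitz_global_solution[OF G(1)] by blast
  have close: "dist (x t) (g t) < B" if "0 \<le> t" "t \<le> 2 * T" for t
  proof -
    have "dist (x t) (g t) \<le> exp (L * \<bar>t - 0\<bar>) * dist (x 0) (g 0)"
      by (rule gronwall_both[OF G(1) x(2) gG]) auto
    also have "dist (x 0) (g 0) = s * norm n" using s x(1) by (simp add: p_def dist_norm)
    also have "exp (L * \<bar>t - 0\<bar>) * (s * norm n) \<le> exp (L * (2 * T)) * (s * norm n)"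
      using that L s by (intro mult_right_mono) (auto intro: mult_left_mono)
    also have "\<dots> = M * s" by (simp add: M_def)
    finally show ?thesis using s(2) by linarith
  qed
  have B_le: "B \<le> \<delta>" "B \<le> \<rho> / 2" "B * norm f \<le> \<phi> (g (T + \<eta>))" "B * norm f \<le> - \<phi> (g (T - \<eta>))"
  proof -
    have "B \<le> \<phi> (g (T + \<eta>)) / norm f" "B \<le> - \<phi> (g (T - \<eta>)) / norm f" by (simp_all add: B_def)
    thus "B * norm f \<le> \<phi> (g (T + \<eta>))" "B * norm f \<le> - \<phi> (g (T - \<eta>))"
      using f by (simp_all only: pos_le_divide_eq zero_less_norm_iff not_False_eq_True)
  qed (unfold B_def, rule order_trans[OF min.cobounded1 min.cobounded1],
      rule order_trans[OF min.cobounded1 min.cobounded2])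
  have xS: "x t \<in> S" if "0 \<le> t" "t \<le> 2 * T" for t
    using close[OF that] B_le(1) by (intro near[of _ t]) linarith
  have sgn: "\<bar>\<phi> (x t) - \<phi> (g t)\<bar> < B * norm f" if "0 \<le> t" "t \<le> 2 * T" for t
  proof -
    have "dist (x t) (g t) * norm f < B * norm f" using close[OF that] f by (intro mult_strict_right_mono) auto
    thus ?thesis using \<phi>_lip[of "x t" "g t"] by linarith
  qed
  have "\<phi> (x (T + \<eta>)) > 0" "\<phi> (x (T - \<eta>)) < 0"
    using sgn[of "T + \<eta>"] sgn[of "T - \<eta>"] B_le \<eta> by auto
  moreover have "continuous_on {T - \<eta>..T + \<eta>} (\<lambda>t. \<phi> (x t))"
    unfolding \<phi>_def by (intro continuous_intros solves_continuous_on[OF x(2)])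
  ultimately obtain \<tau> where \<tau>: "T - \<eta> \<le> \<tau>" "\<tau> \<le> T + \<eta>" "\<phi> (x \<tau>) = 0"
    using IVT'[of "\<lambda>t. \<phi> (x t)" "T - \<eta>" 0 "T + \<eta>"] \<eta>(1) by (auto simp: less_imp_le)
  have \<tau>': "0 < \<tau>" "\<tau> \<le> 2 * T" using \<tau> \<eta> by auto
  obtain \<sigma> where "x \<tau> - p = \<sigma> *\<^sub>R n"
    using orthogonal_pair_decomp[of "x \<tau> - p" f] \<tau>(3) f by (auto simp: \<phi>_def n_def)
  hence \<sigma>: "x \<tau> = p + \<sigma> *\<^sub>R n" by (simp add: algebra_simps)
  have x\<tau>: "x \<tau> \<in> ball p \<rho>"
  proof -
    have "dist (x \<tau>) (g \<tau>) < \<rho> / 2" using close[of \<tau>] \<tau>' B_le by auto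
    moreover have "dist (g \<tau>) p < \<rho> / 2" using \<tau> \<eta> by (intro d3) auto
    ultimately have "dist (x \<tau>) p < \<rho>" using dist_triangle[of "x \<tau>" p "g \<tau>"] by linarith
    thus ?thesis by (simp add: dist_commute)
  qed
  have x0: "x 0 \<in> ball p \<rho>"
    using close[of 0] B_le(2) \<rho>(1) g(2) by (simp add: p_def dist_commute)
  have "solution_on F {0..\<tau>} x"
    unfolding solution_on_def
  proof
    fix t assume "t \<in> {0..\<tau>}"
    hence "x t \<in> S" using xS \<tau>' by auto
    thus "(x has_vector_derivative F (x t)) (at t within {0..\<tau>})"
      using solvesD[OF x(2), of t] G(2) by (auto intro: has_vector_derivative_at_within)
  qed
  moreover have "x ` {0..\<tau>} \<subseteq> D" using xS \<tau>' S(2) by auto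
  ultimately have "(H \<circ> x) constant_on {0..\<tau>}"
    by (intro integrates_constant_on[OF int is_interval_cc])
  hence H_eq: "H (x \<tau>) = H (x 0)" using \<tau>'(1) by (force simp: constant_on_def)
  have "\<sigma> = s"
    using trans[of \<sigma> s] trans[of s \<sigma>] H_eq x\<tau> x0 unfolding \<sigma> x(1) by (cases \<sigma> s rule: linorder_cases) auto
  hence ret: "x \<tau> = x 0" using \<sigma> x(1) by simp
  hence per: "x (t + \<tau>) = x t" for t by (rule periodic_of_return[where x = x, OF G(1) x(2)])
  have range_x: "range x \<subseteq> S"
    unfolding periodic_range[of x \<tau>, OF per \<tau>'(1), of 0] using xS \<tau>' by auto
  have xF: "solves F x" unfolding solves_def
  proof
    fix t
    have "x t \<in> S" using range_x by auto
    thus "(x has_vector_derivative F (x t)) (at t)" using solvesD[OF x(2), of t] G(2) by simp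
  qed
  have "F (x 0) \<noteq> 0" using \<rho>(3)[OF x0] by auto
  hence "closed_orbit F (range x)" using closed_orbitI[OF xF \<tau>'(1) per] by blast
  moreover have "range x \<subseteq> U" using range_x S(1) by blast
  \<comment> \<open>On \<open>C\<close> the value of H is that of p, while x starts on the
    transversal at a point with a larger value.\<close>
  moreover have "range x \<noteq> C"
  proof
    assume "range x = C"
    then obtain t where "x 0 = g t" using g(4) by (metis rangeE rangeI)
    hence "H (x 0) = H p" using integrates_solves[OF int g(1), of t 0] C(2) g(4) by (simp add: p_def)
    thus False using trans[of 0 s] s(1) x0 \<rho>(1) x(1) by simp
  qed
  ultimately show ?thesis by blast
qed

lemma no_limit_cycle_of_integrates:
  assumes "locally_lip F" "open D" "integrates D F V H" "C \<subseteq> D"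
  shows "\<not> limit_cycle F C"
  unfolding limit_cycle_def using nearby_closed_orbit[OF assms(1-3) _ assms(4)] by blast

section \<open>Linearization\<close>

lemma abs_cross_le: "\<bar>cross a b\<bar> \<le> norm a * norm b"
proof -
  have "cross a b = (- snd a, fst a) \<bullet> b" by (simp add: cross_def inner_prod_def)
  moreover have "norm (- snd a, fst a) = norm a" by (cases a) (simp add: norm_Pair add.commute)
  ultimately show ?thesis using Cauchy_Schwarz_ineq2[of "(- snd a, fst a)" b] by simp
qed

lemma cross_add_right: "cross a (b + c) = cross a b + cross a c"
  by (simp add: cross_def algebra_simps)

lemma linearization_remainder:
  assumes "(F has_derivative A) (at p)" "F p = 0" "e > 0"
  obtains \<delta> where "\<delta> > 0" "\<And>z. z \<in> cball p \<delta> \<Longrightarrow> norm (F z - A (z - p)) \<le> e * norm (z - p)"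
proof -
  obtain d where d: "d > 0" "\<And>z. norm (z - p) < d \<Longrightarrow> norm (F z - F p - A (z - p)) \<le> e * norm (z - p)"
    using assms(1,3) unfolding has_derivative_within_alt by auto
  show ?thesis
  proof (rule that[of "d / 2"])
    fix z assume "z \<in> cball p (d / 2)"
    hence "norm (z - p) \<le> d / 2" by (simp add: dist_norm norm_minus_commute)
    hence "norm (z - p) < d" using d(1) by linarith
    thus "norm (F z - A (z - p)) \<le> e * norm (z - p)" using d(2)[of z] assms(2) by simp
  qed (use d in simp)
qed

text \<open>The Lyapunov function is the quadratic form S v \<bullet> v with v = z - p, whose
  derivative along the flow is 2 (S v \<bullet> F z). The linear part contributes at least 2
  \<kappa> |v|^2, and e is chosen so that the remainder of \<open>F\<close> takes away at most half
  of it.\<close>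

lemma not_center_of_quadratic_form:
  fixes F :: "real \<times> real \<Rightarrow> real \<times> real"
  assumes F: "locally_lip F" "F p = 0" "(F has_derivative A) (at p)"
    and S: "bounded_linear S" "\<And>u v. S u \<bullet> v = u \<bullet> S v"
    and \<kappa>: "\<kappa> > 0" "\<And>v. S v \<bullet> A v \<ge> \<kappa> * (norm v)\<^sup>2"
  shows "\<not> is_center F p"
proof -
  obtain K where K: "K > 0" "\<And>v. norm (S v) \<le> norm v * K"
    using bounded_linear.pos_bounded[OF S(1)] by blast
  define e where "e = \<kappa> / (2 * K)"
  have e: "e > 0" "K * e = \<kappa> / 2" using K \<kappa> by (simp_all add: e_def)
  obtain \<delta> where \<delta>: "\<delta> > 0" "\<And>z. z \<in> cball p \<delta> \<Longrightarrow> norm (F z - A (z - p)) \<le> e * norm (z - p)"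
    using linearization_remainder[OF F(3,2) e(1)] by blast
  show ?thesis
  proof (rule not_center_of_increasing[OF F(1,2) \<delta>(1)])
    fix z assume z: "z \<in> cball p \<delta> - {p}"
    have "((\<lambda>z. S (z - p) \<bullet> (z - p)) has_derivative (\<lambda>h. S (z - p) \<bullet> (h - 0) + S (h - 0) \<bullet> (z - p))) (at z)"
      by (intro has_derivative_inner bounded_linear.has_derivative[OF S(1)] has_derivative_diff has_derivative_ident has_derivative_const)
    thus "((\<lambda>z. S (z - p) \<bullet> (z - p)) has_derivative (\<lambda>h. 2 * (S (z - p) \<bullet> h))) (at z)"
      by (rule has_derivative_eq_rhs) (auto simp: S(2) inner_commute)
    define v where "v = z - p"
    define R where "R = F z - A v"
    have v: "norm v > 0" using z by (simp add: v_def)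
    have "\<bar>S v \<bullet> R\<bar> \<le> norm (S v) * norm R" by (rule Cauchy_Schwarz_ineq2)
    also have "\<dots> \<le> (norm v * K) * (e * norm v)"
      using K(2)[of v] \<delta>(2)[of z] z K(1) by (intro mult_mono) (auto simp: R_def v_def)
    also have "\<dots> = (K * e) * (norm v)\<^sup>2" by (simp add: power2_eq_square)
    finally have "\<bar>S v \<bullet> R\<bar> \<le> \<kappa> / 2 * (norm v)\<^sup>2" by (simp only: e(2))
    moreover have "S v \<bullet> F z = S v \<bullet> A v + S v \<bullet> R" by (simp add: R_def inner_diff_right)
    moreover have "\<kappa> / 2 * (norm v)\<^sup>2 > 0" using \<kappa>(1) v by simp
    ultimately have "S v \<bullet> F z > 0" using \<kappa>(2)[of v] by linarith
    thus "2 * (S (z - p) \<bullet> F z) > 0" by (simp add: v_def)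
  qed
qed

definition lin2 :: "real \<Rightarrow> real \<Rightarrow> real \<Rightarrow> real \<Rightarrow> real \<times> real \<Rightarrow> real \<times> real" where
  "lin2 a b c d v = (a * fst v + b * snd v, c * fst v + d * snd v)"

lemma bounded_linear_lin2: "bounded_linear (lin2 a b c d)"
  unfolding lin2_def[abs_def]
  by (intro bounded_linear_intros bounded_linear_Pair)

lemma norm2_prod: "(norm (v :: real \<times> real))\<^sup>2 = (fst v)\<^sup>2 + (snd v)\<^sup>2"
  by (cases v) (simp add: norm_Pair)

text \<open>
  Writing \<open>A\<close> for the linear part, \<open>t\<close> and \<open>D\<close> for its trace and determinant, the forms used are
  \<open>A + A\<^sup>T - t\<close> if \<open>D < 0\<close> and \<open>\<plusminus>(D + (adj A)\<^sup>T (adj A))\<close> if \<open>D > 0\<close> and \<open>t \<noteq> 0\<close>.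
\<close>

lemma center_trace_det:
  fixes F :: "real \<times> real \<Rightarrow> real \<times> real"
  assumes F: "locally_lip F" "(F has_derivative lin2 a b c d) (at p)"
    and C: "is_center F p" and nz: "a * d - b * c \<noteq> 0"
  shows "a + d = 0" "a * d - b * c > 0"
proof -
  have Fp: "F p = 0" using C by (simp add: is_center_def)
  define D where "D = a * d - b * c"
  note test = not_center_of_quadratic_form[OF F(1) Fp F(2) bounded_linear_lin2]
  have det: "D > 0"
  proof (rule ccontr)
    assume "\<not> D > 0"
    hence D: "- D > 0" using nz by (simp add: D_def)
    have "\<not> is_center F p"
    proof (rule test[OF _ D])
      show "lin2 (a - d) (b + c) (b + c) (d - a) u \<bullet> v = u \<bullet> lin2 (a - d) (b + c) (b + c) (d - a) v" for u v
        by (simp add: lin2_def inner_prod_def algebra_simps)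
      show "- D * (norm v)\<^sup>2 \<le> lin2 (a - d) (b + c) (b + c) (d - a) v \<bullet> lin2 a b c d v" for v
      proof -
        \<comment> \<open>By Cayley-Hamilton A^2 - t A = - D, so the product reduces to |A v|^2 - D
          |v|^2.\<close>
        have "lin2 (a - d) (b + c) (b + c) (d - a) v \<bullet> lin2 a b c d v =
            - D * (norm v)\<^sup>2 + (a * fst v + b * snd v)\<^sup>2 + (c * fst v + d * snd v)\<^sup>2"
          unfolding norm2_prod lin2_def inner_prod_def D_def by (simp add: power2_eq_square algebra_simps)
        thus ?thesis by simp
      qed
    qed
    thus False using C by simp
  qed
  show "a + d = 0"
  proof (rule ccontr)
    assume t: "a + d \<noteq> 0"
    define s where "s = sgn (a + d)"
    have s: "s * (a + d) > 0" using t by (simp add: s_def sgn_real_def)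
    \<comment> \<open>Because (adj A) A = D and A + adj A = t, the product of \<open>?S v\<close>
      with A v collapses to s D t |v|^2; the sign s of the trace makes it positive.\<close>
    let ?S = "lin2 (s * (D + d\<^sup>2 + c\<^sup>2)) (- s * (b * d + a * c)) (- s * (b * d + a * c)) (s * (D + b\<^sup>2 + a\<^sup>2))"
    have "\<not> is_center F p"
    proof (rule test)
      show "?S u \<bullet> v = u \<bullet> ?S v" for u v
        by (simp add: lin2_def inner_prod_def algebra_simps)
      show "D * (s * (a + d)) > 0" using det s by simp
      show "D * (s * (a + d)) * (norm v)\<^sup>2 \<le> ?S v \<bullet> lin2 a b c d v" for v
      proof -
        have "?S v \<bullet> lin2 a b c d v = D * (s * (a + d)) * (norm v)\<^sup>2"
          unfolding norm2_prod lin2_def inner_prod_def D_def by (simp add: power2_eq_square algebra_simps)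
        thus ?thesis by simp
      qed
    qed
    thus False using C by simp
  qed
  show "a * d - b * c > 0" using det by (simp add: D_def)
qed

text \<open>Take for \<kappa> the determinant of the matrix of the form divided by its trace. This
  is the product of the two positive eigenvalues over their sum, hence smaller than both, so c -
  \<kappa> is positive and the square can be completed.\<close>

lemma definite_form_bound:
  fixes a b c :: real
  assumes "c > 0" "- b * c - a\<^sup>2 > 0"
  obtains \<kappa> where "\<kappa> > 0" "\<And>u v. c * u\<^sup>2 - 2 * a * u * v - b * v\<^sup>2 \<ge> \<kappa> * (u\<^sup>2 + v\<^sup>2)"
proof
  define \<kappa> where "\<kappa> = (- b * c - a\<^sup>2) / (c - b)"
  have "- b * c > 0" using assms(2) zero_le_power2[of a] by linarith
  hence b: "b < 0" using assms(1) by (simp add: mult_less_0_iff)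
  show \<kappa>: "\<kappa> > 0" unfolding \<kappa>_def using assms b by (intro divide_pos_pos) auto
  have \<kappa>_eq: "\<kappa> * (c - b) = - b * c - a\<^sup>2" using assms(1) b by (simp add: \<kappa>_def)
  have "\<kappa> * (c - b) < c * (c - b)"
  proof -
    have "c * (c - b) = c\<^sup>2 - b * c" by (simp add: power2_eq_square algebra_simps)
    moreover have "c\<^sup>2 > 0" "a\<^sup>2 \<ge> 0" using assms(1) by auto
    ultimately show ?thesis using \<kappa>_eq by linarith
  qed
  hence c: "\<kappa> < c" using assms(1) b by (simp add: mult_less_cancel_right)
  fix u v
  have "(c - \<kappa>) * (c * u\<^sup>2 - 2 * a * u * v - b * v\<^sup>2 - \<kappa> * (u\<^sup>2 + v\<^sup>2)) =
     ((c - \<kappa>) * u - a * v)\<^sup>2 + \<kappa>\<^sup>2 * v\<^sup>2"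
    using \<kappa>_eq by algebra
  hence "(c - \<kappa>) * (c * u\<^sup>2 - 2 * a * u * v - b * v\<^sup>2 - \<kappa> * (u\<^sup>2 + v\<^sup>2)) \<ge> 0" by simp
  thus "c * u\<^sup>2 - 2 * a * u * v - b * v\<^sup>2 \<ge> \<kappa> * (u\<^sup>2 + v\<^sup>2)"
    using c by (simp add: zero_le_mult_iff)
qed

text \<open>With trace 0, \<open>cross v (A v)\<close> is a quadratic form of determinant a d - b c,
  hence definite with the sign of c: the linear part rotates. The remainder of \<open>F\<close>
  costs at most half of the rotation, and the first integral closes the orbits.\<close>

lemma center_of_linearization:
  fixes F :: "real \<times> real \<Rightarrow> real \<times> real"
  assumes F: "locally_lip F" "F p = 0" "(F has_derivative lin2 a b c d) (at p)"
    and lin: "a + d = 0" "a * d - b * c > 0"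
    and D: "open D" "p \<in> D" "integrates D F V H"
  shows "is_center F p"
proof -
  have d: "d = - a" using lin(1) by simp
  have disc: "- b * c - a\<^sup>2 > 0" using lin(2) by (simp add: d power2_eq_square)
  have "c \<noteq> 0" using disc zero_le_power2[of a] by (intro notI) simp
  define \<sigma> where "\<sigma> = sgn c"
  have \<sigma>: "\<sigma> = 1 \<or> \<sigma> = -1" "\<sigma> * c > 0" "\<sigma> * \<sigma> = 1"
    using \<open>c \<noteq> 0\<close> by (auto simp: \<sigma>_def sgn_real_def)
  have "- (\<sigma> * b) * (\<sigma> * c) - (\<sigma> * a)\<^sup>2 > 0"
    using disc \<sigma>(3) by (simp add: power2_eq_square algebra_simps) (metis mult.assoc mult.left_commute mult_1)
  then obtain \<kappa> where \<kappa>: "\<kappa> > 0"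
      "\<And>u v. (\<sigma> * c) * u\<^sup>2 - 2 * (\<sigma> * a) * u * v - (\<sigma> * b) * v\<^sup>2 \<ge> \<kappa> * (u\<^sup>2 + v\<^sup>2)"
    using definite_form_bound[OF \<sigma>(2)] by blast
  have rot_lin: "\<sigma> * cross v (lin2 a b c d v) \<ge> \<kappa> * (norm v)\<^sup>2" for v
  proof -
    have "\<sigma> * cross v (lin2 a b c d v) =
        (\<sigma> * c) * (fst v)\<^sup>2 - 2 * (\<sigma> * a) * fst v * snd v - (\<sigma> * b) * (snd v)\<^sup>2"
      by (simp add: cross_def lin2_def d power2_eq_square algebra_simps)
    thus ?thesis using \<kappa>(2)[of "fst v" "snd v"] by (simp add: norm2_prod)
  qed
  have "\<kappa> / 2 > 0" using \<kappa>(1) by simp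
  then obtain \<delta> where \<delta>: "\<delta> > 0" "\<And>z. z \<in> cball p \<delta> \<Longrightarrow> norm (F z - lin2 a b c d (z - p)) \<le> \<kappa> / 2 * norm (z - p)"
    using linearization_remainder[OF F(3,2)] by blast
  obtain r0 where r0: "r0 > 0" "cball p r0 \<subseteq> D" using D open_contains_cball by blast
  define r where "r = min \<delta> r0"
  show ?thesis
  proof (rule center_of_rotation[OF F(1,2), of r V H "\<kappa> / 2" \<sigma>])
    show "integrates (cball p r) F V H"
      using D(3) r0 by (auto simp: integrates_def r_def subset_iff)
    fix z assume z: "z \<in> cball p r"
    define v where "v = z - p"
    define R where "R = F z - lin2 a b c d v"
    have "\<bar>cross v R\<bar> \<le> norm v * norm R" by (rule abs_cross_le)
    also have "\<dots> \<le> norm v * (\<kappa> / 2 * norm v)"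
      using \<delta>(2)[of z] z by (intro mult_left_mono) (auto simp: R_def v_def r_def)
    also have "\<dots> = \<kappa> / 2 * (norm v)\<^sup>2" by (simp add: power2_eq_square)
    finally have "\<bar>\<sigma> * cross v R\<bar> \<le> \<kappa> / 2 * (norm v)\<^sup>2" using \<sigma>(1) by auto
    moreover have "F z = lin2 a b c d v + R" by (simp add: R_def)
    hence "\<sigma> * cross v (F z) = \<sigma> * cross v (lin2 a b c d v) + \<sigma> * cross v R"
      by (simp add: cross_add_right distrib_left)
    moreover have "\<kappa> * (norm v)\<^sup>2 = \<kappa> / 2 * (norm v)\<^sup>2 + \<kappa> / 2 * (norm v)\<^sup>2" by simp
    ultimately have "\<sigma> * cross v (F z) \<ge> \<kappa> / 2 * (norm v)\<^sup>2" using rot_lin[of v] by linarith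
    thus "\<sigma> * cross (z - p) (F z) \<ge> \<kappa> / 2 * (norm (z - p))\<^sup>2" by (simp add: v_def)
  qed (use \<kappa> \<delta> r0 \<sigma> in \<open>auto simp: r_def\<close>)
qed

text \<open>
  If \<open>f\<close> vanishes somewhere on the orbit then it vanishes identically on it, and at a point of the
  orbit where \<open>h\<close> is maximal the vector field vanishes.
\<close>

lemma closed_orbit_off_invariant_line:
  fixes F :: "real \<times> real \<Rightarrow> real \<times> real" and f h :: "real \<times> real \<Rightarrow> real"
  assumes F: "locally_lip F" and C: "closed_orbit F C"
    and bl: "bounded_linear f" "bounded_linear h" and inj: "\<And>z. f z = 0 \<Longrightarrow> h z = 0 \<Longrightarrow> z = 0"
    and k: "continuous_on UNIV k" "\<And>z. f (F z) = f z * k z"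
    and z: "z \<in> C"
  shows "f z \<noteq> 0"
proof
  assume fz: "f z = 0"
  from C obtain g where g: "solves F g" "C = range g"
    by (metis closed_orbitE)
  obtain t0 where t0: "z = g t0" using z g(2) by auto
  have g_cont: "continuous_on UNIV g" by (rule solves_continuous_on[OF g(1)])
  have fg: "((\<lambda>t. f (g t)) has_vector_derivative f (g t) * k (g t)) (at t)" for t
    using bounded_linear.has_vector_derivative[OF bl(1) solvesD[OF g(1), of t]] by (simp add: k(2))
  have hg: "((\<lambda>t. h (g t)) has_vector_derivative h (F (g t))) (at t)" for t
    by (rule bounded_linear.has_vector_derivative[OF bl(2) solvesD[OF g(1)]])
  have "continuous_on UNIV (\<lambda>t. k (g t))"
    by (rule continuous_on_compose2[OF k(1) g_cont]) auto
  then obtain A where A: "\<And>t. (A has_vector_derivative k (g t)) (at t)"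
    using antiderivative_real_line by blast
  \<comment> \<open>Along the orbit f solves the scalar linear equation y' = k y, so multiplying it
    by exp(- A) gives a constant.\<close>
  have "((\<lambda>t. f (g t) * exp (- A t)) has_real_derivative 0) (at t)" for t
    by (rule derivative_eq_intros A[unfolded has_real_derivative_iff_has_vector_derivative[symmetric]]
          fg[unfolded has_real_derivative_iff_has_vector_derivative[symmetric]] refl | simp)+
  hence "f (g t) * exp (- A t) = f (g t0) * exp (- A t0)" for t
    by (intro DERIV_isconst_all[of "\<lambda>t. f (g t) * exp (- A t)"]) auto
  hence f0: "f (g t) = 0" for t using fz t0 by simp
  have "continuous_on C h" using bl(2) by (intro linear_continuous_on)
  then obtain m where m: "m \<in> C" "\<And>y. y \<in> C \<Longrightarrow> h y \<le> h m"
    using continuous_attains_sup[OF compact_closed_orbit[OF C]] z by blast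
  obtain s where s: "m = g s" using m(1) g(2) by auto
  have "h (F (g s)) = 0"
    by (rule DERIV_local_max[OF hg[unfolded has_real_derivative_iff_has_vector_derivative[symmetric]], of 1 s])
      (use m g s in auto)
  moreover have "f (F (g s)) = 0" by (simp add: k(2) f0)
  ultimately have "F m = 0" using inj s by blast
  thus False using closed_orbit_nonsingular[OF F C m(1)] by simp
qed

text \<open>If p were on the line f = 0, then so would be the points near p in direction e. They lie
  on closed orbits, which avoid the line.\<close>

lemma center_off_invariant_line:
  fixes F :: "real \<times> real \<Rightarrow> real \<times> real" and f h :: "real \<times> real \<Rightarrow> real"
  assumes F: "locally_lip F" and C: "is_center F p"
    and bl: "bounded_linear f" "bounded_linear h" and inj: "\<And>z. f z = 0 \<Longrightarrow> h z = 0 \<Longrightarrow> z = 0"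
    and k: "continuous_on UNIV k" "\<And>z. f (F z) = f z * k z"
    and e: "f e = 0" "e \<noteq> 0"
  shows "f p \<noteq> 0"
proof
  assume fp: "f p = 0"
  obtain U where U: "open U" "p \<in> U"
    and orb: "\<And>q. q \<in> U - {p} \<Longrightarrow> \<exists>C. closed_orbit F C \<and> q \<in> C \<and> C \<subseteq> U - {p}"
    using C by (auto simp: is_center_def)
  obtain r where r: "r > 0" "ball p r \<subseteq> U" using U open_contains_ball by blast
  define q where "q = p + (r / (2 * norm e)) *\<^sub>R e"
  have "dist p q = r / 2" using r(1) e(2) by (simp add: q_def dist_norm)
  hence "q \<in> U - {p}" using r by auto
  then obtain C where "closed_orbit F C" "q \<in> C" using orb by blast
  hence "f q \<noteq> 0" using closed_orbit_off_invariant_line[OF F _ bl inj k] by blast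
  moreover have "f q = 0"
    using fp e(1) bl(1) by (simp add: q_def bounded_linear.linear linear_add linear_cmul)
  ultimately show False by simp
qed

section \<open>Quadratic Kolmogorov systems\<close>

definition quad_poly :: "(nat \<Rightarrow> nat \<Rightarrow> real) \<Rightarrow> real poly poly" where
  "quad_poly c = [: [:c 0 0, c 1 0, c 2 0:], [:c 0 1, c 1 1:], [:c 0 2:] :]"

text \<open>Conics are handled through their coefficient functions: linear combinations and
  comparison of coefficients, on which the pencil argument rests, become plain real
  arithmetic.\<close>

definition qf :: "(nat \<Rightarrow> nat \<Rightarrow> real) \<Rightarrow> real \<times> real \<Rightarrow> real" where
  "qf c z = c 0 0 + c 1 0 * fst z + c 0 1 * snd z + c 2 0 * (fst z)\<^sup>2 + c 1 1 * fst z * snd z + c 0 2 * (snd z)\<^sup>2"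

definition qf_dx :: "(nat \<Rightarrow> nat \<Rightarrow> real) \<Rightarrow> real \<times> real \<Rightarrow> real" where
  "qf_dx c z = c 1 0 + 2 * c 2 0 * fst z + c 1 1 * snd z"

definition qf_dy :: "(nat \<Rightarrow> nat \<Rightarrow> real) \<Rightarrow> real \<times> real \<Rightarrow> real" where
  "qf_dy c z = c 0 1 + c 1 1 * fst z + 2 * c 0 2 * snd z"

lemma eval2_quad_poly: "eval2 (quad_poly c) x y = qf c (x, y)"
  by (simp add: eval2_def quad_poly_def qf_def power2_eq_square algebra_simps)

lemma quadratic_imp_quad_poly:
  assumes "quadratic P"
  shows "P = quad_poly (\<lambda>i j. coeff (coeff P j) i)"
proof (rule poly_eqI, rule poly_eqI)
  fix j i
  have *: "coeff (coeff P j) i = 0" if "i + j > 2" using assms that by (auto simp: quadratic_def not_le[symmetric])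
  consider "j = 0" | "j = 1" | "j = 2" | "j > 2" by linarith
  thus "coeff (coeff P j) i = coeff (coeff (quad_poly (\<lambda>i j. coeff (coeff P j) i)) j) i"
  proof cases
    case 1
    consider "i = 0" | "i = 1" | "i = 2" | "i > 2" by linarith
    thus ?thesis using * 1
      by cases (auto simp: quad_poly_def coeff_pCons numeral_2_eq_2 split: nat.split)
  next
    case 2
    consider "i = 0" | "i = 1" | "i \<ge> 2" by linarith
    thus ?thesis using * 2
      by cases (auto simp: quad_poly_def coeff_pCons numeral_2_eq_2 split: nat.split)
  next
    case 3
    thus ?thesis using *
      by (cases "i = 0") (auto simp: quad_poly_def coeff_pCons numeral_2_eq_2 split: nat.split)
  next
    case 4
    thus ?thesis using * by (auto simp: quad_poly_def coeff_pCons split: nat.split)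
  qed
qed

lemma quadratic_quad_poly:
  assumes "c 2 0 \<noteq> 0 \<or> c 1 1 \<noteq> 0 \<or> c 0 2 \<noteq> 0"
  shows "quadratic (quad_poly c)"
proof -
  have c: "coeff (coeff (quad_poly c) 0) 2 = c 2 0" "coeff (coeff (quad_poly c) 1) 1 = c 1 1"
       "coeff (coeff (quad_poly c) 2) 0 = c 0 2"
    by (simp_all add: quad_poly_def numeral_2_eq_2)
  have "\<exists>i j. coeff (coeff (quad_poly c) j) i \<noteq> 0 \<and> i + j = 2"
    using assms c by (metis add.commute add_0 one_add_one)
  moreover have "\<forall>i j. coeff (coeff (quad_poly c) j) i \<noteq> 0 \<longrightarrow> i + j \<le> 2"
    by (auto simp: quad_poly_def coeff_pCons split: nat.splits)
  ultimately show ?thesis by (auto simp: quadratic_def)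
qed

text \<open>Second differences on a small grid isolate the three quadratic coefficients, first
  differences then the linear ones, and the value at one point the constant.\<close>

lemma qf_zero_on_open:
  assumes "open U" "U \<noteq> {}" "\<And>z. z \<in> U \<Longrightarrow> qf c z = 0"
  shows "c 0 0 = 0 \<and> c 1 0 = 0 \<and> c 0 1 = 0 \<and> c 2 0 = 0 \<and> c 1 1 = 0 \<and> c 0 2 = 0"
proof -
  obtain x y where "(x, y) \<in> U" using assms(2) by auto
  then obtain r where r: "r > 0" "ball (x, y) r \<subseteq> U" using assms(1) open_contains_ball by blast
  define d where "d = r / 4"
  have d: "d > 0" using r by (simp add: d_def)
  have z: "qf c (x + s, y + t) = 0" if "s \<in> {-d, 0, d}" "t \<in> {-d, 0, d}" for s t
  proof (rule assms(3))
    have "dist (x, y) (x + s, y + t) \<le> \<bar>s\<bar> + \<bar>t\<bar>"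
      by (simp add: dist_prod_def dist_real_def sqrt_sum_squares_le_sum_abs)
    also have "\<dots> < r" using that d r by (auto simp: d_def)
    finally show "(x + s, y + t) \<in> U" using r(2) by auto
  qed
  have z0: "qf c (x, y) = 0" using z[of 0 0] by simp
  have z1: "qf c (x + d, y) = 0" "qf c (x - d, y) = 0" "qf c (x, y + d) = 0" "qf c (x, y - d) = 0"
       "qf c (x + d, y + d) = 0"
    using z[of d 0] z[of "-d" 0] z[of 0 d] z[of 0 "-d"] z[of d d] by simp_all
  have "2 * (c 2 0 * d\<^sup>2) = qf c (x + d, y) + qf c (x - d, y) - 2 * qf c (x, y)"
    by (simp add: qf_def power2_eq_square algebra_simps)
  hence c20: "c 2 0 = 0" using z0 z1 d by simp
  have "2 * (c 0 2 * d\<^sup>2) = qf c (x, y + d) + qf c (x, y - d) - 2 * qf c (x, y)"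
    by (simp add: qf_def power2_eq_square algebra_simps)
  hence c02: "c 0 2 = 0" using z0 z1 d by simp
  have "c 1 1 * d\<^sup>2 = qf c (x + d, y + d) - qf c (x + d, y) - qf c (x, y + d) + qf c (x, y)"
    by (simp add: qf_def power2_eq_square algebra_simps)
  hence c11: "c 1 1 = 0" using z0 z1 d by simp
  have "c 1 0 * d = qf c (x + d, y) - qf c (x, y)" using c20 c11 by (simp add: qf_def algebra_simps)
  hence c10: "c 1 0 = 0" using z0 z1 d by simp
  have "c 0 1 * d = qf c (x, y + d) - qf c (x, y)" using c02 c11 by (simp add: qf_def algebra_simps)
  hence c01: "c 0 1 = 0" using z0 z1 d by simp
  show ?thesis using z0 c20 c02 c11 c10 c01 by (simp add: qf_def)
qed

definition vf :: "(nat \<Rightarrow> nat \<Rightarrow> real) \<Rightarrow> (nat \<Rightarrow> nat \<Rightarrow> real) \<Rightarrow> real \<times> real \<Rightarrow> real \<times> real" where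
  "vf a b z = (fst z * qf a z, snd z * qf b z)"

lemma kolmogorov_quad_poly: "kolmogorov (quad_poly a) (quad_poly b) = vf a b"
  by (auto simp: kolmogorov_def vf_def eval2_quad_poly)

text \<open>The Lipschitz property alone does not pass to products. Together with boundedness it
  does, so on a bounded set the class contains all polynomials.\<close>

definition bounded_lip :: "'a::metric_space set \<Rightarrow> ('a \<Rightarrow> real) \<Rightarrow> bool" where
  "bounded_lip S f \<longleftrightarrow> (\<exists>L. L-lipschitz_on S f) \<and> bounded (f ` S)"

lemma bounded_lip_const: "bounded_lip S (\<lambda>_. c)"
  unfolding bounded_lip_def by (auto intro: lipschitz_on_constant finite_imp_bounded finite_subset[of _ "{c}"])

lemma bounded_lip_add: "bounded_lip S f \<Longrightarrow> bounded_lip S g \<Longrightarrow> bounded_lip S (\<lambda>z. f z + g z)"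
  unfolding bounded_lip_def by (auto intro: lipschitz_on_add bounded_plus_comp)

lemma bounded_lip_mult:
  assumes "bounded_lip S f" "bounded_lip S g"
  shows "bounded_lip S (\<lambda>z. f z * g z)"
proof -
  obtain L M where L: "L-lipschitz_on S f" "M-lipschitz_on S g" using assms by (auto simp: bounded_lip_def)
  obtain A B where AB: "\<And>z. z \<in> S \<Longrightarrow> \<bar>f z\<bar> \<le> A" "\<And>z. z \<in> S \<Longrightarrow> \<bar>g z\<bar> \<le> B"
    using assms by (auto simp: bounded_lip_def bounded_iff)
  have nn: "0 \<le> L" "0 \<le> M" using L lipschitz_on_nonneg by blast+
  have "(\<bar>A\<bar> * M + \<bar>B\<bar> * L)-lipschitz_on S (\<lambda>z. f z * g z)"
  proof (rule lipschitz_onI)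
    fix x y assume xy: "x \<in> S" "y \<in> S"
    have "f x * g x - f y * g y = f x * (g x - g y) + g y * (f x - f y)" by (simp add: algebra_simps)
    hence "dist (f x * g x) (f y * g y) \<le> \<bar>f x\<bar> * dist (g x) (g y) + \<bar>g y\<bar> * dist (f x) (f y)"
      using abs_triangle_ineq[of "f x * (g x - g y)" "g y * (f x - f y)"] by (simp add: dist_real_def abs_mult)
    also have "\<dots> \<le> \<bar>A\<bar> * (M * dist x y) + \<bar>B\<bar> * (L * dist x y)"
      using AB(1)[OF xy(1)] AB(2)[OF xy(2)] lipschitz_onD[OF L(1) xy] lipschitz_onD[OF L(2) xy]
      by (intro add_mono mult_mono) auto
    finally show "dist (f x * g x) (f y * g y) \<le> (\<bar>A\<bar> * M + \<bar>B\<bar> * L) * dist x y"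
      by (simp add: algebra_simps)
  qed (use nn in auto)
  moreover have "bounded ((\<lambda>z. f z * g z) ` S)"
    unfolding bounded_iff
  proof (intro exI[of _ "A * B"] ballI)
    fix w assume "w \<in> (\<lambda>z. f z * g z) ` S"
    then obtain z where z: "z \<in> S" "w = f z * g z" by auto
    have "\<bar>f z\<bar> * \<bar>g z\<bar> \<le> A * B" using AB[OF z(1)] by (intro mult_mono) auto
    thus "norm w \<le> A * B" by (simp add: z(2) abs_mult)
  qed
  ultimately show ?thesis by (auto simp: bounded_lip_def)
qed

lemma bounded_lip_fst_snd:
  assumes "bounded (S :: (real \<times> real) set)"
  shows "bounded_lip S fst" "bounded_lip S snd"
proof -
  have "1-lipschitz_on S fst" "1-lipschitz_on S snd"
    by (intro lipschitz_onI; simp add: dist_fst_le dist_snd_le)+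
  thus "bounded_lip S fst" "bounded_lip S snd"
    using assms by (auto simp: bounded_lip_def intro: bounded_fst bounded_snd)
qed

lemma locally_lip_vf: "locally_lip (vf a b)"
  unfolding locally_lip_def
proof
  fix R
  let ?S = "cball (0 :: real \<times> real) R"
  have q: "bounded_lip ?S (qf c)" for c
    unfolding qf_def[abs_def] power2_eq_square
    by (intro bounded_lip_add bounded_lip_mult bounded_lip_const bounded_lip_fst_snd bounded_cball)
  have "bounded_lip ?S (\<lambda>z. fst z * qf a z)" "bounded_lip ?S (\<lambda>z. snd z * qf b z)"
    by (intro bounded_lip_mult q bounded_lip_fst_snd bounded_cball)+
  then obtain L M where "L-lipschitz_on ?S (\<lambda>z. fst z * qf a z)" "M-lipschitz_on ?S (\<lambda>z. snd z * qf b z)"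
    by (auto simp: bounded_lip_def)
  from lipschitz_on_Pair[OF this] show "\<exists>L. L-lipschitz_on ?S (vf a b)"
    unfolding vf_def[abs_def] by blast
qed

lemma qf_has_derivative: "(qf c has_derivative (\<lambda>h. qf_dx c z * fst h + qf_dy c z * snd h)) (at z)"
  unfolding qf_def[abs_def] qf_dx_def qf_dy_def
  by (auto intro!: derivative_eq_intros simp: algebra_simps)

lemma vf_has_derivative:
  "(vf a b has_derivative
     lin2 (qf a z + fst z * qf_dx a z) (fst z * qf_dy a z) (snd z * qf_dx b z) (qf b z + snd z * qf_dy b z)) (at z)"
proof -
  have "(vf a b has_derivative (\<lambda>h. (fst z * (qf_dx a z * fst h + qf_dy a z * snd h) + fst h * qf a z,
        snd z * (qf_dx b z * fst h + qf_dy b z * snd h) + snd h * qf b z))) (at z)"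
    unfolding vf_def[abs_def]
    by (intro has_derivative_Pair has_derivative_mult qf_has_derivative has_derivative_fst has_derivative_snd has_derivative_ident)
  thus ?thesis
    by (rule has_derivative_eq_rhs) (auto simp: lin2_def algebra_simps)
qed

section \<open>Centers and closed orbits avoid the axes; centers are isolated zeros\<close>

definition off_axes :: "(real \<times> real) set" where
  "off_axes = {(x, y). x * y \<noteq> 0}"

lemma off_axes_iff: "z \<in> off_axes \<longleftrightarrow> fst z \<noteq> 0 \<and> snd z \<noteq> 0"
  by (cases z) (simp add: off_axes_def)

lemma open_off_axes: "open off_axes"
proof -
  have "open {z :: real \<times> real. fst z * snd z \<noteq> 0}"
    by (intro open_Collect_neq continuous_intros)
  moreover have "{z :: real \<times> real. fst z * snd z \<noteq> 0} = off_axes" by (auto simp: off_axes_def)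
  ultimately show ?thesis by simp
qed

lemma continuous_on_qf: "continuous_on S (qf c)"
  by (meson continuous_at_imp_continuous_on has_derivative_continuous qf_has_derivative)

lemma closed_orbit_vf_off_axes:
  assumes "closed_orbit (vf a b) C"
  shows "C \<subseteq> off_axes"
proof
  fix z assume z: "z \<in> C"
  have "fst z \<noteq> 0"
    by (rule closed_orbit_off_invariant_line[OF locally_lip_vf assms bounded_linear_fst bounded_linear_snd _ continuous_on_qf[of _ a] _ z])
      (auto simp: vf_def prod_eq_iff)
  moreover have "snd z \<noteq> 0"
    by (rule closed_orbit_off_invariant_line[OF locally_lip_vf assms bounded_linear_snd bounded_linear_fst _ continuous_on_qf[of _ b] _ z])
      (auto simp: vf_def prod_eq_iff)
  ultimately show "z \<in> off_axes" by (simp add: off_axes_iff)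
qed

lemma center_vf_off_axes:
  assumes "is_center (vf a b) p"
  shows "p \<in> off_axes"
proof -
  have "fst p \<noteq> 0"
    by (rule center_off_invariant_line[OF locally_lip_vf assms bounded_linear_fst bounded_linear_snd _ continuous_on_qf[of _ a], of "(0, 1)"])
      (auto simp: vf_def prod_eq_iff)
  moreover have "snd p \<noteq> 0"
    by (rule center_off_invariant_line[OF locally_lip_vf assms bounded_linear_snd bounded_linear_fst _ continuous_on_qf[of _ b], of "(1, 0)"])
      (auto simp: vf_def prod_eq_iff)
  ultimately show ?thesis by (simp add: off_axes_iff)
qed

lemma center_vf_zero:
  assumes "is_center (vf a b) p"
  shows "qf a p = 0" "qf b p = 0"
  using assms center_vf_off_axes[OF assms] by (auto simp: is_center_def vf_def off_axes_iff prod_eq_iff)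

lemma center_isolated:
  assumes "locally_lip F" "is_center F p"
  obtains r where "r > 0" "\<And>z. z \<in> ball p r - {p} \<Longrightarrow> F z \<noteq> (0 :: real \<times> real)"
proof -
  obtain U where U: "open U" "p \<in> U"
    and orb: "\<And>q. q \<in> U - {p} \<Longrightarrow> \<exists>C. closed_orbit F C \<and> q \<in> C \<and> C \<subseteq> U - {p}"
    using assms(2) by (auto simp: is_center_def)
  obtain r where r: "r > 0" "ball p r \<subseteq> U" using U open_contains_ball by blast
  show ?thesis
    using that[OF r(1)] orb closed_orbit_nonsingular[OF assms(1)] r(2) by (metis DiffD1 DiffD2 DiffI subsetD)
qed

lemma center_vf_isolated:
  assumes "is_center (vf a b) p"
  obtains r where "r > 0" "\<And>z. z \<in> ball p r \<Longrightarrow> qf a z = 0 \<Longrightarrow> qf b z = 0 \<Longrightarrow> z = p"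
proof -
  obtain r where r: "r > 0" "\<And>z. z \<in> ball p r - {p} \<Longrightarrow> vf a b z \<noteq> 0"
    using center_isolated[OF locally_lip_vf assms] by blast
  show ?thesis by (rule that[OF r(1)]) (use r(2) in \<open>force simp: vf_def zero_prod_def\<close>)
qed

definition jac :: "(nat \<Rightarrow> nat \<Rightarrow> real) \<Rightarrow> (nat \<Rightarrow> nat \<Rightarrow> real) \<Rightarrow> real \<times> real \<Rightarrow> real" where
  "jac a b z = qf_dx a z * qf_dy b z - qf_dy a z * qf_dx b z"

text \<open>At a common zero of P and Q the linear part of the field is the Jacobian matrix of (P,
  Q) with its rows scaled by x and y, so its determinant is x y J and its trace x P_x + y
  Q_y.\<close>

lemma center_vf_trace_det:
  assumes "is_center (vf a b) p" "jac a b p \<noteq> 0"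
  shows "fst p * qf_dx a p + snd p * qf_dy b p = 0" "fst p * snd p * jac a b p > 0"
proof -
  have z: "qf a p = 0" "qf b p = 0" "p \<in> off_axes"
    using assms(1) center_vf_zero center_vf_off_axes by blast+
  have d: "(vf a b has_derivative lin2 (fst p * qf_dx a p) (fst p * qf_dy a p) (snd p * qf_dx b p) (snd p * qf_dy b p)) (at p)"
    using vf_has_derivative[of a b p] z by simp
  have e: "fst p * qf_dx a p * (snd p * qf_dy b p) - fst p * qf_dy a p * (snd p * qf_dx b p) = fst p * snd p * jac a b p"
    by (simp add: jac_def algebra_simps)
  hence nz: "fst p * qf_dx a p * (snd p * qf_dy b p) - fst p * qf_dy a p * (snd p * qf_dx b p) \<noteq> 0"
    using assms(2) z(3) by (simp add: off_axes_iff)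
  show "fst p * qf_dx a p + snd p * qf_dy b p = 0" "fst p * snd p * jac a b p > 0"
    using center_trace_det[OF locally_lip_vf d assms(1) nz] e by simp_all
qed

section \<open>The elementary first integral\<close>

text \<open>
  With \<open>V = \<bar>x\<bar>\<^bsup>m-1\<^esup> \<bar>y\<bar>\<^bsup>n-1\<^esup>\<close> as an integrating factor, the condition on the divergence separates
  into one condition for each monomial.
\<close>

definition divergence_free :: "real \<Rightarrow> real \<Rightarrow> (nat \<Rightarrow> nat \<Rightarrow> real) \<Rightarrow> (nat \<Rightarrow> nat \<Rightarrow> real) \<Rightarrow> bool" where
  "divergence_free m n a b \<longleftrightarrow>
     (\<forall>(i, j) \<in> {(0, 0), (1, 0), (0, 1), (2, 0), (1, 1), (0, 2)}.
        a i j * (m + real i) + b i j * (n + real j) = 0)"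

lemma divergence_freeD:
  assumes "divergence_free m n a b"
  shows "a 0 0 * m + b 0 0 * n = 0" "a 1 0 * (m + 1) + b 1 0 * n = 0" "a 0 1 * m + b 0 1 * (n + 1) = 0"
    "a 2 0 * (m + 2) + b 2 0 * n = 0" "a 1 1 * (m + 1) + b 1 1 * (n + 1) = 0" "a 0 2 * m + b 0 2 * (n + 2) = 0"
  using assms by (simp_all add: divergence_free_def)

definition int_factor :: "real \<Rightarrow> real \<Rightarrow> real \<times> real \<Rightarrow> real" where
  "int_factor m n z = \<bar>fst z\<bar> powr (m - 1) * \<bar>snd z\<bar> powr (n - 1)"

text \<open>The usual denominator m + i is left out, so that the formula survives m + i = 0: off 0
  it is then sgn(x)^(i+1), which is locally constant.\<close>

definition pow_antideriv :: "real \<Rightarrow> nat \<Rightarrow> real \<Rightarrow> real" where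
  "pow_antideriv m i x = x ^ (i + 1) * \<bar>x\<bar> powr (m - 1)"

lemma has_real_derivative_abs:
  assumes "x \<noteq> (0::real)"
  shows "(abs has_real_derivative sgn x) (at x)"
proof -
  have "open {y. y * x > 0}" by (intro open_Collect_less continuous_intros)
  moreover have "sgn x * y = \<bar>y\<bar>" if "y \<in> {y. y * x > 0}" for y
    using that by (auto simp: zero_less_mult_iff)
  moreover have "((\<lambda>y. sgn x * y) has_real_derivative sgn x) (at x)"
    by (auto intro!: derivative_eq_intros)
  moreover have "x \<in> {y. y * x > 0}" using assms by (simp add: zero_less_mult_iff) linarith
  ultimately show ?thesis using has_field_derivative_transform_within_open by blast
qed

lemma has_real_derivative_abs_powr:
  assumes "x \<noteq> (0::real)"
  shows "((\<lambda>x. \<bar>x\<bar> powr a) has_real_derivative a * \<bar>x\<bar> powr a / x) (at x)"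
proof -
  from DERIV_chain2[OF has_real_derivative_powr[of "\<bar>x\<bar>" a] has_real_derivative_abs[OF assms]]
  have "((\<lambda>x. \<bar>x\<bar> powr a) has_real_derivative a * \<bar>x\<bar> powr (a - 1) * sgn x) (at x)" using assms by simp
  moreover have "a * \<bar>x\<bar> powr (a - 1) * sgn x = a * \<bar>x\<bar> powr a / x"
    using assms by (simp add: powr_diff sgn_real_def field_simps)
  ultimately show ?thesis by simp
qed

lemma has_real_derivative_ln_abs:
  assumes "x \<noteq> (0::real)"
  shows "((\<lambda>x. ln \<bar>x\<bar>) has_real_derivative 1 / x) (at x)"
proof -
  from DERIV_chain2[OF DERIV_ln_divide[of "\<bar>x\<bar>"] has_real_derivative_abs[OF assms]] assms
  have "((\<lambda>x. ln \<bar>x\<bar>) has_real_derivative 1 / \<bar>x\<bar> * sgn x) (at x)" by simp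
  moreover have "1 / \<bar>x\<bar> * sgn x = 1 / x" using assms by (simp add: sgn_real_def)
  ultimately show ?thesis by simp
qed

lemma has_real_derivative_pow_antideriv:
  assumes "x \<noteq> 0"
  shows "(pow_antideriv m i has_real_derivative (m + real i) * (x ^ i * \<bar>x\<bar> powr (m - 1))) (at x)"
proof -
  have "((\<lambda>x. x ^ (i + 1)) has_real_derivative real (i + 1) * x ^ i) (at x)"
    using DERIV_pow[of "i + 1" x] by simp
  from DERIV_mult[OF this has_real_derivative_abs_powr[OF assms, of "m - 1"]]
  have "(pow_antideriv m i has_real_derivative
      real (i + 1) * x ^ i * \<bar>x\<bar> powr (m - 1) + (m - 1) * \<bar>x\<bar> powr (m - 1) / x * x ^ (i + 1)) (at x)"
    unfolding pow_antideriv_def[abs_def] .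
  moreover have "real (i + 1) * x ^ i * \<bar>x\<bar> powr (m - 1) + (m - 1) * \<bar>x\<bar> powr (m - 1) / x * x ^ (i + 1) =
      (m + real i) * (x ^ i * \<bar>x\<bar> powr (m - 1))"
    using assms by (simp add: field_simps)
  ultimately show ?thesis by simp
qed

text \<open>The contribution of one monomial to H, with y-derivative a V x^(i+1) y^j and
  x-derivative - b V x^i y^(j+1). Integrate in y if n + j is nonzero, otherwise in x if m + i is
  nonzero; if both vanish, X Y is locally constant off the axes and logarithms appear.\<close>

definition monomial_integral :: "real \<Rightarrow> real \<Rightarrow> real \<Rightarrow> real \<Rightarrow> nat \<Rightarrow> nat \<Rightarrow> real \<times> real \<Rightarrow> real" where
  "monomial_integral m n a b i j z =
     (let X = pow_antideriv m i (fst z); Y = pow_antideriv n j (snd z) in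
      if n + real j \<noteq> 0 then a / (n + real j) * (X * Y)
      else if m + real i \<noteq> 0 then - b / (m + real i) * (X * Y)
      else X * Y * (a * ln \<bar>snd z\<bar> + (- b) * ln \<bar>fst z\<bar>))"

lemma monomial_integral_has_derivative:
  assumes z: "z \<in> off_axes" and ab: "a * (m + real i) + b * (n + real j) = 0"
  shows "(monomial_integral m n a b i j has_derivative
     (\<lambda>h. int_factor m n z * ((fst z) ^ i * (snd z) ^ j * cross (fst z * a, snd z * b) h))) (at z)"
proof -
  obtain x y where [simp]: "z = (x, y)" by (cases z)
  have xy: "x \<noteq> 0" "y \<noteq> 0" using z by (auto simp: off_axes_iff)
  define X Y where "X = pow_antideriv m i" and "Y = pow_antideriv n j"
  define X' where "X' = x ^ i * \<bar>x\<bar> powr (m - 1)"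
  define Y' where "Y' = y ^ j * \<bar>y\<bar> powr (n - 1)"
  have XY: "X x = x * X'" "Y y = y * Y'" by (simp_all add: X_def Y_def X'_def Y'_def pow_antideriv_def)
  have fx: "((\<lambda>z. f (fst z)) has_derivative (\<lambda>h. d * fst h)) (at z)" if "(f has_real_derivative d) (at x)" for f d
    using has_derivative_compose[OF bounded_linear_imp_has_derivative[OF bounded_linear_fst], where x = z and s = UNIV and g = f and g' = "(*) d"]
      that by (simp add: has_field_derivative_def)
  have fy: "((\<lambda>z. f (snd z)) has_derivative (\<lambda>h. d * snd h)) (at z)" if "(f has_real_derivative d) (at y)" for f d
    using has_derivative_compose[OF bounded_linear_imp_has_derivative[OF bounded_linear_snd], where x = z and s = UNIV and g = f and g' = "(*) d"]
      that by (simp add: has_field_derivative_def)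
  have dX: "((\<lambda>z. X (fst z)) has_derivative (\<lambda>h. ((m + real i) * X') * fst h)) (at z)"
    unfolding X_def X'_def by (rule fx[OF has_real_derivative_pow_antideriv[OF xy(1)]])
  have dY: "((\<lambda>z. Y (snd z)) has_derivative (\<lambda>h. ((n + real j) * Y') * snd h)) (at z)"
    unfolding Y_def Y'_def by (rule fy[OF has_real_derivative_pow_antideriv[OF xy(2)]])
  have dXY: "((\<lambda>z. X (fst z) * Y (snd z)) has_derivative
      (\<lambda>h. X x * (((n + real j) * Y') * snd h) + ((m + real i) * X') * fst h * Y y)) (at z)"
    using has_derivative_mult[OF dX dY] by simp
  have rhs: "int_factor m n z * ((fst z) ^ i * (snd z) ^ j * cross (fst z * a, snd z * b) h) =
      X' * Y' * (x * a * snd h - y * b * fst h)" for h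
    by (simp add: int_factor_def X'_def Y'_def cross_def)
  consider "n + real j \<noteq> 0" | "n + real j = 0" "m + real i \<noteq> 0" | "n + real j = 0" "m + real i = 0" by blast
  thus ?thesis
  proof cases
    case 1
    have "monomial_integral m n a b i j = (\<lambda>z. a / (n + real j) * (X (fst z) * Y (snd z)))"
      using 1 by (auto simp: monomial_integral_def X_def Y_def)
    moreover have b: "b = - (a * (m + real i)) / (n + real j)" using ab 1 by (simp add: field_simps)
    have "a / (n + real j) * (X x * (((n + real j) * Y') * snd h) + ((m + real i) * X') * fst h * Y y) =
        X' * Y' * (x * a * snd h - y * b * fst h)" for h
      unfolding XY b using 1 by (simp add: field_simps)
    ultimately show ?thesis
      unfolding rhs using has_derivative_mult_right[OF dXY, of "a / (n + real j)"] by (simp only:)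
  next
    case 2
    have a: "a = 0" using ab 2 by simp
    have "monomial_integral m n a b i j = (\<lambda>z. - b / (m + real i) * (X (fst z) * Y (snd z)))"
      using 2 by (auto simp: monomial_integral_def X_def Y_def)
    moreover have "- b / (m + real i) * (X x * (((n + real j) * Y') * snd h) + ((m + real i) * X') * fst h * Y y) =
        X' * Y' * (x * a * snd h - y * b * fst h)" for h
      unfolding XY a using 2 by (simp add: field_simps)
    ultimately show ?thesis
      unfolding rhs using has_derivative_mult_right[OF dXY, of "- b / (m + real i)"] by (simp only:)
  next
    case 3
    have "monomial_integral m n a b i j = (\<lambda>z. X (fst z) * Y (snd z) * (a * ln \<bar>snd z\<bar> + (- b) * ln \<bar>fst z\<bar>))"
      using 3 by (auto simp: monomial_integral_def X_def Y_def)
    moreover have "((\<lambda>z. a * ln \<bar>snd z\<bar> + (- b) * ln \<bar>fst z\<bar>) has_derivative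
        (\<lambda>h. a * (1 / y * snd h) + (- b) * (1 / x * fst h))) (at z)"
      by (intro has_derivative_add has_derivative_mult_right fx[OF has_real_derivative_ln_abs[OF xy(1)]]
          fy[OF has_real_derivative_ln_abs[OF xy(2)]])
    from has_derivative_mult[OF dXY this]
    have "((\<lambda>z. X (fst z) * Y (snd z) * (a * ln \<bar>snd z\<bar> + (- b) * ln \<bar>fst z\<bar>)) has_derivative
        (\<lambda>h. X x * Y y * (a * (1 / y * snd h) + (- b) * (1 / x * fst h)))) (at z)"
      using 3 by simp
    moreover have "X x * Y y * (a * (1 / y * snd h) + (- b) * (1 / x * fst h)) =
        X' * Y' * (x * a * snd h - y * b * fst h)" for h
      unfolding XY using xy by (simp add: field_simps)
    ultimately show ?thesis unfolding rhs by simp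
  qed
qed

definition kolmogorov_integral ::
    "real \<Rightarrow> real \<Rightarrow> (nat \<Rightarrow> nat \<Rightarrow> real) \<Rightarrow> (nat \<Rightarrow> nat \<Rightarrow> real) \<Rightarrow> real \<times> real \<Rightarrow> real" where
  "kolmogorov_integral m n a b z =
     monomial_integral m n (a 0 0) (b 0 0) 0 0 z + monomial_integral m n (a 1 0) (b 1 0) 1 0 z +
     monomial_integral m n (a 0 1) (b 0 1) 0 1 z + monomial_integral m n (a 2 0) (b 2 0) 2 0 z +
     monomial_integral m n (a 1 1) (b 1 1) 1 1 z + monomial_integral m n (a 0 2) (b 0 2) 0 2 z"

lemma integrates_kolmogorov:
  assumes "divergence_free m n a b"
  shows "integrates off_axes (vf a b) (int_factor m n) (kolmogorov_integral m n a b)"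
  unfolding integrates_def
proof (intro ballI conjI)
  fix z assume z: "z \<in> off_axes"
  show "int_factor m n z > 0" using z by (simp add: int_factor_def off_axes_iff)
  show "(kolmogorov_integral m n a b has_derivative (\<lambda>h. int_factor m n z * cross (vf a b z) h)) (at z)"
    unfolding kolmogorov_integral_def[abs_def]
  proof (rule has_derivative_eq_rhs)
    note D = divergence_freeD[OF assms]
    note M = monomial_integral_has_derivative[OF z]
    show "((\<lambda>z. monomial_integral m n (a 0 0) (b 0 0) 0 0 z + monomial_integral m n (a 1 0) (b 1 0) 1 0 z +
         monomial_integral m n (a 0 1) (b 0 1) 0 1 z + monomial_integral m n (a 2 0) (b 2 0) 2 0 z +
         monomial_integral m n (a 1 1) (b 1 1) 1 1 z + monomial_integral m n (a 0 2) (b 0 2) 0 2 z) has_derivative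
       (\<lambda>h. int_factor m n z * (fst z ^ 0 * snd z ^ 0 * cross (fst z * a 0 0, snd z * b 0 0) h) +
            int_factor m n z * (fst z ^ 1 * snd z ^ 0 * cross (fst z * a 1 0, snd z * b 1 0) h) +
            int_factor m n z * (fst z ^ 0 * snd z ^ 1 * cross (fst z * a 0 1, snd z * b 0 1) h) +
            int_factor m n z * (fst z ^ 2 * snd z ^ 0 * cross (fst z * a 2 0, snd z * b 2 0) h) +
            int_factor m n z * (fst z ^ 1 * snd z ^ 1 * cross (fst z * a 1 1, snd z * b 1 1) h) +
            int_factor m n z * (fst z ^ 0 * snd z ^ 2 * cross (fst z * a 0 2, snd z * b 0 2) h))) (at z)"
      by (intro has_derivative_add M) (use D in simp_all)
  qed (simp add: fun_eq_iff cross_def vf_def qf_def power2_eq_square algebra_simps)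
qed

section \<open>Elementarity and nonconstancy of the first integral\<close>

lemma elementary_poly: "(\<lambda>z. eval2 R (fst z) (snd z)) \<in> elementary"
  using elementary.polynomial[of R] by (simp add: case_prod_unfold)

lemma elementary_const: "(\<lambda>z. c) \<in> elementary"
  using elementary_poly[of "[:[:c:]:]"] by (simp add: eval2_def)

lemma elementary_pow_antideriv:
  "(\<lambda>z. pow_antideriv m i (fst z)) \<in> elementary" "(\<lambda>z. pow_antideriv m i (snd z)) \<in> elementary"
proof -
  have "(\<lambda>z. fst z ^ (i + 1)) \<in> elementary"
    using elementary_poly[of "[:monom 1 (i + 1):]"] by (simp add: eval2_def poly_monom)
  moreover have "(\<lambda>z. \<bar>fst z\<bar> powr (m - 1)) \<in> elementary"
    using elementary.powr_x[of "m - 1"] by (simp add: case_prod_unfold)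
  ultimately show "(\<lambda>z. pow_antideriv m i (fst z)) \<in> elementary"
    unfolding pow_antideriv_def by (rule elementary.mult)
  have "(\<lambda>z. snd z ^ (i + 1)) \<in> elementary"
    using elementary_poly[of "monom 1 (i + 1)"] by (simp add: eval2_def poly_monom)
  moreover have "(\<lambda>z. \<bar>snd z\<bar> powr (m - 1)) \<in> elementary"
    using elementary.powr_y[of "m - 1"] by (simp add: case_prod_unfold)
  ultimately show "(\<lambda>z. pow_antideriv m i (snd z)) \<in> elementary"
    unfolding pow_antideriv_def by (rule elementary.mult)
qed

lemma elementary_monomial_integral: "monomial_integral m n a b i j \<in> elementary"
proof -
  have "(\<lambda>z. ln \<bar>fst z\<bar>) \<in> elementary" "(\<lambda>z. ln \<bar>snd z\<bar>) \<in> elementary"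
    using elementary.ln_x elementary.ln_y by (simp_all add: case_prod_unfold)
  note intros = elementary.mult elementary.add elementary_const elementary_pow_antideriv this
  show ?thesis
    unfolding monomial_integral_def[abs_def] Let_def
    by (cases "n + real j = 0"; cases "m + real i = 0"; simp only: if_True if_False simp_thms; intro intros)
qed

lemma elementary_kolmogorov_integral: "kolmogorov_integral m n a b \<in> elementary"
  unfolding kolmogorov_integral_def[abs_def] by (intro elementary.add elementary_monomial_integral)

text \<open>The y-derivative of H is V x P, with V and x nonzero; if H were constant on an open set,
  the conic P would vanish there and so have no coefficients.\<close>

lemma integrates_nonconstant:
  assumes int: "integrates off_axes (vf a b) V H" and U: "open U" "U \<noteq> {}" "U \<subseteq> off_axes"
    and a: "a 2 0 \<noteq> 0 \<or> a 1 1 \<noteq> 0 \<or> a 0 2 \<noteq> 0"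
  shows "\<not> H constant_on U"
proof
  assume "H constant_on U"
  then obtain c where c: "\<And>z. z \<in> U \<Longrightarrow> H z = c" by (auto simp: constant_on_def)
  have "qf a z = 0" if z: "z \<in> U" for z
  proof -
    have zD: "z \<in> off_axes" using z U(3) by blast
    have "(H has_derivative (\<lambda>h. 0)) (at z)"
      using has_derivative_transform_within_open[OF has_derivative_const U(1) z, of c H] c by simp
    from has_derivative_unique[OF integratesD(2)[OF int zD] this]
    have "V z * cross (vf a b z) (0, 1) = 0" by (rule fun_cong)
    thus ?thesis using integratesD(1)[OF int zD] zD by (simp add: cross_def vf_def off_axes_iff)
  qed
  from qf_zero_on_open[OF U(1,2) this] a show False by blast
qed

section \<open>Four common zeros of two conics\<close>

definition qf2 :: "(nat \<Rightarrow> nat \<Rightarrow> real) \<Rightarrow> real \<times> real \<Rightarrow> real" where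
  "qf2 c u = c 2 0 * (fst u)\<^sup>2 + c 1 1 * fst u * snd u + c 0 2 * (snd u)\<^sup>2"

text \<open>The polarization \<open>qf2 c (u + v) - qf2 c u - qf2 c v\<close>; it is the coefficient
  of s t in the Taylor expansion at p + s u + t v.\<close>

definition qf_polar :: "(nat \<Rightarrow> nat \<Rightarrow> real) \<Rightarrow> real \<times> real \<Rightarrow> real \<times> real \<Rightarrow> real" where
  "qf_polar c u v = 2 * c 2 0 * fst u * fst v + c 1 1 * (fst u * snd v + snd u * fst v) + 2 * c 0 2 * snd u * snd v"

definition qf_dir :: "(nat \<Rightarrow> nat \<Rightarrow> real) \<Rightarrow> real \<times> real \<Rightarrow> real \<times> real \<Rightarrow> real" where
  "qf_dir c z u = qf_dx c z * fst u + qf_dy c z * snd u"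

lemma qf_affine:
  "qf c (p + s *\<^sub>R u + t *\<^sub>R v) =
     qf c p + s * qf_dir c p u + t * qf_dir c p v + s\<^sup>2 * qf2 c u + s * t * qf_polar c u v + t\<^sup>2 * qf2 c v"
  by (simp add: qf_def qf_dir_def qf_dx_def qf_dy_def qf2_def qf_polar_def power2_eq_square algebra_simps)

lemma qf_dir_affine:
  "qf_dir c (p + s *\<^sub>R u + t *\<^sub>R v) u = qf_dir c p u + 2 * s * qf2 c u + t * qf_polar c u v"
  "qf_dir c (p + s *\<^sub>R u + t *\<^sub>R v) v = qf_dir c p v + s * qf_polar c u v + 2 * t * qf2 c v"
  by (simp_all add: qf_dir_def qf_dx_def qf_dy_def qf2_def qf_polar_def power2_eq_square algebra_simps)

lemma qf_diff_combination:
  "qf (\<lambda>i j. c i j - k * a i j - l * b i j) z = qf c z - k * qf a z - l * qf b z"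
  "qf2 (\<lambda>i j. c i j - k * a i j - l * b i j) z = qf2 c z - k * qf2 a z - l * qf2 b z"
  by (simp_all add: qf_def qf2_def algebra_simps)

lemma jac_cross: "jac a b z * cross u v = qf_dir a z u * qf_dir b z v - qf_dir a z v * qf_dir b z u"
  by (simp add: jac_def cross_def qf_dir_def algebra_simps)

lemma parallel_of_cross_zero:
  assumes "cross u v = 0" "u \<noteq> 0"
  obtains s where "v = s *\<^sub>R u"
proof
  have n: "(fst u)\<^sup>2 + (snd u)\<^sup>2 \<noteq> 0" using assms(2) by (auto simp: prod_eq_iff sum_power2_eq_zero_iff)
  have c: "fst u * snd v = snd u * fst v" using assms(1) by (simp add: cross_def)
  have "fst v * ((fst u)\<^sup>2 + (snd u)\<^sup>2) = (u \<bullet> v) * fst u" "snd v * ((fst u)\<^sup>2 + (snd u)\<^sup>2) = (u \<bullet> v) * snd u"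
    using c by (simp add: inner_prod_def, algebra)+
  thus "v = ((u \<bullet> v) / ((fst u)\<^sup>2 + (snd u)\<^sup>2)) *\<^sub>R u"
    using n by (simp add: prod_eq_iff field_simps)
qed

text \<open>Cramer's rule in the basis u, v with origin p.\<close>

lemma coordinates:
  assumes "cross u v \<noteq> 0"
  shows "z = p + (cross (z - p) v / cross u v) *\<^sub>R u + (cross u (z - p) / cross u v) *\<^sub>R v"
proof -
  have "fst (z - p) * cross u v = cross (z - p) v * fst u + cross u (z - p) * fst v"
       "snd (z - p) * cross u v = cross (z - p) v * snd u + cross u (z - p) * snd v"
    by (simp_all add: cross_def algebra_simps)
  thus ?thesis using assms by (simp add: prod_eq_iff field_simps)
qed

text \<open>A conic through three collinear points contains the line, so its zeros are not isolated.\<close>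

lemma centers_not_collinear:
  assumes "is_center (vf a b) p" "is_center (vf a b) q" "is_center (vf a b) r" "p \<noteq> q" "p \<noteq> r" "q \<noteq> r"
  shows "cross (q - p) (r - p) \<noteq> 0"
proof
  assume "cross (q - p) (r - p) = 0"
  moreover have u0: "q - p \<noteq> 0" using assms(4) by simp
  ultimately obtain s where s: "r - p = s *\<^sub>R (q - p)" by (rule parallel_of_cross_zero)
  define u where "u = q - p"
  have r: "r = p + s *\<^sub>R u + 0 *\<^sub>R u" and q: "q = p + 1 *\<^sub>R u + 0 *\<^sub>R u" using s by (simp_all add: u_def algebra_simps)
  have s01: "s \<noteq> 0" "s \<noteq> 1" using r q assms(5,6) by auto
  have line: "qf c (p + x *\<^sub>R u + 0 *\<^sub>R u) = 0" if "qf c p = 0" "qf c q = 0" "qf c r = 0" for c x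
  proof -
    have 1: "qf_dir c p u + qf2 c u = 0" using that(1,2) qf_affine[of c p 1 u 0 u] q by simp
    have "s * qf_dir c p u + s\<^sup>2 * qf2 c u = 0" using that(1,3) qf_affine[of c p s u 0 u] r by simp
    hence "s * (s - 1) * qf2 c u = 0" using 1 by algebra
    hence "qf2 c u = 0" using s01 by simp
    thus ?thesis using that(1) 1 by (simp only: qf_affine) simp
  qed
  obtain e where e: "e > 0" "\<And>z. z \<in> ball p e \<Longrightarrow> qf a z = 0 \<Longrightarrow> qf b z = 0 \<Longrightarrow> z = p"
    using center_vf_isolated[OF assms(1)] by blast
  define z where "z = p + (e / (2 * norm u)) *\<^sub>R u + 0 *\<^sub>R u"
  have nu: "norm u > 0" using u0 by (simp add: u_def)
  have "dist p z = e / 2" using e(1) nu by (simp add: z_def dist_norm)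
  hence "z \<in> ball p e" "z \<noteq> p" using e(1) by auto
  moreover have "qf a z = 0" "qf b z = 0"
    unfolding z_def by (intro line center_vf_zero[OF assms(1)] center_vf_zero[OF assms(2)] center_vf_zero[OF assms(3)])+
  ultimately show False using e(2) by blast
qed

text \<open>A short segment through p along the gradient has ends where \<open>f\<close> takes
  opposite signs. Both ends lie on a circle around p, which is connected, so \<open>f\<close>
  vanishes on that circle. This is what excludes proportional P and Q.\<close>

lemma zero_not_isolated:
  fixes f :: "real \<times> real \<Rightarrow> real"
  assumes f: "(f has_derivative (\<lambda>h. g1 * fst h + g2 * snd h)) (at p)" "continuous_on UNIV f" "f p = 0"
    and g: "g1 \<noteq> 0 \<or> g2 \<noteq> 0" and r: "r > 0"
  shows "\<exists>z \<in> ball p r - {p}. f z = 0"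
proof -
  define g where "g = (g1, g2)"
  have g0: "norm g > 0" using g by (simp add: g_def zero_prod_def)
  define \<phi> where "\<phi> t = f (p + t *\<^sub>R g)" for t
  have "((\<lambda>t. p + t *\<^sub>R g) has_derivative (\<lambda>t. t *\<^sub>R g)) (at 0)"
    by (auto intro!: derivative_eq_intros)
  moreover have "(f has_derivative (\<lambda>h. g1 * fst h + g2 * snd h)) (at (p + 0 *\<^sub>R g))" using f(1) by simp
  ultimately have "((\<lambda>t. f (p + t *\<^sub>R g)) has_derivative (\<lambda>t. g1 * fst (t *\<^sub>R g) + g2 * snd (t *\<^sub>R g))) (at 0)"
    by (rule has_derivative_compose)
  moreover have "(\<lambda>t. g1 * fst (t *\<^sub>R g) + g2 * snd (t *\<^sub>R g)) = (*) (g1\<^sup>2 + g2\<^sup>2)"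
    by (simp add: fun_eq_iff g_def power2_eq_square algebra_simps)
  ultimately have "(\<phi> has_real_derivative g1\<^sup>2 + g2\<^sup>2) (at 0)"
    by (simp only: \<phi>_def[abs_def] has_field_derivative_def)
  moreover have "g1\<^sup>2 + g2\<^sup>2 > 0" using g by (simp add: sum_power2_gt_zero_iff)
  ultimately obtain d1 d2 where d: "d1 > 0" "d2 > 0"
      "\<And>h. 0 < h \<Longrightarrow> h < d1 \<Longrightarrow> \<phi> 0 < \<phi> (0 + h)"
      "\<And>h. 0 < h \<Longrightarrow> h < d2 \<Longrightarrow> \<phi> (0 - h) < \<phi> 0"
    using DERIV_pos_inc_right DERIV_pos_inc_left by metis
  have \<phi>0: "\<phi> 0 = 0" using f(3) by (simp add: \<phi>_def)
  define M where "M = min (min d1 d2) (r / norm g)"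
  define h where "h = M / 2"
  have "M > 0" "M \<le> d1" "M \<le> d2" "M \<le> r / norm g" using d r g0 by (auto simp: M_def)
  hence h: "h > 0" "h < d1" "h < d2" "h < r / norm g" unfolding h_def by linarith+
  have hr: "h * norm g < r" using h(4) g0 by (simp add: pos_less_divide_eq)
  have pts: "p + h *\<^sub>R g \<in> sphere p (h * norm g)" "p - h *\<^sub>R g \<in> sphere p (h * norm g)"
    using h(1) by (simp_all add: dist_norm)
  have "connected (f ` sphere p (h * norm g))"
    by (intro connected_continuous_image continuous_on_subset[OF f(2)] connected_sphere) auto
  moreover have "f (p + h *\<^sub>R g) > 0" using d(3)[OF h(1,2)] \<phi>0 by (simp add: \<phi>_def)
  moreover have "f (p - h *\<^sub>R g) < 0" using d(4)[OF h(1,3)] \<phi>0 by (simp add: \<phi>_def)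
  ultimately have "0 \<in> f ` sphere p (h * norm g)"
    using connected_contains_Icc[OF _ imageI[OF pts(2)] imageI[OF pts(1)], of f] by auto
  then obtain z where z: "z \<in> sphere p (h * norm g)" "f z = 0" by auto
  have "z \<in> ball p r - {p}" using z(1) hr h(1) g0 by auto
  thus ?thesis using z(2) by blast
qed

section \<open>The pencil of conics through four points, in affine coordinates\<close>

locale four_zeros =
  fixes p u v :: "real \<times> real" and s t :: real
  assumes uv: "cross u v \<noteq> 0" and st: "s \<noteq> 0" "t \<noteq> 0"
begin

definition vanishes :: "(nat \<Rightarrow> nat \<Rightarrow> real) \<Rightarrow> bool" where
  "vanishes c \<longleftrightarrow> qf c p = 0 \<and> qf c (p + u) = 0 \<and> qf c (p + v) = 0 \<and> qf c (p + s *\<^sub>R u + t *\<^sub>R v) = 0"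

lemma vanishes_dir:
  assumes "vanishes c"
  shows "qf_dir c p u = - qf2 c u" "qf_dir c p v = - qf2 c v"
  using assms qf_affine[of c p 1 u 0 v] qf_affine[of c p 0 u 1 v] by (auto simp: vanishes_def)

lemma vanishes_polar:
  assumes "vanishes c"
  shows "s * t * qf_polar c u v = - (qf2 c u * (s\<^sup>2 - s) + qf2 c v * (t\<^sup>2 - t))"
  using assms qf_affine[of c p s u t v] vanishes_dir[OF assms] by (simp add: vanishes_def algebra_simps)

text \<open>The values of the quadratic part at u and v determine a conic through the four points:
  the zeros p + u and p + v yield the linear part, and the fourth one, thanks to s t \<noteq> 0, the
  mixed term. So these conics form a space of dimension at most 2.\<close>

lemma vanishes_zero:
  assumes c: "vanishes c" "qf2 c u = 0" "qf2 c v = 0"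
  shows "qf c z = 0"
proof -
  have "qf_polar c u v = 0" using vanishes_polar[OF c(1)] c(2,3) st by simp
  hence "qf c (p + x *\<^sub>R u + y *\<^sub>R v) = 0" for x y
    unfolding qf_affine using c vanishes_dir[OF c(1)] by (simp add: vanishes_def)
  thus ?thesis using coordinates[OF uv, of z p] by metis
qed

lemma vanishes_combination:
  assumes "vanishes c" "vanishes a" "vanishes b"
    "qf2 c u = k * qf2 a u + l * qf2 b u" "qf2 c v = k * qf2 a v + l * qf2 b v"
  shows "qf (\<lambda>i j. c i j - k * a i j - l * b i j) z = 0"
  by (rule vanishes_zero) (use assms in \<open>simp_all add: vanishes_def qf_diff_combination\<close>)

text \<open>The four Jacobians are inversely proportional to the barycentric coefficients \<open>1 - s - t, s, t, -1\<close>.\<close>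

lemma vanishes_jac:
  assumes "vanishes a" "vanishes b"
  defines "K \<equiv> (qf2 a u * qf2 b v - qf2 a v * qf2 b u) * (1 - s - t)"
  shows "(1 - s - t) * (jac a b p * cross u v) = K"
        "s * (jac a b (p + u) * cross u v) = K"
        "t * (jac a b (p + v) * cross u v) = K"
        "- (jac a b (p + s *\<^sub>R u + t *\<^sub>R v) * cross u v) = K"
proof -
  note ab = vanishes_dir[OF assms(1)] vanishes_dir[OF assms(2)]
  note pa = vanishes_polar[OF assms(1)] and pb = vanishes_polar[OF assms(2)]
  define A B C A' B' C' where "A = qf2 a u" and "B = qf2 a v" and "C = qf_polar a u v"
    and "A' = qf2 b u" and "B' = qf2 b v" and "C' = qf_polar b u v"
  note defs = A_def[symmetric] B_def[symmetric] C_def[symmetric] A'_def[symmetric] B'_def[symmetric] C'_def[symmetric]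
  have C: "s * t * C = - (A * (s\<^sup>2 - s) + B * (t\<^sup>2 - t))" "s * t * C' = - (A' * (s\<^sup>2 - s) + B' * (t\<^sup>2 - t))"
    using pa pb by (simp_all only: defs)
  have jac: "jac a b (p + x *\<^sub>R u + y *\<^sub>R v) * cross u v =
      (A * (2 * x - 1) + y * C) * (B' * (2 * y - 1) + x * C') - (B * (2 * y - 1) + x * C) * (A' * (2 * x - 1) + y * C')" for x y
    unfolding jac_cross qf_dir_affine ab defs by (simp add: algebra_simps)
  have K: "K = (A * B' - B * A') * (1 - s - t)" by (simp add: K_def defs)
  show "(1 - s - t) * (jac a b p * cross u v) = K"
  proof -
    have "jac a b p * cross u v = A * B' - B * A'" using jac[of 0 0] by simp
    thus ?thesis by (simp add: K)
  qed
  \<comment> \<open>The mixed terms enter through s t C and s t C', so the identities are proved up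
    to the nonzero factors t, s and s t.\<close>
  have "t * (s * (jac a b (p + u) * cross u v)) = t * K"
    using jac[of 1 0] C unfolding K by simp algebra
  thus "s * (jac a b (p + u) * cross u v) = K" using st by simp
  have "s * (t * (jac a b (p + v) * cross u v)) = s * K"
    using jac[of 0 1] C unfolding K by simp algebra
  thus "t * (jac a b (p + v) * cross u v) = K" using st by simp
  have "s * t * (- (jac a b (p + s *\<^sub>R u + t *\<^sub>R v) * cross u v)) = s * t * K"
    using C unfolding K jac by algebra
  from mult_left_cancel[THEN iffD1, OF _ this] st
  show "- (jac a b (p + s *\<^sub>R u + t *\<^sub>R v) * cross u v) = K" by simp
qed

end


lemma four_centers:
  assumes quad: "a 2 0 \<noteq> 0 \<or> a 1 1 \<noteq> 0 \<or> a 0 2 \<noteq> 0"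
    and C: "is_center (vf a b) p1" "is_center (vf a b) p2" "is_center (vf a b) p3" "is_center (vf a b) p4"
    and dist: "distinct [p1, p2, p3, p4]"
  obtains e1 e2 e3 e4 m n where "divergence_free m n a b"
    "e1 + e2 + e3 + e4 = 0" "e1 *\<^sub>R p1 + e2 *\<^sub>R p2 + e3 *\<^sub>R p3 + e4 *\<^sub>R p4 = 0"
    "e1 * (fst p1 * snd p1) > 0" "e2 * (fst p2 * snd p2) > 0" "e3 * (fst p3 * snd p3) > 0" "e4 * (fst p4 * snd p4) > 0"
proof -
  define u v where "u = p2 - p1" and "v = p3 - p1"
  define s t where "s = cross (p4 - p1) v / cross u v" and "t = cross u (p4 - p1) / cross u v"
  have uv: "cross u v \<noteq> 0"
    unfolding u_def v_def using dist by (intro centers_not_collinear[OF C(1,2,3)]) auto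
  have p2: "p2 = p1 + u" and p3: "p3 = p1 + v" by (simp_all add: u_def v_def)
  have p4: "p4 = p1 + s *\<^sub>R u + t *\<^sub>R v" unfolding s_def t_def by (rule coordinates[OF uv])
  \<comment> \<open>Up to the factor \<open>cross u v\<close>, the barycentric coordinates s, t and
    1 - s - t of p4 are crosses of differences of three centers; noncollinearity makes them
    nonzero.\<close>
  have "cross (p4 - p1) v \<noteq> 0"
    unfolding v_def using dist by (intro centers_not_collinear[OF C(1,4,3)]) auto
  hence s: "s \<noteq> 0" using uv by (simp add: s_def)
  have "cross u (p4 - p1) \<noteq> 0"
    unfolding u_def using dist by (intro centers_not_collinear[OF C(1,2,4)]) auto
  hence t: "t \<noteq> 0" using uv by (simp add: t_def)
  have "cross (p3 - p2) (p4 - p2) \<noteq> 0"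
    using dist by (intro centers_not_collinear[OF C(2,3,4)]) auto
  also have "cross (p3 - p2) (p4 - p2) = (1 - s - t) * cross u v"
    unfolding p2 p3 p4 by (simp add: cross_def algebra_simps)
  finally have st1: "1 - s - t \<noteq> 0" by simp
  interpret four_zeros p1 u v s t by unfold_locales (use uv s t in auto)
  have va: "vanishes a" and vb: "vanishes b"
    using C(1,2,3,4)[THEN center_vf_zero(1)] C(1,2,3,4)[THEN center_vf_zero(2)]
    unfolding vanishes_def p2 p3 p4 by blast+
  define K where "K = (qf2 a u * qf2 b v - qf2 a v * qf2 b u) * (1 - s - t)"
  have a_nz: "qf2 a u \<noteq> 0 \<or> qf2 a v \<noteq> 0"
  proof (rule ccontr)
    assume "\<not> (qf2 a u \<noteq> 0 \<or> qf2 a v \<noteq> 0)"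
    hence "qf a z = 0" for z using vanishes_zero[OF va] by blast
    from qf_zero_on_open[OF open_UNIV _ this] quad show False by auto
  qed
  \<comment> \<open>If Q were a multiple of P, every zero of P would be a common zero. But the
    gradient of P at p1 is nonzero, having the values - \<open>qf2 a u\<close> and -
    \<open>qf2 a v\<close> on u and v, so p1 would not be isolated.\<close>
  have ab: "qf2 a u * qf2 b v - qf2 a v * qf2 b u \<noteq> 0"
  proof
    assume eq: "qf2 a u * qf2 b v - qf2 a v * qf2 b u = 0"
    obtain l where l: "qf2 b u = l * qf2 a u" "qf2 b v = l * qf2 a v"
    proof (cases "qf2 a u = 0")
      case True
      thus ?thesis using that[of "qf2 b v / qf2 a v"] a_nz eq by auto
    next
      case False
      thus ?thesis using that[of "qf2 b u / qf2 a u"] eq by (simp add: field_simps)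
    qed
    have proportional: "qf b z = l * qf a z" for z
    proof -
      have "qf (\<lambda>i j. b i j - l * a i j - 0 * a i j) z = 0"
        by (rule vanishes_combination[OF vb va va]) (use l in auto)
      thus ?thesis unfolding qf_diff_combination by simp
    qed
    obtain r where r: "r > 0" "\<And>z. z \<in> ball p1 r \<Longrightarrow> qf a z = 0 \<Longrightarrow> qf b z = 0 \<Longrightarrow> z = p1"
      using center_vf_isolated[OF C(1)] by blast
    have "qf_dx a p1 \<noteq> 0 \<or> qf_dy a p1 \<noteq> 0"
      using vanishes_dir[OF va] a_nz by (auto simp: qf_dir_def)
    hence "\<exists>z \<in> ball p1 r - {p1}. qf a z = 0"
      using va r(1) by (intro zero_not_isolated[OF qf_has_derivative continuous_on_qf]) (auto simp: vanishes_def)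
    then obtain z where "z \<in> ball p1 r - {p1}" "qf a z = 0" by blast
    thus False using r(2)[of z] proportional[of z] by auto
  qed
  have K: "K \<noteq> 0" using ab st1 by (simp add: K_def)
  note J = vanishes_jac[OF va vb, folded K_def p2 p3 p4]
  have jac: "jac a b p1 \<noteq> 0" "jac a b p2 \<noteq> 0" "jac a b p3 \<noteq> 0" "jac a b p4 \<noteq> 0"
    using J K by auto
  note tr = center_vf_trace_det(1)[OF C(1) jac(1)] center_vf_trace_det(1)[OF C(2) jac(2)]
    center_vf_trace_det(1)[OF C(3) jac(3)] center_vf_trace_det(1)[OF C(4) jac(4)]
  \<comment> \<open>The operators x d/dx and y d/dy multiply x^i y^j by i and j, so c is the conic x
    P_x + y Q_y.\<close>
  define c where "c i j = real i * a i j + real j * b i j" for i j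
  have "qf c z = fst z * qf_dx a z + snd z * qf_dy b z" for z
    by (simp add: qf_def qf_dx_def qf_dy_def c_def power2_eq_square algebra_simps)
  hence vc: "vanishes c" unfolding vanishes_def using tr by (simp add: p2 p3 p4)
  define D where "D = qf2 a u * qf2 b v - qf2 a v * qf2 b u"
  \<comment> \<open>Cramer's rule for c = k a + l b, with the values of the quadratic parts at u and
    v as coordinates on the pencil.\<close>
  define k where "k = (qf2 c u * qf2 b v - qf2 c v * qf2 b u) / D"
  define l where "l = (qf2 a u * qf2 c v - qf2 a v * qf2 c u) / D"
  have D: "D \<noteq> 0" using ab by (simp add: D_def)
  have kD: "k * D = qf2 c u * qf2 b v - qf2 c v * qf2 b u" "l * D = qf2 a u * qf2 c v - qf2 a v * qf2 c u"
    using D by (simp_all add: k_def l_def)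
  have "D * (k * qf2 a u + l * qf2 b u) = D * qf2 c u" "D * (k * qf2 a v + l * qf2 b v) = D * qf2 c v"
    using kD D_def by algebra+
  hence cu: "qf2 c u = k * qf2 a u + l * qf2 b u" "qf2 c v = k * qf2 a v + l * qf2 b v"
    using D by simp_all
  \<comment> \<open>Comparing coefficients in c = k a + l b gives a i j (i - k) + b i j (j - l) =
    0.\<close>
  define m n where "m = - k" and "n = - l"
  have "(\<lambda>i j. c i j - k * a i j - l * b i j) 0 0 = 0 \<and> (\<lambda>i j. c i j - k * a i j - l * b i j) 1 0 = 0 \<and>
     (\<lambda>i j. c i j - k * a i j - l * b i j) 0 1 = 0 \<and> (\<lambda>i j. c i j - k * a i j - l * b i j) 2 0 = 0 \<and>
     (\<lambda>i j. c i j - k * a i j - l * b i j) 1 1 = 0 \<and> (\<lambda>i j. c i j - k * a i j - l * b i j) 0 2 = 0"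
    by (rule qf_zero_on_open[OF open_UNIV]) (use vanishes_combination[OF vc va vb cu] in auto)
  hence dfree: "divergence_free m n a b"
    by (simp add: divergence_free_def c_def m_def n_def algebra_simps)
  \<comment> \<open>From e (j \<open>cross u v\<close>) = K the number e K \<open>cross u v\<close>
    equals K^2 / j and has the sign of j. Scaling the barycentric relation by K
    \<open>cross u v\<close> thus gives all four coefficients the signs of their Jacobians at
    once.\<close>
  have pos: "e * K * cross u v * w > 0" if "e * (j * cross u v) = K" "w * j > 0" for e j w :: real
  proof -
    have "(e * K * cross u v * w) * j\<^sup>2 = K\<^sup>2 * (w * j)"
      unfolding that(1)[symmetric] by (simp add: power2_eq_square)
    also have "\<dots> > 0" using K that(2) by simp
    finally show ?thesis by (simp add: zero_less_mult_iff not_less power2_less_0)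
  qed
  show ?thesis
  proof (rule that[OF dfree])
    show "(1 - s - t) * K * cross u v + s * K * cross u v + t * K * cross u v + (- 1) * K * cross u v = 0"
      by (simp add: algebra_simps)
    show "((1 - s - t) * K * cross u v) *\<^sub>R p1 + (s * K * cross u v) *\<^sub>R p2 + (t * K * cross u v) *\<^sub>R p3 + ((- 1) * K * cross u v) *\<^sub>R p4 = 0"
      unfolding p2 p3 p4 by (simp add: prod_eq_iff algebra_simps)
    show "(1 - s - t) * K * cross u v * (fst p1 * snd p1) > 0"
      by (rule pos[OF J(1) center_vf_trace_det(2)[OF C(1) jac(1)]])
    show "s * K * cross u v * (fst p2 * snd p2) > 0"
      by (rule pos[OF J(2) center_vf_trace_det(2)[OF C(2) jac(2)]])
    show "t * K * cross u v * (fst p3 * snd p3) > 0"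
      by (rule pos[OF J(3) center_vf_trace_det(2)[OF C(3) jac(3)]])
    show "(- 1) * K * cross u v * (fst p4 * snd p4) > 0"
      by (rule pos[OF _ center_vf_trace_det(2)[OF C(4) jac(4)]]) (use J(4) in simp)
  qed
qed

section \<open>Configurations\<close>

lemma quadrants_nth:
  "quadrants ! 0 = {(x, y). x > 0 \<and> y > 0}" "quadrants ! 1 = {(x, y). x < 0 \<and> y > 0}"
  "quadrants ! 2 = {(x, y). x < 0 \<and> y < 0}" "quadrants ! 3 = {(x, y). x > 0 \<and> y < 0}"
    "quadrants ! Suc 0 = {(x, y). x < 0 \<and> y > 0}"
  by (simp_all add: quadrants_def)

lemma less_4_cases: "(j::nat) < 4 \<Longrightarrow> (j = 0 \<Longrightarrow> P) \<Longrightarrow> (j = 1 \<Longrightarrow> P) \<Longrightarrow> (j = 2 \<Longrightarrow> P) \<Longrightarrow> (j = 3 \<Longrightarrow> P) \<Longrightarrow> P"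
  by linarith

lemma quadrants_nth_inject:
  assumes "i < 4" "j < 4" "quadrants ! i = quadrants ! j"
  shows "i = j"
proof -
  have n: "(1, 1) \<in> quadrants ! k \<longleftrightarrow> k = 0" "(-1, 1) \<in> quadrants ! k \<longleftrightarrow> k = 1"
    "(-1, -1) \<in> quadrants ! k \<longleftrightarrow> k = 2" "(1, -1) \<in> quadrants ! k \<longleftrightarrow> k = 3" if "k < 4" for k
    using that by (elim less_4_cases; simp add: quadrants_nth)+
  have "i = 0 \<longleftrightarrow> j = 0" "i = 1 \<longleftrightarrow> j = 1" "i = 2 \<longleftrightarrow> j = 2"
    using n[OF assms(1)] n[OF assms(2)] unfolding assms(3) by blast+
  thus ?thesis using assms(1,2) by linarith
qed

lemma config_equiv_refl: "length c = 4 \<Longrightarrow> config_equiv c c"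
  unfolding config_equiv_def
  by (intro conjI bexI[of _ id] plane_symmetries.intros(1)) (auto dest: quadrants_nth_inject)

text \<open>As \<open>h\<close> is an involution, \<open>h \<circ> g\<close> maps quadrant i onto
  quadrant j exactly when \<open>g\<close> maps it onto quadrant \<pi> j. So permuting the target by
  \<pi> amounts to composing the witness with \<open>h\<close>.\<close>

lemma config_equiv_step:
  assumes h: "\<And>g. g \<in> plane_symmetries \<Longrightarrow> h \<circ> g \<in> plane_symmetries" "\<And>z. h (h z) = z"
    and \<pi>: "\<And>j. j < 4 \<Longrightarrow> \<pi> j < 4 \<and> (\<forall>z. h z \<in> quadrants ! j \<longleftrightarrow> z \<in> quadrants ! \<pi> j) \<and> d' ! j = d ! \<pi> j"
    and len: "length d' = 4" and eq: "config_equiv c d"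
  shows "config_equiv c d'"
proof -
  obtain g where g: "g \<in> plane_symmetries" "\<And>i j. i < 4 \<Longrightarrow> j < 4 \<Longrightarrow> g ` (quadrants ! i) = quadrants ! j \<Longrightarrow> d ! j = c ! i"
    using eq by (auto simp: config_equiv_def)
  have "d' ! j = c ! i" if ij: "i < 4" "j < 4" "(h \<circ> g) ` (quadrants ! i) = quadrants ! j" for i j
  proof -
    have img: "h ` (g ` (quadrants ! i)) = quadrants ! j" using ij(3) by (simp add: image_comp)
    have "g ` (quadrants ! i) = quadrants ! \<pi> j"
    proof (rule set_eqI)
      fix z
      have "inj h" using h(2) by (rule inj_on_inverseI)
      hence "z \<in> g ` (quadrants ! i) \<longleftrightarrow> h z \<in> quadrants ! j" unfolding img[symmetric] by (simp add: inj_image_mem_iff)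
      thus "z \<in> g ` (quadrants ! i) \<longleftrightarrow> z \<in> quadrants ! \<pi> j" using \<pi>[OF ij(2)] by blast
    qed
    thus ?thesis using g(2)[OF ij(1)] \<pi>[OF ij(2)] by simp
  qed
  thus ?thesis using h(1)[OF g(1)] len eq unfolding config_equiv_def by blast
qed

lemma config_equiv_flip_x:
  assumes "config_equiv c [n1, n2, n3, n4]"
  shows "config_equiv c [n2, n1, n4, n3]"
proof (rule config_equiv_step[OF plane_symmetries.intros(2) _ _ _ assms])
  fix j :: nat assume "j < 4"
  thus "[1, 0, 3, 2] ! j < (4 :: nat) \<and>
      (\<forall>z. (\<lambda>(x, y). (- x, y)) z \<in> quadrants ! j \<longleftrightarrow> z \<in> quadrants ! ([1, 0, 3, 2] ! j)) \<and>
      [n2, n1, n4, n3] ! j = [n1, n2, n3, n4] ! ([1, 0, 3, 2] ! j)"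
    by (rule less_4_cases) (auto simp: quadrants_nth)
qed auto

lemma config_equiv_flip_y:
  assumes "config_equiv c [n1, n2, n3, n4]"
  shows "config_equiv c [n4, n3, n2, n1]"
proof (rule config_equiv_step[OF plane_symmetries.intros(3) _ _ _ assms])
  fix j :: nat assume "j < 4"
  thus "[3, 2, 1, 0] ! j < (4 :: nat) \<and>
      (\<forall>z. (\<lambda>(x, y). (x, - y)) z \<in> quadrants ! j \<longleftrightarrow> z \<in> quadrants ! ([3, 2, 1, 0] ! j)) \<and>
      [n4, n3, n2, n1] ! j = [n1, n2, n3, n4] ! ([3, 2, 1, 0] ! j)"
    by (rule less_4_cases) (auto simp: quadrants_nth)
qed auto

lemma config_equiv_swap:
  assumes "config_equiv c [n1, n2, n3, n4]"
  shows "config_equiv c [n1, n4, n3, n2]"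
proof (rule config_equiv_step[OF plane_symmetries.intros(4) _ _ _ assms])
  fix j :: nat assume "j < 4"
  thus "[0, 3, 2, 1] ! j < (4 :: nat) \<and>
      (\<forall>z. (\<lambda>(x, y). (y, x)) z \<in> quadrants ! j \<longleftrightarrow> z \<in> quadrants ! ([0, 3, 2, 1] ! j)) \<and>
      [n1, n4, n3, n2] ! j = [n1, n2, n3, n4] ! ([0, 3, 2, 1] ! j)"
    by (rule less_4_cases) (auto simp: quadrants_nth)
qed auto

definition normal_configs :: "nat list set" where
  "normal_configs = {[1,1,1,1], [0,1,2,1], [0,1,1,2]}"

text \<open>One of the three occupied quadrants holds two centers. The swap of x and y exchanges the
  second and the fourth quadrant, so a double second one can be moved to the fourth place.\<close>

lemma config_equiv_empty_first:
  assumes "config_equiv c [0, n2, n3, n4]" "n2 + n3 + n4 = 4" "n2 \<ge> 1" "n3 \<ge> 1" "n4 \<ge> 1"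
  shows "\<exists>d \<in> normal_configs. config_equiv c d"
proof -
  consider "n2 = 2" "n3 = 1" "n4 = 1" | "n2 = 1" "n3 = 2" "n4 = 1" | "n2 = 1" "n3 = 1" "n4 = 2"
    using assms(2-) by linarith
  thus ?thesis
    using assms(1) config_equiv_swap[OF assms(1)] by cases (auto simp: normal_configs_def)
qed

text \<open>The six sums count the centers in the four half-planes bounded by an axis and in the two
  pairs of opposite quadrants. An empty quadrant shares a sum with each of the others and so forces
  a center into all three; reflections move it to the first place.\<close>

lemma config_equiv_normal:
  assumes sum: "n1 + n2 + n3 + n4 = 4"
    and pairs: "n1 + n2 \<ge> 1" "n3 + n4 \<ge> 1" "n1 + n4 \<ge> 1" "n2 + n3 \<ge> 1" "n1 + n3 \<ge> 1" "n2 + n4 \<ge> 1"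
  shows "\<exists>d \<in> normal_configs. config_equiv [n1, n2, n3, n4] d"
proof -
  have r: "config_equiv [n1, n2, n3, n4] [n1, n2, n3, n4]" by (rule config_equiv_refl) simp
  consider "n1 = 0" | "n2 = 0" | "n3 = 0" | "n4 = 0" | "n1 = 1" "n2 = 1" "n3 = 1" "n4 = 1"
    using sum by linarith
  thus ?thesis
  proof cases
    case 1
    show ?thesis by (rule config_equiv_empty_first[of _ n2 n3 n4]) (use r 1 sum pairs in auto)
  next
    case 2
    show ?thesis
      by (rule config_equiv_empty_first[of _ n1 n4 n3]) (use config_equiv_flip_x[OF r] 2 sum pairs in auto)
  next
    case 3
    show ?thesis
      by (rule config_equiv_empty_first[of _ n4 n1 n2])
        (use config_equiv_flip_x[OF config_equiv_flip_y[OF r]] 3 sum pairs in auto)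
  next
    case 4
    show ?thesis
      by (rule config_equiv_empty_first[of _ n3 n2 n1]) (use config_equiv_flip_y[OF r] 4 sum pairs in auto)
  next
    case 5
    thus ?thesis using r by (auto simp: normal_configs_def)
  qed
qed

text \<open>From e (x y) > 0, e y has the sign of x and e x the sign of y. If all x (or all y) had
  one sign, the weighted sum of the y (of the x) could not be 0; if all products x y had one sign,
  neither could the sum of the coefficients.\<close>

lemma centers_coefficients:
  assumes "e1 * (fst p1 * snd p1) > 0" "e2 * (fst p2 * snd p2) > 0" "e3 * (fst p3 * snd p3) > 0"
    "e4 * (fst p4 * snd p4) > (0::real)"
    and e: "e1 + e2 + e3 + e4 = 0" "e1 *\<^sub>R p1 + e2 *\<^sub>R p2 + e3 *\<^sub>R p3 + e4 *\<^sub>R p4 = 0"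
  defines "S \<equiv> {p1, p2, p3, p4}"
  shows "\<exists>z\<in>S. fst z < 0" "\<exists>z\<in>S. fst z > 0" "\<exists>z\<in>S. snd z < 0" "\<exists>z\<in>S. snd z > 0"
    "\<exists>z\<in>S. fst z * snd z < 0" "\<exists>z\<in>S. fst z * snd z > 0"
proof -
  have ex: "e1 * fst p1 + e2 * fst p2 + e3 * fst p3 + e4 * fst p4 = 0"
    and ey: "e1 * snd p1 + e2 * snd p2 + e3 * snd p3 + e4 * snd p4 = 0"
    using arg_cong[OF e(2), of fst] arg_cong[OF e(2), of snd] by simp_all
  note pos = assms(1-4)
  have h: "x \<noteq> 0 \<and> y \<noteq> 0" if "e * (x * y) > 0" for e x y :: real using that by auto
  have nz: "fst z \<noteq> 0 \<and> snd z \<noteq> 0" if "z \<in> S" for z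
    using that h[OF pos(1)] h[OF pos(2)] h[OF pos(3)] h[OF pos(4)] unfolding S_def by blast
  have sgn: "fst z > 0 \<or> fst z < 0" "snd z > 0 \<or> snd z < 0" if "z \<in> S" for z
    using nz[OF that] by linarith+
 have sx: "x > 0 \<Longrightarrow> e * y > 0" "x < 0 \<Longrightarrow> e * y < 0" if "e * (x * y) > 0" for e x y :: real
    using that zero_less_mult_iff[of x "e * y"] by (simp_all add: mult.left_commute)
  have sy: "y > 0 \<Longrightarrow> e * x > 0" "y < 0 \<Longrightarrow> e * x < 0" if "e * (x * y) > 0" for e x y :: real
    using that zero_less_mult_iff[of y "e * x"] by (simp_all add: mult.left_commute mult.commute)
  have S: "p1 \<in> S" "p2 \<in> S" "p3 \<in> S" "p4 \<in> S" by (simp_all add: S_def)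
  show "\<exists>z\<in>S. fst z < 0"
  proof (rule ccontr)
    assume "\<not> (\<exists>z\<in>S. fst z < 0)"
    hence "fst p1 > 0" "fst p2 > 0" "fst p3 > 0" "fst p4 > 0" using sgn S by blast+
    hence "e1 * snd p1 > 0" "e2 * snd p2 > 0" "e3 * snd p3 > 0" "e4 * snd p4 > 0"
      using sx(1)[OF pos(1)] sx(1)[OF pos(2)] sx(1)[OF pos(3)] sx(1)[OF pos(4)] by blast+
    thus False using ey by linarith
  qed
  show "\<exists>z\<in>S. fst z > 0"
  proof (rule ccontr)
    assume "\<not> (\<exists>z\<in>S. fst z > 0)"
    hence "fst p1 < 0" "fst p2 < 0" "fst p3 < 0" "fst p4 < 0" using sgn S by blast+
    hence "e1 * snd p1 < 0" "e2 * snd p2 < 0" "e3 * snd p3 < 0" "e4 * snd p4 < 0"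
      using sx(2)[OF pos(1)] sx(2)[OF pos(2)] sx(2)[OF pos(3)] sx(2)[OF pos(4)] by blast+
    thus False using ey by linarith
  qed
  show "\<exists>z\<in>S. snd z < 0"
  proof (rule ccontr)
    assume "\<not> (\<exists>z\<in>S. snd z < 0)"
    hence "snd p1 > 0" "snd p2 > 0" "snd p3 > 0" "snd p4 > 0" using sgn S by blast+
    hence "e1 * fst p1 > 0" "e2 * fst p2 > 0" "e3 * fst p3 > 0" "e4 * fst p4 > 0"
      using sy(1)[OF pos(1)] sy(1)[OF pos(2)] sy(1)[OF pos(3)] sy(1)[OF pos(4)] by blast+
    thus False using ex by linarith
  qed
  show "\<exists>z\<in>S. snd z > 0"
  proof (rule ccontr)
    assume "\<not> (\<exists>z\<in>S. snd z > 0)"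
    hence "snd p1 < 0" "snd p2 < 0" "snd p3 < 0" "snd p4 < 0" using sgn S by blast+
    hence "e1 * fst p1 < 0" "e2 * fst p2 < 0" "e3 * fst p3 < 0" "e4 * fst p4 < 0"
      using sy(2)[OF pos(1)] sy(2)[OF pos(2)] sy(2)[OF pos(3)] sy(2)[OF pos(4)] by blast+
    thus False using ex by linarith
  qed
  show "\<exists>z\<in>S. fst z * snd z < 0"
  proof (rule ccontr)
    assume "\<not> (\<exists>z\<in>S. fst z * snd z < 0)"
    hence "fst z * snd z \<ge> 0" if "z \<in> S" for z using that by force
    hence "e1 > 0" "e2 > 0" "e3 > 0" "e4 > 0"
      using pos S by (metis mult_nonpos_nonneg not_less)+
    thus False using e(1) by linarith
  qed
  show "\<exists>z\<in>S. fst z * snd z > 0"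
  proof (rule ccontr)
    assume "\<not> (\<exists>z\<in>S. fst z * snd z > 0)"
    hence "fst z * snd z \<le> 0" if "z \<in> S" for z using that by force
    hence "e1 < 0" "e2 < 0" "e3 < 0" "e4 < 0"
      using pos S by (metis mult_nonneg_nonpos not_less)+
    thus False using e(1) by linarith
  qed
qed

lemma configuration_normal:
  assumes C: "card (centers F) = 4" "centers F \<subseteq> off_axes"
    and ex: "\<exists>z\<in>centers F. fst z < 0" "\<exists>z\<in>centers F. fst z > 0" "\<exists>z\<in>centers F. snd z < 0"
      "\<exists>z\<in>centers F. snd z > 0" "\<exists>z\<in>centers F. fst z * snd z < 0" "\<exists>z\<in>centers F. fst z * snd z > 0"
  shows "\<exists>d \<in> normal_configs. config_equiv (configuration F) d"
proof -
  define S where "S = centers F"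
  define A B C D where "A = {(x::real, y::real). x > 0 \<and> y > 0}" and "B = {(x::real, y::real). x < 0 \<and> y > 0}"
    and "C = {(x::real, y::real). x < 0 \<and> y < 0}" and "D = {(x::real, y::real). x > 0 \<and> y < 0}"
  define n1 n2 n3 n4 where "n1 = card (S \<inter> A)" and "n2 = card (S \<inter> B)"
    and "n3 = card (S \<inter> C)" and "n4 = card (S \<inter> D)"
  note n_defs = n1_def n2_def n3_def n4_def
  \<comment> \<open>An infinite set has cardinality 0, so cardinality 4 includes finiteness.\<close>
  have fin: "finite S" using assms(1) card.infinite by (force simp: S_def)
  have Q: "z \<in> A \<longleftrightarrow> fst z > 0 \<and> snd z > 0" "z \<in> B \<longleftrightarrow> fst z < 0 \<and> snd z > 0"
    "z \<in> C \<longleftrightarrow> fst z < 0 \<and> snd z < 0" "z \<in> D \<longleftrightarrow> fst z > 0 \<and> snd z < 0" for z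
    by (cases z; simp add: A_def B_def C_def D_def)+
  have nz: "fst z \<noteq> 0" "snd z \<noteq> 0" if "z \<in> S" for z using that assms(2) by (auto simp: S_def off_axes_def)
  have conf: "configuration F = [n1, n2, n3, n4]"
    by (simp add: configuration_def quadrants_def n_defs S_def A_def B_def C_def D_def)
  have S_eq: "S = (S \<inter> A) \<union> ((S \<inter> B) \<union> ((S \<inter> C) \<union> (S \<inter> D)))"
  proof -
    have "z \<in> A \<or> z \<in> B \<or> z \<in> C \<or> z \<in> D" if "z \<in> S" for z
      unfolding Q using nz[OF that] by linarith
    thus ?thesis by blast
  qed
  have "(S \<inter> A) \<inter> ((S \<inter> B) \<union> ((S \<inter> C) \<union> (S \<inter> D))) = {}" "(S \<inter> B) \<inter> ((S \<inter> C) \<union> (S \<inter> D)) = {}"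
    "(S \<inter> C) \<inter> (S \<inter> D) = {}"
    using Q by force+
  hence "card ((S \<inter> A) \<union> ((S \<inter> B) \<union> ((S \<inter> C) \<union> (S \<inter> D)))) = n1 + (n2 + (n3 + n4))"
    using fin by (simp only: card_Un_disjoint finite_Int finite_UnI n_defs simp_thms)
  hence sum: "n1 + n2 + n3 + n4 = 4" using assms(1) S_eq by (simp add: S_def)
  have ge: "card (S \<inter> X) + card (S \<inter> Y) \<ge> 1" if "z \<in> S" "z \<in> X \<or> z \<in> Y" for z X Y
  proof -
    have "S \<inter> X \<noteq> {} \<or> S \<inter> Y \<noteq> {}" using that by blast
    hence "card (S \<inter> X) > 0 \<or> card (S \<inter> Y) > 0" using fin by (simp add: card_gt_0_iff)
    thus ?thesis by linarith
  qed
  have sgn: "fst z > 0 \<or> fst z < 0" "snd z > 0 \<or> snd z < 0" if "z \<in> S" for z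
    using nz[OF that] by linarith+
  note ex' = ex[folded S_def]
  show ?thesis
    unfolding conf
  proof (rule config_equiv_normal[OF sum])
    show "n1 + n2 \<ge> 1" using ex'(4) unfolding n_defs
      by (elim bexE) (rule ge, assumption, use sgn Q in blast)
    show "n3 + n4 \<ge> 1" using ex'(3) unfolding n_defs
      by (elim bexE) (rule ge, assumption, use sgn Q in blast)
    show "n1 + n4 \<ge> 1" using ex'(2) unfolding n_defs
      by (elim bexE) (rule ge, assumption, use sgn Q in blast)
    show "n2 + n3 \<ge> 1" using ex'(1) unfolding n_defs
      by (elim bexE) (rule ge, assumption, use sgn Q in blast)
    show "n1 + n3 \<ge> 1" using ex'(6) unfolding n_defs
      by (elim bexE) (rule ge, assumption, use Q in \<open>auto simp: zero_less_mult_iff\<close>)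
    show "n2 + n4 \<ge> 1" using ex'(5) unfolding n_defs
      by (elim bexE) (rule ge, assumption, use Q in \<open>auto simp: mult_less_0_iff\<close>)
  qed
qed

section \<open>Systems with four centers\<close>

definition coeffs :: "real \<Rightarrow> real \<Rightarrow> real \<Rightarrow> real \<Rightarrow> real \<Rightarrow> real \<Rightarrow> nat \<Rightarrow> nat \<Rightarrow> real" where
  "coeffs c00 c10 c01 c20 c11 c02 i j =
     (if i = 0 then (if j = 0 then c00 else if j = 1 then c01 else c02)
      else if i = 1 then (if j = 0 then c10 else c11) else c20)"

lemma coeffs_simps [simp]:
  "coeffs c00 c10 c01 c20 c11 c02 0 0 = c00" "coeffs c00 c10 c01 c20 c11 c02 (Suc 0) 0 = c10"
  "coeffs c00 c10 c01 c20 c11 c02 0 (Suc 0) = c01" "coeffs c00 c10 c01 c20 c11 c02 2 0 = c20"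
  "coeffs c00 c10 c01 c20 c11 c02 (Suc 0) (Suc 0) = c11" "coeffs c00 c10 c01 c20 c11 c02 0 2 = c02"
  by (simp_all add: coeffs_def)

text \<open>The converse of \<open>center_vf_trace_det\<close>, in the presence of an integrating
  factor.\<close>

lemma center_vf_criterion:
  assumes "divergence_free m n a b" "p \<in> off_axes" "qf a p = 0" "qf b p = 0"
    "fst p * qf_dx a p + snd p * qf_dy b p = 0" "fst p * snd p * jac a b p > 0"
  shows "is_center (vf a b) p"
proof -
  have d: "(vf a b has_derivative lin2 (fst p * qf_dx a p) (fst p * qf_dy a p) (snd p * qf_dx b p) (snd p * qf_dy b p)) (at p)"
    using vf_has_derivative[of a b p] assms(3,4) by simp
  have "fst p * qf_dx a p * (snd p * qf_dy b p) - fst p * qf_dy a p * (snd p * qf_dx b p) = fst p * snd p * jac a b p"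
    by (simp add: jac_def algebra_simps)
  hence "fst p * qf_dx a p * (snd p * qf_dy b p) - fst p * qf_dy a p * (snd p * qf_dx b p) > 0" using assms(6) by simp
  moreover have "vf a b p = 0" using assms(3,4) by (simp add: vf_def zero_prod_def)
  ultimately show ?thesis
    using center_of_linearization[OF locally_lip_vf _ d assms(5) _ open_off_axes assms(2) integrates_kolmogorov[OF assms(1)]]
    by blast
qed

text \<open>Every center is a common zero of P and Q, so finding the centers of an example reduces
  to solving P = Q = 0 and checking trace and determinant at the solutions.\<close>

lemma centers_vf_eq:
  assumes "divergence_free m n a b"
    and "\<And>x y. qf a (x, y) = 0 \<Longrightarrow> qf b (x, y) = 0 \<Longrightarrow> (x, y) \<in> S"
    and "\<And>p. p \<in> S \<Longrightarrow> p \<in> off_axes \<and> qf a p = 0 \<and> qf b p = 0 \<and>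
        fst p * qf_dx a p + snd p * qf_dy b p = 0 \<and> fst p * snd p * jac a b p > 0"
  shows "centers (vf a b) = S"
proof (intro equalityI subsetI)
  fix p assume "p \<in> centers (vf a b)"
  hence "qf a p = 0" "qf b p = 0" using center_vf_zero by (auto simp: centers_def)
  thus "p \<in> S" using assms(2)[of "fst p" "snd p"] by simp
next
  fix p assume "p \<in> S"
  from assms(3)[OF this] show "p \<in> centers (vf a b)"
    using center_vf_criterion[OF assms(1)] by (simp add: centers_def)
qed

text \<open>
  The examples have the first integral \<open>\<bar>x\<bar>\<^sup>m \<bar>y\<bar>\<^sup>n h\<close> with \<open>h\<close> quadratic, for which
  \<open>P = - (y h\<^sub>y + n h)\<close> and \<open>Q = x h\<^sub>x + m h\<close> up to a factor. In the last two, \<open>h\<close>, \<open>m\<close>, \<open>n\<close> were found by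
  searching for four integer points at which \<open>P\<close>, \<open>Q\<close> and the trace can vanish.
\<close>

lemma configuration_1111:
  "\<exists>P Q. quadratic P \<and> quadratic Q \<and> card (centers (kolmogorov P Q)) = 4 \<and>
     configuration (kolmogorov P Q) = [1,1,1,1]"
proof -
  \<comment> \<open>Here h = 4 - x^2 - y^2 and m = n = 1.\<close>
  define a b where "a = coeffs (-4) 0 0 1 0 3" and "b = coeffs 4 0 0 (-3) 0 (-1)"
  have C: "centers (vf a b) = {(1, 1), (-1, 1), (-1, -1), (1, -1)}"
  proof (rule centers_vf_eq[of 1 1])
    show "divergence_free 1 1 a b" by (simp add: divergence_free_def a_def b_def)
    fix x y assume "qf a (x, y) = 0" "qf b (x, y) = 0"
    hence "x\<^sup>2 = 1" "y\<^sup>2 = 1" by (simp_all add: qf_def a_def b_def)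
    thus "(x, y) \<in> {(1, 1), (-1, 1), (-1, -1), (1, -1)}" by (auto simp: power2_eq_1_iff)
  qed (auto simp: off_axes_def qf_def qf_dx_def qf_dy_def jac_def a_def b_def)
  show ?thesis
    by (intro exI[of _ "quad_poly a"] exI[of _ "quad_poly b"] conjI quadratic_quad_poly)
      (simp_all add: kolmogorov_quad_poly configuration_def quadrants_def C, simp_all add: a_def b_def)
qed

lemma configuration_0121:
  "\<exists>P Q. quadratic P \<and> quadratic Q \<and> card (centers (kolmogorov P Q)) = 4 \<and>
     configuration (kolmogorov P Q) = [0,1,2,1]"
proof -
  \<comment> \<open>Here m = n = 12 and h is proportional to 39 x^2 + 72 x y + 39 y^2 + 234 x + 234
    y + 325. By this symmetry Q(x, y) = - P(y, x): exchanging x and y reverses time.\<close>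
  define a b where "a = coeffs 50 36 39 6 12 7" and "b = coeffs (-50) (-39) (-36) (-7) (-12) (-6)"
  have C: "centers (vf a b) = {(-1, -1), (-2, -2), (1, -4), (-4, 1)}"
  proof (rule centers_vf_eq[of 12 12])
    show "divergence_free 12 12 a b" by (simp add: divergence_free_def a_def b_def)
    fix x y assume z: "qf a (x, y) = 0" "qf b (x, y) = 0"
    \<comment> \<open>A degenerate member of the pencil: two lines, each containing two of the
      centers.\<close>
    have "(y - x) * (x + y + 3) = qf a (x, y) + qf b (x, y)"
      by (simp add: qf_def a_def b_def power2_eq_square algebra_simps)
    hence "y = x \<or> y = - 3 - x" using z by auto
    thus "(x, y) \<in> {(-1, -1), (-2, -2), (1, -4), (-4, 1)}"
    proof
      assume y: "y = x"
      have "25 * ((x + 1) * (x + 2)) = qf a (x, y)"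
        unfolding y by (simp add: qf_def a_def power2_eq_square algebra_simps)
      hence "x = -1 \<or> x = -2" using z(1) by auto
      thus ?thesis using y by auto
    next
      assume y: "y = - 3 - x"
      have "(x - 1) * (x + 4) = qf a (x, y)"
        unfolding y by (simp add: qf_def a_def power2_eq_square algebra_simps)
      hence "x = 1 \<or> x = -4" using z(1) by auto
      thus ?thesis using y by auto
    qed
  qed (auto simp: off_axes_def qf_def qf_dx_def qf_dy_def jac_def a_def b_def)
  show ?thesis
    by (intro exI[of _ "quad_poly a"] exI[of _ "quad_poly b"] conjI quadratic_quad_poly)
      (simp_all add: kolmogorov_quad_poly configuration_def quadrants_def C, simp_all add: a_def b_def)
qed

lemma configuration_0112:
  "\<exists>P Q. quadratic P \<and> quadratic Q \<and> card (centers (kolmogorov P Q)) = 4 \<and>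
     configuration (kolmogorov P Q) = [0,1,1,2]"
proof -
  \<comment> \<open>Here m = 40, n = -82 and h = 2 + (80/41) x + 2 y + x^2/2 + x y + (9/20)
    y^2.\<close>
  define a b where "a = coeffs 164 160 162 41 81 36" and "b = coeffs 80 80 80 21 41 18"
  have C: "centers (vf a b) = {(-1, -1), (-4, 2), (2, -3), (2, -6)}"
  proof (rule centers_vf_eq[of 40 "-82"])
    show "divergence_free 40 (-82) a b" by (simp add: divergence_free_def a_def b_def)
    fix x y assume z: "qf a (x, y) = 0" "qf b (x, y) = 0"
    \<comment> \<open>Again a member of the pencil that splits into two lines with two centers on
      each.\<close>
    have "(x - 2) * (x + y + 2) = 2 * qf b (x, y) - qf a (x, y)"
      by (simp add: qf_def a_def b_def power2_eq_square algebra_simps)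
    hence "x = 2 \<or> y = - x - 2" using z by auto
    thus "(x, y) \<in> {(-1, -1), (-4, 2), (2, -3), (2, -6)}"
    proof
      assume x: "x = 2"
      have "18 * ((y + 3) * (y + 6)) = qf b (x, y)"
        unfolding x by (simp add: qf_def b_def power2_eq_square algebra_simps)
      hence "y = -3 \<or> y = -6" using z(2) by auto
      thus ?thesis using x by auto
    next
      assume y: "y = - x - 2"
      have "(-2) * ((x + 1) * (x + 4)) = qf b (x, y)"
        unfolding y by (simp add: qf_def b_def power2_eq_square algebra_simps)
      hence "x = -1 \<or> x = -4" using z(2) by auto
      thus ?thesis using y by auto
    qed
  qed (auto simp: off_axes_def qf_def qf_dx_def qf_dy_def jac_def a_def b_def)
  show ?thesis
    by (intro exI[of _ "quad_poly a"] exI[of _ "quad_poly b"] conjI quadratic_quad_poly)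
      (simp_all add: kolmogorov_quad_poly configuration_def quadrants_def C, simp_all add: a_def b_def)
qed

lemma four_centers_imp:
  assumes P: "quadratic P" and Q: "quadratic Q" and card: "card (centers (kolmogorov P Q)) = 4"
  shows "(\<exists>H \<in> elementary. first_integral_on off_axes (kolmogorov P Q) H) \<and>
      \<not> (\<exists>C. limit_cycle (kolmogorov P Q) C) \<and>
      (\<exists>c \<in> normal_configs. config_equiv (configuration (kolmogorov P Q)) c)"
proof -
  define a where "a i j = coeff (coeff P j) i" for i j
  define b where "b i j = coeff (coeff Q j) i" for i j
  have F: "kolmogorov P Q = vf a b"
    using quadratic_imp_quad_poly[OF P] quadratic_imp_quad_poly[OF Q] kolmogorov_quad_poly[of a b]
    by (simp add: a_def[abs_def] b_def[abs_def])
  have quad: "a 2 0 \<noteq> 0 \<or> a 1 1 \<noteq> 0 \<or> a 0 2 \<noteq> 0"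
  proof -
    obtain i j where ij: "a i j \<noteq> 0" "i + j = 2" using P by (auto simp: quadratic_def a_def)
    consider "i = 2" "j = 0" | "i = 1" "j = 1" | "i = 0" "j = 2" using ij(2) by linarith
    thus ?thesis using ij(1) by cases auto
  qed
  have card': "card (centers (vf a b)) = 4" using card F by simp
  hence "finite (centers (vf a b))" by (intro card_ge_0_finite) simp
  then obtain xs where xs: "set xs = centers (vf a b)" "distinct xs" using finite_distinct_list by blast
  hence "length xs = 4" using card' distinct_card by metis
  then obtain p1 p2 p3 p4 where p: "xs = [p1, p2, p3, p4]"
    by (auto simp: numeral_eq_Suc length_Suc_conv)
  have S: "centers (vf a b) = {p1, p2, p3, p4}" using xs(1) p by auto
  hence C: "is_center (vf a b) p1" "is_center (vf a b) p2" "is_center (vf a b) p3" "is_center (vf a b) p4"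
    unfolding centers_def by blast+
  have dist: "distinct [p1, p2, p3, p4]" using xs(2) p by simp
  obtain e1 e2 e3 e4 m n where dfree: "divergence_free m n a b"
    and e: "e1 + e2 + e3 + e4 = 0" "e1 *\<^sub>R p1 + e2 *\<^sub>R p2 + e3 *\<^sub>R p3 + e4 *\<^sub>R p4 = 0"
    and pos: "e1 * (fst p1 * snd p1) > 0" "e2 * (fst p2 * snd p2) > 0" "e3 * (fst p3 * snd p3) > 0" "e4 * (fst p4 * snd p4) > 0"
    by (rule four_centers[OF quad C dist], rule that)
  note int = integrates_kolmogorov[OF dfree]
  have "first_integral_on off_axes (vf a b) (kolmogorov_integral m n a b)"
    unfolding first_integral_on_def
    using integrates_nonconstant[OF int _ _ _ quad] integrates_constant_on[OF int] by blast
  hence "\<exists>H \<in> elementary. first_integral_on off_axes (vf a b) H"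
    using elementary_kolmogorov_integral by blast
  moreover have "\<not> limit_cycle (vf a b) C" for C
  proof
    assume L: "limit_cycle (vf a b) C"
    hence "closed_orbit (vf a b) C" by (simp add: limit_cycle_def)
    hence "C \<subseteq> off_axes" by (rule closed_orbit_vf_off_axes)
    thus False using no_limit_cycle_of_integrates[OF locally_lip_vf open_off_axes int] L by blast
  qed
  moreover have "\<exists>c \<in> normal_configs. config_equiv (configuration (vf a b)) c"
  proof (rule configuration_normal[OF card'])
    show "centers (vf a b) \<subseteq> off_axes" using center_vf_off_axes by (auto simp: centers_def)
  qed (unfold S, (rule centers_coefficients[OF pos e])+)
  ultimately show ?thesis unfolding F by blast
qed

theorem theorem5p2:
  "(\<forall>P Q. quadratic P \<and> quadratic Q \<and> card (centers (kolmogorov P Q)) = 4 \<longrightarrow>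
      (\<exists>H \<in> elementary. first_integral_on {(x, y). x * y \<noteq> 0} (kolmogorov P Q) H) \<and>
      \<not> (\<exists>C. limit_cycle (kolmogorov P Q) C) \<and>
      (\<exists>c \<in> {[1,1,1,1], [0,1,2,1], [0,1,1,2]}. config_equiv (configuration (kolmogorov P Q)) c)) \<and>
   (\<forall>c \<in> {[1,1,1,1], [0,1,2,1], [0,1,1,2]}.
      \<exists>P Q. quadratic P \<and> quadratic Q \<and> card (centers (kolmogorov P Q)) = 4 \<and>
            configuration (kolmogorov P Q) = c)"
proof (rule conjI)
  show "\<forall>P Q. quadratic P \<and> quadratic Q \<and> card (centers (kolmogorov P Q)) = 4 \<longrightarrow>
      (\<exists>H \<in> elementary. first_integral_on {(x, y). x * y \<noteq> 0} (kolmogorov P Q) H) \<and>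
      \<not> (\<exists>C. limit_cycle (kolmogorov P Q) C) \<and>
      (\<exists>c \<in> {[1,1,1,1], [0,1,2,1], [0,1,1,2]}. config_equiv (configuration (kolmogorov P Q)) c)"
    by (intro allI impI, elim conjE) (rule four_centers_imp[unfolded normal_configs_def off_axes_def])
next
  show "\<forall>c \<in> {[1,1,1,1], [0,1,2,1], [0,1,1,2]}.
      \<exists>P Q. quadratic P \<and> quadratic Q \<and> card (centers (kolmogorov P Q)) = 4 \<and>
            configuration (kolmogorov P Q) = c"
    by (intro ballI, elim insertE emptyE)
      (simp_all only: configuration_1111 configuration_0121 configuration_0112)
qed

end
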